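(* Let $\Gamma$ be a finite simplicial graph. The following are equivalent: (1) $G(\Gamma)$ is of weak type I. (2) There do not exist a vertex $x\in X(\Gamma)$ and a vertex $v\in\mathcal{P}(\Gamma)$ such that $St(v)$ separates $(F(\Gamma))_x$ (i.e. such that $(F(\Gamma))_x\setminus St(v)$ is disconnected). (3) Every element of $\mathrm{Aut}(\mathcal{P}(\Gamma))$ (the group of simplicial automorphisms of $\mathcal{P}(\Gamma)$) is visible.
   Context: For a finite simplicial graph $\Gamma$ with vertex set $\{v_i\}$, $G(\Gamma)$ is the right-angled Artin group with generators $v_i$ and relations $[v_i,v_j]=1$ whenever $v_i,v_j$ are adjacent. In a graph or simplicial complex, $lk(v)$ is the full subcomplex spanned by the vertices adjacent to $v$ and $St(v)$ is the full subcomplex spanned by $v$ and the vertices adjacent to $v$; $d$ is the combinatorial distance between vertices. $\Gamma$ is of weak type II if $\Gamma$ is connected and for all vertices $v,w\in\Gamma$ with $d(v,w)=2$, $\Gamma\setminus(lk(v)\cap lk(w))$ is connected. $G(\Gamma)$ is of weak type I if $\Gamma$ is of weak type II and $\Gamma$ does not contain any separating closed star (i.e. $\Gamma\setminus St(v)$ is never disconnected). $S(\Gamma)$ is the Salvetti complex (one vertex, one oriented labelled edge per vertex of $\Gamma$, one $n$-torus per $n$-clique), $X(\Gamma)$ its universal cover, a $CAT(0)$ cube complex; $G(\Gamma)$ is identified with the vertex set of $X(\Gamma)$. Standard flats in $X(\Gamma)$ are the lifts of the tori corresponding to cliques of $\Gamma$; one-dimensional ones are standard geodesics; a maximal standard flat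 is one not properly contained in another standard flat. Two convex subsets $C,C'$ are parallel if $d(\cdot,C)|_{C'}$ and $d(\cdot,C')|_{C}$ are constant. The extension complex $\mathcal{P}(\Gamma)$ is the flag complex whose vertices are the parallel classes of standard geodesics, two distinct vertices being joined by an edge if there are standard geodesics in the two classes which span a standard 2-flat. For a standard flat $F$, $\Delta(F)$ is the simplex of $\mathcal{P}(\Gamma)$ spanned by the parallel classes of the standard geodesics contained in $F$. $F(\Gamma)$ is the flag complex of $\Gamma$. For a vertex $x\in X(\Gamma)$, $(F(\Gamma))_x\subset\mathcal{P}(\Gamma)$ is the union of the simplexes $\Delta(F)$ over all standard flats $F$ containing $x$; it is isomorphic to $F(\Gamma)$. Visibility: let $\alpha:\mathcal{P}(\Gamma)\to\mathcal{P}(\Gamma')$ be a simplicial isomorphism. For $p\in G(\Gamma)$ let $F_1,\dots,F_n$ be all the maximal standard flats in $X(\Gamma)$ containing $p$, and let $F'_i\subset X(\Gamma')$ be the unique maximal standard flat with $\Delta(F'_i)=\alpha(\Delta(F_i))$. Then $\alpha$ is visible if $\bigcap_{i=1}^nF'_i\neq\emptyset$ for every $p\in G(\Gamma)$. *)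

theory Defs
  imports Complex_Main "HOL-Algebra.Group"
begin

section \<open>Simplicial complexes and simplicial graphs\<close>

text \<open>
  A simplicial complex is given by the set of its nonempty simplices, each simplex being a finite
  set of vertices. A simplicial graph is a simplicial complex of dimension at most one.
\<close>

definition simplicial_complex :: "'b set set \<Rightarrow> bool" where
  "simplicial_complex K \<longleftrightarrow>
     (\<forall>s\<in>K. finite s \<and> s \<noteq> {}) \<and> (\<forall>s\<in>K. \<forall>t. t \<subseteq> s \<longrightarrow> t \<noteq> {} \<longrightarrow> t \<in> K)"

definition verts :: "'b set set \<Rightarrow> 'b set" where
  "verts K = \<Union>K"

definition finite_simplicial_graph :: "'v set set \<Rightarrow> bool" where
  "finite_simplicial_graph \<Gamma> \<longleftrightarrow>
     simplicial_complex \<Gamma> \<and> finite (verts \<Gamma>) \<and> (\<forall>s\<in>\<Gamma>. card s \<le> 2)"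

definition adjacent :: "'b set set \<Rightarrow> 'b \<Rightarrow> 'b \<Rightarrow> bool" where
  "adjacent K v w \<longleftrightarrow> v \<noteq> w \<and> {v, w} \<in> K"

definition full_subcomplex :: "'b set set \<Rightarrow> 'b set \<Rightarrow> 'b set set" where
  "full_subcomplex K A = {s \<in> K. s \<subseteq> A}"

definition lk :: "'b set set \<Rightarrow> 'b \<Rightarrow> 'b set set" where
  "lk K v = full_subcomplex K {w. adjacent K v w}"

definition St :: "'b set set \<Rightarrow> 'b \<Rightarrow> 'b set set" where
  "St K v = full_subcomplex K (insert v {w. adjacent K v w})"

text \<open>
  Removing a subcomplex means deleting its vertices together with every simplex meeting them. All
  the subcomplexes removed below are full in the ambient complex, so this is a deformation retract
  of the set-theoretic complement of geometric realisations.
\<close>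

definition remove :: "'b set set \<Rightarrow> 'b set set \<Rightarrow> 'b set set" where
  "remove K L = full_subcomplex K (verts K - verts L)"

definition edge_rel :: "'b set set \<Rightarrow> ('b \<times> 'b) set" where
  "edge_rel K = {(v, w). adjacent K v w}"

text \<open>The empty complex counts as connected, so that \<open>disconnected\<close> is the plain negation.\<close>

definition connected_complex :: "'b set set \<Rightarrow> bool" where
  "connected_complex K \<longleftrightarrow> (\<forall>v\<in>verts K. \<forall>w\<in>verts K. (v, w) \<in> (edge_rel K)\<^sup>*)"

text \<open>Only meaningful for two vertices in the same component.\<close>

definition comb_dist :: "'b set set \<Rightarrow> 'b \<Rightarrow> 'b \<Rightarrow> nat" where
  "comb_dist K v w = (LEAST n. (v, w) \<in> edge_rel K ^^ n)"

definition cliques :: "'b set \<Rightarrow> ('b \<Rightarrow> 'b \<Rightarrow> bool) \<Rightarrow> 'b set set" where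
  "cliques V R = {A. A \<subseteq> V \<and> finite A \<and> pairwise R A}"

definition flag_complex :: "'b set \<Rightarrow> ('b \<Rightarrow> 'b \<Rightarrow> bool) \<Rightarrow> 'b set set" where
  "flag_complex V R = cliques V R - {{}}"

definition simplicial_iso :: "'b set set \<Rightarrow> 'c set set \<Rightarrow> ('b \<Rightarrow> 'c) \<Rightarrow> bool" where
  "simplicial_iso K L f \<longleftrightarrow>
     bij_betw f (verts K) (verts L) \<and> (\<forall>s. s \<subseteq> verts K \<longrightarrow> (s \<in> K \<longleftrightarrow> f ` s \<in> L))"

definition weak_type_II :: "'v set set \<Rightarrow> bool" where
  "weak_type_II \<Gamma> \<longleftrightarrow> connected_complex \<Gamma> \<and>
     (\<forall>v\<in>verts \<Gamma>. \<forall>w\<in>verts \<Gamma>. comb_dist \<Gamma> v w = 2 \<longrightarrow>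
        connected_complex (remove \<Gamma> (lk \<Gamma> v \<inter> lk \<Gamma> w)))"

definition weak_type_I :: "'v set set \<Rightarrow> bool" where
  "weak_type_I \<Gamma> \<longleftrightarrow> weak_type_II \<Gamma> \<and>
     (\<forall>v\<in>verts \<Gamma>. connected_complex (remove \<Gamma> (St \<Gamma> v)))"

section \<open>Right-angled Artin groups\<close>

text \<open>
  A letter \<open>(v, True)\<close> stands for the generator \<open>v\<close>, and \<open>(v, False)\<close> for its inverse. The group is
  the quotient of the monoid of words by the congruence generated by free cancellation and the
  commutators of adjacent generators.
\<close>

type_synonym 'v word = "('v \<times> bool) list"

definition words :: "'v set set \<Rightarrow> 'v word set" where
  "words \<Gamma> = lists (verts \<Gamma> \<times> UNIV)"

inductive raag_eq :: "'v set set \<Rightarrow> 'v word \<Rightarrow> 'v word \<Rightarrow> bool" for \<Gamma> where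
  refl: "u \<in> words \<Gamma> \<Longrightarrow> raag_eq \<Gamma> u u"
| sym: "raag_eq \<Gamma> u w \<Longrightarrow> raag_eq \<Gamma> w u"
| trans: "raag_eq \<Gamma> u w \<Longrightarrow> raag_eq \<Gamma> w z \<Longrightarrow> raag_eq \<Gamma> u z"
| mult: "raag_eq \<Gamma> u u' \<Longrightarrow> raag_eq \<Gamma> w w' \<Longrightarrow> raag_eq \<Gamma> (u @ w) (u' @ w')"
| cancel: "v \<in> verts \<Gamma> \<Longrightarrow> raag_eq \<Gamma> [(v, b), (v, \<not> b)] []"
| commutator: "adjacent \<Gamma> v w \<Longrightarrow>
    raag_eq \<Gamma> [(v, True), (w, True), (v, False), (w, False)] []"

definition raag_rel :: "'v set set \<Rightarrow> ('v word \<times> 'v word) set" where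
  "raag_rel \<Gamma> = {(u, w). raag_eq \<Gamma> u w}"

definition raag :: "'v set set \<Rightarrow> 'v word set monoid" where
  "raag \<Gamma> = \<lparr>carrier = words \<Gamma> // raag_rel \<Gamma>,
            monoid.mult = (\<lambda>A B. \<Union>a\<in>A. \<Union>b\<in>B. raag_rel \<Gamma> `` {a @ b}),
            one = raag_rel \<Gamma> `` {[]}\<rparr>"

definition gen :: "'v set set \<Rightarrow> 'v \<Rightarrow> 'v word set" where
  "gen \<Gamma> v = raag_rel \<Gamma> `` {[(v, True)]}"

lemma raag_eq_words: "raag_eq \<Gamma> u w \<Longrightarrow> u \<in> words \<Gamma> \<and> w \<in> words \<Gamma>"
  by (induction rule: raag_eq.induct) (auto simp: words_def adjacent_def verts_def)

lemma equiv_raag_rel: "equiv (words \<Gamma>) (raag_rel \<Gamma>)"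
proof (rule equivI)
  show "raag_rel \<Gamma> \<subseteq> words \<Gamma> \<times> words \<Gamma>"
    using raag_eq_words by (auto simp: raag_rel_def)
  show "refl_on (words \<Gamma>) (raag_rel \<Gamma>)"
    by (auto simp: refl_on_def raag_rel_def intro: raag_eq.refl)
  show "sym (raag_rel \<Gamma>)"
    by (rule symI) (simp add: raag_rel_def raag_eq.sym)
  show "trans (raag_rel \<Gamma>)"
    by (rule transI) (simp add: raag_rel_def, rule raag_eq.trans)
qed

lemma raag_mult_class:
  assumes "u \<in> words \<Gamma>" "w \<in> words \<Gamma>"
  shows "raag_rel \<Gamma> `` {u} \<otimes>\<^bsub>raag \<Gamma>\<^esub> raag_rel \<Gamma> `` {w} = raag_rel \<Gamma> `` {u @ w}"
proof -
  have eq: "raag_rel \<Gamma> `` {a @ b} = raag_rel \<Gamma> `` {u @ w}"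
    if "raag_eq \<Gamma> u a" "raag_eq \<Gamma> w b" for a b
    by (rule equiv_class_eq[OF equiv_raag_rel, symmetric])
      (simp add: raag_rel_def raag_eq.mult[OF that])
  have "(\<Union>a\<in>raag_rel \<Gamma> `` {u}. \<Union>b\<in>raag_rel \<Gamma> `` {w}. raag_rel \<Gamma> `` {a @ b}) =
      (\<Union>a\<in>raag_rel \<Gamma> `` {u}. \<Union>b\<in>raag_rel \<Gamma> `` {w}. raag_rel \<Gamma> `` {u @ w})"
    by (intro SUP_cong HOL.refl eq) (simp_all add: raag_rel_def)
  moreover have "u \<in> raag_rel \<Gamma> `` {u}" "w \<in> raag_rel \<Gamma> `` {w}"
    by (simp_all add: raag_rel_def assms raag_eq.refl)
  ultimately show ?thesis
    unfolding raag_def monoid.simps by blast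
qed

lemma raag_inverse_word:
  "u \<in> words \<Gamma> \<Longrightarrow> raag_eq \<Gamma> (map (\<lambda>(v, b). (v, \<not> b)) (rev u) @ u) []"
proof (induction u)
  case Nil
  then show ?case by (simp add: raag_eq.refl)
next
  case (Cons x u)
  obtain v b where x: "x = (v, b)" by (cases x)
  let ?i = "map (\<lambda>(v, b). (v, \<not> b)) (rev u)"
  have v: "v \<in> verts \<Gamma>" and u: "u \<in> words \<Gamma>"
    using Cons.prems x by (auto simp: words_def)
  have i: "?i \<in> words \<Gamma>"
    using u by (auto simp: words_def)
  have c: "raag_eq \<Gamma> ([(v, \<not> b), (v, b)] @ u) u"
    using raag_eq.mult[OF raag_eq.cancel[OF v, of "\<not> b"] raag_eq.refl[OF u]] by simp
  have "raag_eq \<Gamma> (?i @ [(v, \<not> b), (v, b)] @ u) (?i @ u)"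
    by (rule raag_eq.mult[OF raag_eq.refl[OF i] c])
  then have "raag_eq \<Gamma> (?i @ [(v, \<not> b), (v, b)] @ u) []"
    by (rule raag_eq.trans[OF _ Cons.IH[OF u]])
  then show ?case
    by (simp add: x)
qed

lemma group_raag: "group (raag \<Gamma>)"
proof -
  have car: "\<exists>u\<in>words \<Gamma>. x = raag_rel \<Gamma> `` {u}" if "x \<in> carrier (raag \<Gamma>)" for x
    using that unfolding raag_def partial_object.simps by (rule quotientE) blast
  have cl: "raag_rel \<Gamma> `` {u} \<in> carrier (raag \<Gamma>)" if "u \<in> words \<Gamma>" for u
    using that unfolding raag_def partial_object.simps by (rule quotientI)
  have w: "[] \<in> words \<Gamma>" "\<And>u w. u \<in> words \<Gamma> \<Longrightarrow> w \<in> words \<Gamma> \<Longrightarrow> u @ w \<in> words \<Gamma>"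
    by (auto simp: words_def)
  have one: "\<one>\<^bsub>raag \<Gamma>\<^esub> = raag_rel \<Gamma> `` {[]}"
    by (simp add: raag_def)
  show ?thesis
  proof (rule groupI)
    fix x y assume "x \<in> carrier (raag \<Gamma>)" "y \<in> carrier (raag \<Gamma>)"
    then obtain a b where "a \<in> words \<Gamma>" "b \<in> words \<Gamma>"
      "x = raag_rel \<Gamma> `` {a}" "y = raag_rel \<Gamma> `` {b}"
      using car by meson
    then show "x \<otimes>\<^bsub>raag \<Gamma>\<^esub> y \<in> carrier (raag \<Gamma>)"
      by (simp add: raag_mult_class w(2) cl)
  next
    show "\<one>\<^bsub>raag \<Gamma>\<^esub> \<in> carrier (raag \<Gamma>)"
      using one cl w(1) by simp
  next
    fix x y z assume "x \<in> carrier (raag \<Gamma>)" "y \<in> carrier (raag \<Gamma>)" "z \<in> carrier (raag \<Gamma>)"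
    then obtain a b c where "a \<in> words \<Gamma>" "b \<in> words \<Gamma>" "c \<in> words \<Gamma>"
      "x = raag_rel \<Gamma> `` {a}" "y = raag_rel \<Gamma> `` {b}" "z = raag_rel \<Gamma> `` {c}"
      using car by meson
    then show "x \<otimes>\<^bsub>raag \<Gamma>\<^esub> y \<otimes>\<^bsub>raag \<Gamma>\<^esub> z = x \<otimes>\<^bsub>raag \<Gamma>\<^esub> (y \<otimes>\<^bsub>raag \<Gamma>\<^esub> z)"
      by (simp add: raag_mult_class w(2))
  next
    fix x assume "x \<in> carrier (raag \<Gamma>)"
    then obtain a where a: "a \<in> words \<Gamma>" "x = raag_rel \<Gamma> `` {a}"
      using car by meson
    then show "\<one>\<^bsub>raag \<Gamma>\<^esub> \<otimes>\<^bsub>raag \<Gamma>\<^esub> x = x"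
      by (simp add: one raag_mult_class w(1))
    let ?i = "map (\<lambda>(v, b). (v, \<not> b)) (rev a)"
    have i: "?i \<in> words \<Gamma>"
      using a(1) by (auto simp: words_def)
    have "raag_rel \<Gamma> `` {?i} \<otimes>\<^bsub>raag \<Gamma>\<^esub> x = \<one>\<^bsub>raag \<Gamma>\<^esub>"
      unfolding one a(2) raag_mult_class[OF i a(1)]
      using raag_inverse_word[OF a(1)]
      by (intro equiv_class_eq[OF equiv_raag_rel]) (simp add: raag_rel_def)
    then show "\<exists>y\<in>carrier (raag \<Gamma>). y \<otimes>\<^bsub>raag \<Gamma>\<^esub> x = \<one>\<^bsub>raag \<Gamma>\<^esub>"
      using cl[OF i] by blast
  qed
qed

section \<open>The universal cover of the Salvetti complex\<close>

abbreviation graph_cliques :: "'v set set \<Rightarrow> 'v set set" where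
  "graph_cliques \<Gamma> \<equiv> cliques (verts \<Gamma>) (adjacent \<Gamma>)"

text \<open>
  A point of the Salvetti complex is written in its torus coordinates, taken in \<open>[0, 1)\<close>: the support
  of such a coordinate vector is a clique, namely the one indexing the open cell containing the
  point. The empty clique gives the unique vertex.
\<close>

definition salvetti :: "'v set set \<Rightarrow> ('v \<Rightarrow> real) set" where
  "salvetti \<Gamma> = {t. (\<forall>v. 0 \<le> t v \<and> t v < 1) \<and> {v. t v \<noteq> 0} \<in> graph_cliques \<Gamma>}"

text \<open>
  The open cells of the universal cover lying over the open cell of a clique \<open>K\<close> form a single free
  orbit of the deck group \<open>G(\<Gamma>)\<close>: they are the interiors of the cubes with initial vertex \<open>g\<close> and
  edges labelled by \<open>K\<close>. Hence a point of \<open>X(\<Gamma>)\<close> is a pair of a group element and a point of the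
  Salvetti complex, the covering map being the second projection, and its vertices
  are the pairs \<open>(g, 0)\<close>. How the cells are glued together is encoded in \<open>flat_map\<close>.
\<close>

type_synonym 'v point = "'v word set \<times> ('v \<Rightarrow> real)"

definition X :: "'v set set \<Rightarrow> 'v point set" where
  "X \<Gamma> = carrier (raag \<Gamma>) \<times> salvetti \<Gamma>"

definition vertex :: "'v word set \<Rightarrow> 'v point" where
  "vertex g = (g, \<lambda>_. 0)"

definition X_vertices :: "'v set set \<Rightarrow> 'v point set" where
  "X_vertices \<Gamma> = vertex ` carrier (raag \<Gamma>)"

text \<open>
  The product of the powers \<open>v [^] n v\<close>. It is used only if the support of \<open>n\<close> is a clique; the factors
  then commute, so the chosen enumeration is irrelevant.
\<close>

definition monomial :: "'v set set \<Rightarrow> ('v \<Rightarrow> int) \<Rightarrow> 'v word set" where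
  "monomial \<Gamma> n =
     foldr (\<lambda>v h. gen \<Gamma> v [^]\<^bsub>raag \<Gamma>\<^esub> n v \<otimes>\<^bsub>raag \<Gamma>\<^esub> h)
       (SOME vs. distinct vs \<and> set vs = {v. n v \<noteq> 0}) \<one>\<^bsub>raag \<Gamma>\<^esub>"

definition coords :: "'v set \<Rightarrow> ('v \<Rightarrow> real) set" where
  "coords K = {s. \<forall>v. v \<notin> K \<longrightarrow> s v = 0}"

text \<open>
  For a clique \<open>K\<close>, \<open>flat_map \<Gamma> g\<close> restricted to \<open>coords K\<close> (a copy of Euclidean space) is the lift,
  sending the origin to the vertex \<open>g\<close>, of the universal covering of the torus of \<open>K\<close>.
\<close>

definition flat_map :: "'v set set \<Rightarrow> 'v word set \<Rightarrow> ('v \<Rightarrow> real) \<Rightarrow> 'v point" where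
  "flat_map \<Gamma> g s = (g \<otimes>\<^bsub>raag \<Gamma>\<^esub> monomial \<Gamma> (\<lambda>v. \<lfloor>s v\<rfloor>), \<lambda>v. frac (s v))"

text \<open>
  The length metric: the infimum of the lengths of strings, a string being a finite sequence of
  points in which any two consecutive ones lie in a common closed unit cube.
\<close>

definition cube_coords :: "'v set \<Rightarrow> ('v \<Rightarrow> real) set" where
  "cube_coords K = {s \<in> coords K. \<forall>v\<in>K. 0 \<le> s v \<and> s v \<le> 1}"

inductive string_length :: "'v set set \<Rightarrow> 'v point \<Rightarrow> 'v point \<Rightarrow> real \<Rightarrow> bool" for \<Gamma> where
  start: "x \<in> X \<Gamma> \<Longrightarrow> string_length \<Gamma> x x 0"
| extend: "string_length \<Gamma> x (flat_map \<Gamma> g s) l \<Longrightarrow> g \<in> carrier (raag \<Gamma>) \<Longrightarrow>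
    K \<in> graph_cliques \<Gamma> \<Longrightarrow> s \<in> cube_coords K \<Longrightarrow> s' \<in> cube_coords K \<Longrightarrow>
    string_length \<Gamma> x (flat_map \<Gamma> g s') (l + sqrt (\<Sum>v\<in>K. (s v - s' v)\<^sup>2))"

definition X_dist :: "'v set set \<Rightarrow> 'v point \<Rightarrow> 'v point \<Rightarrow> real" where
  "X_dist \<Gamma> x y = Inf {l. string_length \<Gamma> x y l}"

definition X_setdist :: "'v set set \<Rightarrow> 'v point \<Rightarrow> 'v point set \<Rightarrow> real" where
  "X_setdist \<Gamma> x C = Inf (X_dist \<Gamma> x ` C)"

text \<open>Applied only to standard flats, which are convex.\<close>

definition parallel :: "'v set set \<Rightarrow> 'v point set \<Rightarrow> 'v point set \<Rightarrow> bool" where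
  "parallel \<Gamma> C C' \<longleftrightarrow>
     (\<exists>c. \<forall>x\<in>C'. X_setdist \<Gamma> x C = c) \<and> (\<exists>c. \<forall>x\<in>C. X_setdist \<Gamma> x C' = c)"

section \<open>Standard flats and the extension complex\<close>

definition standard_flats_dim :: "'v set set \<Rightarrow> nat \<Rightarrow> 'v point set set" where
  "standard_flats_dim \<Gamma> n =
     {flat_map \<Gamma> g ` coords K | g K. g \<in> carrier (raag \<Gamma>) \<and> K \<in> graph_cliques \<Gamma> \<and> card K = n}"

text \<open>The empty clique contributes the vertices, as standard flats of dimension zero.\<close>

definition standard_flats :: "'v set set \<Rightarrow> 'v point set set" where
  "standard_flats \<Gamma> = (\<Union>n. standard_flats_dim \<Gamma> n)"

abbreviation standard_geodesics :: "'v set set \<Rightarrow> 'v point set set" where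
  "standard_geodesics \<Gamma> \<equiv> standard_flats_dim \<Gamma> 1"

definition maximal_standard_flats :: "'v set set \<Rightarrow> 'v point set set" where
  "maximal_standard_flats \<Gamma> =
     {F \<in> standard_flats \<Gamma>. \<not> (\<exists>F'\<in>standard_flats \<Gamma>. F \<subset> F')}"

definition parallel_class :: "'v set set \<Rightarrow> 'v point set \<Rightarrow> 'v point set set" where
  "parallel_class \<Gamma> l = {l' \<in> standard_geodesics \<Gamma>. parallel \<Gamma> l l'}"

text \<open>\<open>F\<close> is spanned by \<open>l\<close> and \<open>l'\<close> if it is the smallest standard flat containing both.\<close>

definition span_2_flat :: "'v set set \<Rightarrow> 'v point set \<Rightarrow> 'v point set \<Rightarrow> bool" where
  "span_2_flat \<Gamma> l l' \<longleftrightarrow>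
     (\<exists>F\<in>standard_flats_dim \<Gamma> 2. l \<union> l' \<subseteq> F \<and>
        (\<forall>F'\<in>standard_flats \<Gamma>. l \<union> l' \<subseteq> F' \<longrightarrow> F \<subseteq> F'))"

definition extension_complex :: "'v set set \<Rightarrow> 'v point set set set set" where
  "extension_complex \<Gamma> =
     flag_complex (parallel_class \<Gamma> ` standard_geodesics \<Gamma>)
       (\<lambda>a b. a \<noteq> b \<and> (\<exists>l\<in>a. \<exists>l'\<in>b. span_2_flat \<Gamma> l l'))"

text \<open>The vertex set of the simplex \<open>\<Delta>(F)\<close>.\<close>

definition Delta :: "'v set set \<Rightarrow> 'v point set \<Rightarrow> 'v point set set set" where
  "Delta \<Gamma> F = parallel_class \<Gamma> ` {l \<in> standard_geodesics \<Gamma>. l \<subseteq> F}"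

text \<open>The subcomplex \<open>(F(\<Gamma>))\<^sub>x\<close>.\<close>

definition flag_at :: "'v set set \<Rightarrow> 'v point \<Rightarrow> 'v point set set set set" where
  "flag_at \<Gamma> x = {s. s \<noteq> {} \<and> (\<exists>F\<in>standard_flats \<Gamma>. x \<in> F \<and> s \<subseteq> Delta \<Gamma> F)}"

definition visible ::
  "'v set set \<Rightarrow> 'w set set \<Rightarrow> ('v point set set \<Rightarrow> 'w point set set) \<Rightarrow> bool" where
  "visible \<Gamma> \<Gamma>' \<alpha> \<longleftrightarrow>
     (\<forall>p\<in>carrier (raag \<Gamma>).
        (\<Inter>F\<in>{F \<in> maximal_standard_flats \<Gamma>. vertex p \<in> F}.
           THE F'. F' \<in> maximal_standard_flats \<Gamma>' \<and> Delta \<Gamma>' F' = \<alpha> ` Delta \<Gamma> F) \<noteq> {})"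

end

(*
  A coset of the star group of v encodes a parallel class of standard geodesics of label v, and two
  classes are adjacent in the extension complex iff their labels are adjacent and their cosets meet.
  Thus the trace on F(Gamma)_x of a star is either a star in Gamma or, projecting x to the coset, a
  set S contained in lk(v) cap lk(w) for a vertex w at distance at least 2 from v; the trace is the
  whole intersection if x is one step away. As v sees all of lk(v) cap lk(w) - S, this gives (1) <-> (2).

  If (2) holds, two maximal flats through p cannot be sent to disjoint flats: a hyperplane separating
  the images has a class q, the star of q separates their simplices, and so the star of the preimage
  of q would separate F(Gamma)_p. The Helly property of cosets then gives a common point.

  If (1) fails, hyperplanes cut the extension complex along a set fixed pointwise by some g in
  G(Gamma); moving only one of the pieces by g is a simplicial automorphism that is not visible.
*)

theory Submission
  imports Defs
begin

text \<open>The definitions are metric: parallelism compares infima of lengths of strings. No CAT(0)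
  geometry is developed for it. Two maps that do not lengthen strings, a fold onto a link and a real
  coordinate along a geodesic, decide when standard geodesics are parallel; after
  \<open>parallel_lines_iff\<close> only cosets occur. Nor is a normal form for words presupposed. A
  signed count of edges is unchanged by every defining relation. It yields half-spaces, and these
  yield the facts on geodesic words behind intersections, gates, separation and the Helly property
  of cosets. The obstacle in the last direction is a separating intersection of two links when no
  star separates. Then \<open>v\<close> and \<open>w\<close> themselves lie in different components,
  and \<open>v \<cdot> w\<close> is a translation that fixes the cut. Unlike translation along
  \<open>v\<close> in the case of a star, it does not preserve the piece to be moved but carries it
  onto vertices outside the piece. So the piece and its translate have to trade places.\<close>

locale raag_graph =
  fixes \<Gamma> :: "'v set set"
  assumes fsg: "finite_simplicial_graph \<Gamma>"
begin

sublocale G: group "raag \<Gamma>"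
  by (rule group_raag)

abbreviation "V \<equiv> verts \<Gamma>"
abbreviation "adj \<equiv> adjacent \<Gamma>"
abbreviation "C \<equiv> carrier (raag \<Gamma>)"
abbreviation mul :: "'v word set \<Rightarrow> 'v word set \<Rightarrow> 'v word set" (infixl "\<cdot>" 70)
  where "x \<cdot> y \<equiv> x \<otimes>\<^bsub>raag \<Gamma>\<^esub> y"
abbreviation inverse_elt :: "'v word set \<Rightarrow> 'v word set" ("inver")
  where "inver x \<equiv> inv\<^bsub>raag \<Gamma>\<^esub> x"
abbreviation "one_elt \<equiv> \<one>\<^bsub>raag \<Gamma>\<^esub>"

definition nbr :: "'v \<Rightarrow> 'v set" where "nbr v = {w. adj v w}"
definition star :: "'v \<Rightarrow> 'v set" where "star v = insert v (nbr v)"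
definition cl :: "'v word \<Rightarrow> 'v word set" where "cl u = raag_rel \<Gamma> `` {u}"
definition linv :: "'v \<times> bool \<Rightarrow> 'v \<times> bool" where "linv s = (fst s, \<not> snd s)"
definition winv :: "'v word \<Rightarrow> 'v word" where "winv u = map linv (rev u)"
definition par :: "'v set \<Rightarrow> 'v word set set" where
  "par A = cl ` {u \<in> words \<Gamma>. fst ` set u \<subseteq> A}"
text \<open>\<open>par A\<close> is the special subgroup on \<open>A\<close>. For a clique
  \<open>A\<close> the coset is the vertex set of a standard flat; for a star it collects the
  vertices of all geodesics in one parallel class.\<close>

definition lc :: "'v word set \<Rightarrow> 'v set \<Rightarrow> 'v word set set" where
  "lc g A = (\<lambda>z. g \<cdot> z) ` par A"

subsection \<open>Words and group elements\<close>

lemma finite_V: "finite V"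
  using fsg by (simp add: finite_simplicial_graph_def)

lemma singleton_simplex: "v \<in> V \<Longrightarrow> {v} \<in> \<Gamma>"
  using fsg by (force simp: finite_simplicial_graph_def simplicial_complex_def verts_def)

lemma adj_V: "adj a b \<Longrightarrow> a \<in> V" "adj a b \<Longrightarrow> b \<in> V"
  by (auto simp: adjacent_def verts_def)

lemma adj_sym: "adj a b \<Longrightarrow> adj b a"
  by (auto simp: adjacent_def insert_commute)

lemma adj_irrefl [simp]: "\<not> adj a a"
  by (simp add: adjacent_def)

lemma nbr_V: "nbr v \<subseteq> V"
  by (auto simp: nbr_def adj_V)

lemma star_V: "v \<in> V \<Longrightarrow> star v \<subseteq> V"
  using nbr_V by (auto simp: star_def)

lemma words_Nil [simp]: "[] \<in> words \<Gamma>"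
  by (simp add: words_def)

lemma words_Cons [simp]: "s # u \<in> words \<Gamma> \<longleftrightarrow> fst s \<in> V \<and> u \<in> words \<Gamma>"
  by (cases s) (auto simp: words_def)

lemma words_append [simp]: "u @ w \<in> words \<Gamma> \<longleftrightarrow> u \<in> words \<Gamma> \<and> w \<in> words \<Gamma>"
  by (auto simp: words_def)

lemma cl_in: "u \<in> words \<Gamma> \<Longrightarrow> cl u \<in> C"
  unfolding cl_def raag_def partial_object.simps by (rule quotientI)

lemma cl_append: "u \<in> words \<Gamma> \<Longrightarrow> w \<in> words \<Gamma> \<Longrightarrow> cl (u @ w) = cl u \<cdot> cl w"
  unfolding cl_def by (rule raag_mult_class[symmetric])

lemma cl_Nil [simp]: "cl [] = one_elt"
  by (simp add: cl_def raag_def)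

lemma cl_eqI: "raag_eq \<Gamma> u w \<Longrightarrow> cl u = cl w"
  unfolding cl_def by (rule equiv_class_eq[OF equiv_raag_rel]) (simp add: raag_rel_def)

lemma cl_eqD: "cl u = cl w \<Longrightarrow> w \<in> words \<Gamma> \<Longrightarrow> raag_eq \<Gamma> u w"
  unfolding cl_def using eq_equiv_class[OF _ equiv_raag_rel] by (fastforce simp: raag_rel_def)

lemma cl_surj: "x \<in> C \<Longrightarrow> \<exists>u\<in>words \<Gamma>. x = cl u"
  unfolding cl_def raag_def partial_object.simps by (rule quotientE) blast+

lemma cl_Cons: "fst s \<in> V \<Longrightarrow> u \<in> words \<Gamma> \<Longrightarrow> cl (s # u) = cl [s] \<cdot> cl u"
  using cl_append[of "[s]" u] by simp

lemma fst_linv [simp]: "fst (linv s) = fst s"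
  by (simp add: linv_def)

lemma linv_linv [simp]: "linv (linv s) = s"
  by (simp add: linv_def)

lemma linv_neq [simp]: "linv s \<noteq> s" "s \<noteq> linv s"
  by (auto simp: linv_def prod_eq_iff)

lemma letter_in [simp]: "fst s \<in> V \<Longrightarrow> cl [s] \<in> C"
  by (rule cl_in) simp

lemma cl_linv: assumes "fst s \<in> V" shows "cl [linv s] = inver (cl [s])"
proof -
  obtain v b where s: "s = (v, b)" by (cases s)
  have "cl [s] \<cdot> cl [linv s] = one_elt"
    using assms cl_eqI[OF raag_eq.cancel[of v \<Gamma> b]] cl_append[of "[s]" "[linv s]"]
    by (simp add: s linv_def)
  then show ?thesis
    using assms by (metis G.inv_equality G.inv_inv G.inv_closed fst_linv letter_in)
qed

lemma letter_cancel:
  assumes "fst s \<in> V" "x \<in> C"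
  shows "x \<cdot> cl [s] \<cdot> cl [linv s] = x" "x \<cdot> cl [linv s] \<cdot> cl [s] = x"
  using assms by (simp_all add: cl_linv G.m_assoc)

lemma inv_cancel:
  "x \<in> C \<Longrightarrow> y \<in> C \<Longrightarrow> inver x \<cdot> (x \<cdot> y) = y"
  "x \<in> C \<Longrightarrow> y \<in> C \<Longrightarrow> x \<cdot> (inver x \<cdot> y) = y"
  by (simp_all flip: G.m_assoc)

lemma winv_words [simp]: "winv u \<in> words \<Gamma> \<longleftrightarrow> u \<in> words \<Gamma>"
  by (induction u) (auto simp: winv_def)

lemma winv_simps [simp]:
  "winv [] = []" "winv (u @ w) = winv w @ winv u" "winv (s # u) = winv u @ [linv s]"
  "winv (winv u) = u" "length (winv u) = length u" "fst ` set (winv u) = fst ` set u"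
  by (auto simp: winv_def rev_map image_image map_idI)

lemma cl_winv: "u \<in> words \<Gamma> \<Longrightarrow> cl (winv u) = inver (cl u)"
proof (induction u)
  case (Cons s u)
  then have "cl (winv (s # u)) = cl (winv u) \<cdot> cl [linv s]"
    by (simp add: cl_append)
  then show ?case
    using Cons by (simp add: cl_linv cl_Cons[of s u] G.inv_mult_group cl_in)
qed simp

lemma comm_inv:
  assumes "x \<in> C" "y \<in> C" "x \<cdot> y = y \<cdot> x"
  shows "inver x \<cdot> y = y \<cdot> inver x"
proof -
  have "inver x \<cdot> y = inver x \<cdot> (y \<cdot> x) \<cdot> inver x"
    using assms(1,2) by (simp add: G.m_assoc)
  also have "\<dots> = y \<cdot> inver x"
    using assms(1,2) by (simp flip: assms(3) G.m_assoc)
  finally show ?thesis .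
qed

text \<open>The relator says that the two positive letters commute; the other signs follow by
  passing to inverses one letter at a time.\<close>

lemma letters_commute:
  assumes "adj (fst s) (fst t)"
  shows "cl [s] \<cdot> cl [t] = cl [t] \<cdot> cl [s]"
proof -
  let ?x = "cl [(fst s, True)]" and ?y = "cl [(fst t, True)]"
  have V: "fst s \<in> V" "fst t \<in> V" using adj_V assms by auto
  then have C: "?x \<in> C" "?y \<in> C" by auto
  have i: "cl [(fst s, False)] = inver ?x" "cl [(fst t, False)] = inver ?y"
    using V cl_linv[of "(fst s, True)"] cl_linv[of "(fst t, True)"] by (auto simp: linv_def)
  have "?x \<cdot> (?y \<cdot> (inver ?x \<cdot> inver ?y)) = one_elt"
    using cl_eqI[OF raag_eq.commutator[OF assms]] V
    by (simp add: cl_Cons[where u="_ # _"] i)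
  then have "?x \<cdot> ?y \<cdot> inver (?y \<cdot> ?x) = one_elt"
    using C by (simp add: G.inv_mult_group G.m_assoc)
  then have xy: "?x \<cdot> ?y = ?y \<cdot> ?x"
    using C by (metis G.inv_equality G.inv_inv G.inv_closed G.m_closed)
  have ix: "inver ?x \<cdot> ?y = ?y \<cdot> inver ?x" by (rule comm_inv) (use C xy in auto)
  have iy: "inver ?y \<cdot> ?x = ?x \<cdot> inver ?y" by (rule comm_inv) (use C xy in auto)
  have ixy: "inver ?x \<cdot> inver ?y = inver ?y \<cdot> inver ?x" by (rule comm_inv) (use C iy in auto)
  have "cl [s] \<in> {?x, inver ?x}" "cl [t] \<in> {?y, inver ?y}"
    using i by (cases s; cases t; cases "snd s"; cases "snd t"; simp)+
  then show ?thesis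
    using xy ix iy ixy by auto
qed

lemma parI: "u \<in> words \<Gamma> \<Longrightarrow> fst ` set u \<subseteq> A \<Longrightarrow> cl u \<in> par A"
  by (auto simp: par_def)

lemma par_in: "z \<in> par A \<Longrightarrow> z \<in> C"
  by (auto simp: par_def cl_in)

lemma par_one [simp]: "one_elt \<in> par A"
  using parI[of "[]" A] by simp

lemma par_mult: "y \<in> par A \<Longrightarrow> z \<in> par A \<Longrightarrow> y \<cdot> z \<in> par A"
  by (auto simp: par_def image_iff) (metis (no_types, lifting) cl_append le_sup_iff image_Un set_append words_append)

lemma par_inv: assumes "z \<in> par A" shows "inver z \<in> par A"
proof -
  obtain u where "z = cl u" "u \<in> words \<Gamma>" "fst ` set u \<subseteq> A"
    using assms by (auto simp: par_def)
  then show ?thesis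
    using parI[of "winv u" A] by (simp add: cl_winv)
qed

lemma par_mono: "A \<subseteq> B \<Longrightarrow> par A \<subseteq> par B"
  by (auto simp: par_def)

lemma par_letter: "fst s \<in> V \<Longrightarrow> fst s \<in> A \<Longrightarrow> cl [s] \<in> par A"
  by (rule parI) auto

lemma par_nbr_commute:
  assumes "z \<in> par (nbr (fst s))"
  shows "cl [s] \<cdot> z = z \<cdot> cl [s]"
proof (cases "fst s \<in> V")
  case True
  obtain u where u: "z = cl u" "u \<in> words \<Gamma>" "fst ` set u \<subseteq> nbr (fst s)"
    using assms by (auto simp: par_def)
  from u(2,3) have "cl [s] \<cdot> cl u = cl u \<cdot> cl [s]"
  proof (induction u)
    case (Cons t u)
    have t: "cl [s] \<cdot> cl [t] = cl [t] \<cdot> cl [s]"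
      by (rule letters_commute) (use Cons in \<open>auto simp: nbr_def\<close>)
    have "cl [s] \<cdot> cl (t # u) = cl [s] \<cdot> cl [t] \<cdot> cl u"
      using Cons True by (simp add: cl_Cons[of t u] G.m_assoc cl_in)
    also have "\<dots> = cl [t] \<cdot> (cl [s] \<cdot> cl u)"
      unfolding t using Cons True by (simp add: G.m_assoc cl_in)
    also have "\<dots> = cl (t # u) \<cdot> cl [s]"
      using Cons True by (simp add: cl_Cons[of t u] G.m_assoc cl_in)
    finally show ?case .
  qed (use True in simp)
  then show ?thesis using u by simp
next
  case False
  then have "nbr (fst s) = {}" using adj_V by (auto simp: nbr_def)
  then have "z = one_elt" using assms by (auto simp: par_def)
  \<comment> \<open>No pair of \<open>raag_rel\<close> contains a word with a letter outside
    \<open>V\<close>. The class is empty, and so are both products.\<close>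
  moreover have "cl [s] = {}"
    using False raag_eq_words by (fastforce simp: cl_def raag_rel_def)
  ultimately show ?thesis
    by (simp add: raag_def)
qed

lemma lcI: "z \<in> par A \<Longrightarrow> g \<cdot> z \<in> lc g A"
  by (auto simp: lc_def)

lemma lc_self [simp]: "g \<in> C \<Longrightarrow> g \<in> lc g A"
  using lcI[of one_elt A g] by simp

lemma lc_in: "g \<in> C \<Longrightarrow> y \<in> lc g A \<Longrightarrow> y \<in> C"
  by (auto simp: lc_def par_in)

lemma lc_iff: assumes "g \<in> C" "y \<in> C" shows "y \<in> lc g A \<longleftrightarrow> inver g \<cdot> y \<in> par A"
proof
  assume "y \<in> lc g A"
  then obtain z where "z \<in> par A" "y = g \<cdot> z" by (auto simp: lc_def)
  then show "inver g \<cdot> y \<in> par A"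
    using assms by (simp add: par_in flip: G.m_assoc)
next
  assume "inver g \<cdot> y \<in> par A"
  then have "g \<cdot> (inver g \<cdot> y) \<in> lc g A" by (rule lcI)
  then show "y \<in> lc g A"
    using assms by (simp flip: G.m_assoc)
qed

lemma lc_sym: assumes g: "g \<in> C" and y: "y \<in> lc g A" shows "g \<in> lc y A"
proof -
  have "y \<in> C" by (rule lc_in[OF g y])
  then show ?thesis
    using par_inv[of "inver g \<cdot> y" A] g y by (simp add: lc_iff G.inv_mult_group)
qed

lemma lc_trans: assumes "g \<in> C" "y \<in> lc g A" "z \<in> lc y A" shows "z \<in> lc g A"
proof -
  obtain a b where ab: "a \<in> par A" "b \<in> par A" "y = g \<cdot> a" "z = y \<cdot> b"
    using assms by (auto simp: lc_def)
  then show ?thesis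
    using lcI[OF par_mult[OF ab(1,2)], of g] assms(1) by (simp add: G.m_assoc par_in)
qed

lemma lc_eq: "g \<in> C \<Longrightarrow> y \<in> lc g A \<Longrightarrow> lc y A = lc g A"
  by (intro equalityI subsetI) (blast intro: lc_trans lc_sym lc_in)+

lemma lc_step: "g \<in> C \<Longrightarrow> y \<in> lc g A \<Longrightarrow> fst t \<in> V \<Longrightarrow> fst t \<in> A \<Longrightarrow> y \<cdot> cl [t] \<in> lc g A"
  using lc_trans lcI par_letter by blast

lemma lc_step_iff: assumes "g \<in> C" "y \<in> C" "fst t \<in> V" "fst t \<in> A"
  shows "y \<cdot> cl [t] \<in> lc g A \<longleftrightarrow> y \<in> lc g A"
  using lc_step[of g y A t] lc_step[of g "y \<cdot> cl [t]" A "linv t"] assms by (auto simp: letter_cancel)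

lemma lc_mono: "A \<subseteq> B \<Longrightarrow> lc g A \<subseteq> lc g B"
  unfolding lc_def by (intro image_mono par_mono)

lemma lc_mult_left:
  assumes "k \<in> C" "g \<in> C" "y \<in> C"
  shows "k \<cdot> y \<in> lc (k \<cdot> g) A \<longleftrightarrow> y \<in> lc g A"
  using assms by (simp add: lc_iff G.inv_mult_group G.m_assoc inv_cancel)

subsection \<open>Crossing numbers and half-spaces\<close>

text \<open>
  Signed count, along a path starting at \<open>y\<close>, of the edges labelled \<open>s\<close> that issue from a point of \<open>E\<close>.
  If \<open>E\<close> is invariant under the link of the label, every defining relation has count zero, so the
  count depends on the end points only. Cosets of the link group yield the hyperplanes of \<open>X(\<Gamma>)\<close>,
  and cosets of the star group yield the coordinate along a standard geodesic.
\<close>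

fun cnt :: "'v word set set \<Rightarrow> 'v \<times> bool \<Rightarrow> 'v word set \<Rightarrow> 'v word \<Rightarrow> int" where
  "cnt E s y [] = 0"
| "cnt E s y (t # u) =
     (if t = s \<and> y \<in> E then 1 else if t = linv s \<and> y \<cdot> cl [t] \<in> E then -1 else 0) + cnt E s (y \<cdot> cl [t]) u"

definition lk_invariant :: "'v word set set \<Rightarrow> 'v \<Rightarrow> bool" where
  "lk_invariant E v \<longleftrightarrow> (\<forall>y\<in>C. \<forall>t. adj v (fst t) \<longrightarrow> (y \<cdot> cl [t] \<in> E \<longleftrightarrow> y \<in> E))"

lemma cnt_append: "x \<in> C \<Longrightarrow> u \<in> words \<Gamma> \<Longrightarrow> w \<in> words \<Gamma> \<Longrightarrow>
    cnt E s x (u @ w) = cnt E s x u + cnt E s (x \<cdot> cl u) w"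
proof (induction u arbitrary: x)
  case (Cons t u)
  then show ?case by (simp add: cl_Cons[of t u] G.m_assoc cl_in)
qed simp

lemma cnt_raag_eq:
  assumes "raag_eq \<Gamma> u w" "lk_invariant E (fst s)" "x \<in> C"
  shows "cnt E s x u = cnt E s x w"
  using assms(1,3)
proof (induction arbitrary: x rule: raag_eq.induct)
  case (mult u u' w w')
  have "cl u = cl u'" "u \<in> words \<Gamma>" "u' \<in> words \<Gamma>" "w \<in> words \<Gamma>" "w' \<in> words \<Gamma>"
    using cl_eqI[OF mult(1)] raag_eq_words[OF mult(1)] raag_eq_words[OF mult(2)] by auto
  then show ?case
    using mult by (simp add: cnt_append cl_in)
next
  case (cancel v b)
  then show ?case
    using letter_cancel(1)[of "(v, b)" x] by (cases s) (auto simp: linv_def)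
next
  case (commutator v w)
  have V: "v \<in> V" "w \<in> V" and ad: "adj w v" using commutator adj_V adj_sym by auto
  define a a' b b' where ab: "a = cl [(v, True)]" "a' = cl [(v, False)]" "b = cl [(w, True)]" "b' = cl [(w, False)]"
  have C: "a \<in> C" "b \<in> C" and i: "a' = inver a" "b' = inver b"
    using V cl_linv[of "(v, True)"] cl_linv[of "(w, True)"] by (auto simp: ab linv_def)
  have "a \<cdot> b = b \<cdot> a" unfolding ab by (rule letters_commute) (use commutator in auto)
  then have 2: "x \<cdot> a \<cdot> b = x \<cdot> b \<cdot> a"
    using C commutator(2) by (simp_all add: i G.m_assoc)
  have 4: "x \<cdot> b \<cdot> a \<cdot> a' = x \<cdot> b" using C commutator(2) by (simp_all add: i G.m_assoc)
  have 3: "x \<cdot> b \<cdot> b' = x" using C commutator(2) by (simp_all add: i G.m_assoc)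
  \<comment> \<open>Opposite edges of the square with label \<open>fst s\<close> are traversed in
    opposite directions, and invariance puts both or neither of their initial points into
    \<open>E\<close>.\<close>
  have inv: "y \<cdot> a \<in> E \<longleftrightarrow> y \<in> E" if "fst s = w" "y \<in> C" for y
    using assms(2) that ad by (auto simp: lk_invariant_def ab)
  have inv': "y \<cdot> b \<in> E \<longleftrightarrow> y \<in> E" if "fst s = v" "y \<in> C" for y
    using assms(2) that commutator(1) by (auto simp: lk_invariant_def ab)
  have vw: "v \<noteq> w" using commutator(1) by auto
  have f: "x \<cdot> b \<in> C" "x \<cdot> a \<in> C" using C commutator(2) by auto
  obtain c d where s: "s = (c, d)" by (cases s)
  show ?case
    unfolding cnt.simps ab[symmetric] s
    using vw 3 inv[OF _ commutator(2)] inv[OF _ f(1)] inv'[OF _ commutator(2)] inv'[OF _ f(2)]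
    by (auto simp: linv_def 2 4 s)
qed auto

definition crs :: "'v word set set \<Rightarrow> 'v \<times> bool \<Rightarrow> 'v word set \<Rightarrow> 'v word set \<Rightarrow> int" where
  "crs E s x y = cnt E s x (SOME u. u \<in> words \<Gamma> \<and> x \<cdot> cl u = y)"

lemma crs_word:
  assumes "lk_invariant E (fst s)" "x \<in> C" "u \<in> words \<Gamma>"
  shows "crs E s x (x \<cdot> cl u) = cnt E s x u"
proof -
  define w where "w = (SOME w. w \<in> words \<Gamma> \<and> x \<cdot> cl w = x \<cdot> cl u)"
  have "w \<in> words \<Gamma> \<and> x \<cdot> cl w = x \<cdot> cl u"
    unfolding w_def by (rule someI[of _ u]) (use assms in auto)
  then have "raag_eq \<Gamma> w u"
    using assms by (intro cl_eqD) (auto simp: cl_in)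
  from cnt_raag_eq[OF this assms(1,2)] show ?thesis
    by (simp add: crs_def w_def)
qed

lemma path_ex: assumes "x \<in> C" "y \<in> C" obtains u where "u \<in> words \<Gamma>" "y = x \<cdot> cl u"
proof -
  obtain u where "u \<in> words \<Gamma>" "inver x \<cdot> y = cl u"
    using cl_surj[of "inver x \<cdot> y"] assms by auto
  then show ?thesis
    using that[of u] assms by (metis G.inv_closed G.inv_inv G.inv_solve_left cl_in)
qed

lemma crs_step:
  assumes "lk_invariant E (fst s)" "x \<in> C" "y \<in> C" "fst t \<in> V"
  shows "crs E s x (y \<cdot> cl [t]) = crs E s x y +
    (if t = s \<and> y \<in> E then 1 else if t = linv s \<and> y \<cdot> cl [t] \<in> E then -1 else 0)"
proof -
  obtain u where u: "u \<in> words \<Gamma>" "y = x \<cdot> cl u" using path_ex assms by blast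
  have "y \<cdot> cl [t] = x \<cdot> cl (u @ [t])"
    using u assms by (simp add: cl_append G.m_assoc cl_in)
  then have "crs E s x (y \<cdot> cl [t]) = cnt E s x (u @ [t])"
    using crs_word[OF assms(1,2), of "u @ [t]"] u assms by simp
  then show ?thesis
    using crs_word[OF assms(1,2) u(1)] u assms by (simp add: cnt_append)
qed

lemma crs_self [simp]: "lk_invariant E (fst s) \<Longrightarrow> x \<in> C \<Longrightarrow> crs E s x x = 0"
  using crs_word[of E s x "[]"] by simp

text \<open>A coset is connected along edges labelled in \<open>A\<close>, so a property that
  survives these edges spreads from any one point to all. With \<open>A = V\<close> this is
  induction over the whole group.\<close>

lemma coset_induct [consumes 3, case_names base step]:
  assumes "g \<in> C" "x \<in> lc g A" "y \<in> lc g A" "P x"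
    "\<And>y t. y \<in> lc g A \<Longrightarrow> P y \<Longrightarrow> fst t \<in> V \<Longrightarrow> fst t \<in> A \<Longrightarrow> P (y \<cdot> cl [t])"
  shows "P y"
proof -
  have x: "x \<in> C" using assms lc_in by blast
  have "y \<in> lc x A" using assms lc_eq by blast
  then obtain u where u: "u \<in> words \<Gamma>" "fst ` set u \<subseteq> A" "y = x \<cdot> cl u"
    by (auto simp: lc_def par_def)
  from u(1,2) have "P (x \<cdot> cl u) \<and> x \<cdot> cl u \<in> lc g A"
  proof (induction u rule: rev_induct)
    case (snoc t u)
    then have "P (x \<cdot> cl u \<cdot> cl [t]) \<and> x \<cdot> cl u \<cdot> cl [t] \<in> lc g A"
      using assms(1,5) lc_step by auto
    then show ?case
      using snoc.prems x by (simp add: cl_append G.m_assoc cl_in)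
  qed (use assms x in simp)
  then show ?thesis using u by simp
qed

text \<open>
  The half-space containing \<open>p \<cdot> s\<close> that is bounded by the hyperplane dual to the edge from \<open>p\<close>
  to \<open>p \<cdot> s\<close>. The crossing number takes only the values 0 and 1 because all edges crossing this
  hyperplane issue from one coset of the link group, on which it vanishes.
\<close>

definition far :: "'v word set \<Rightarrow> 'v \<times> bool \<Rightarrow> 'v word set \<Rightarrow> bool" where
  "far p s y \<longleftrightarrow> crs (lc p (nbr (fst s))) s p y = 1"

lemma words_iff: "u \<in> words \<Gamma> \<longleftrightarrow> fst ` set u \<subseteq> V"
  by (induction u) auto

lemma par_V: "par V = C"
  using cl_surj by (auto simp: par_def cl_in words_iff[symmetric])

lemma lc_V: "p \<in> C \<Longrightarrow> lc p V = C"
proof (intro equalityI subsetI)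
  assume "p \<in> C"
  then show "y \<in> C" if "y \<in> lc p V" for y using that by (rule lc_in)
  show "y \<in> lc p V" if "y \<in> C" for y using that \<open>p \<in> C\<close> by (simp add: lc_iff par_V)
qed

lemma lk_invariant_lc: "p \<in> C \<Longrightarrow> nbr v \<subseteq> A \<Longrightarrow> lk_invariant (lc p A) v"
  unfolding lk_invariant_def using lc_step_iff adj_V by (auto simp: nbr_def)

lemma crs_lc_nbr:
  assumes p: "p \<in> C" and s: "fst s \<in> V" and y: "y \<in> lc p (nbr (fst s))"
  shows "crs (lc p (nbr (fst s))) s p y = 0"
proof -
  let ?E = "lc p (nbr (fst s))"
  have inv: "lk_invariant ?E (fst s)" by (rule lk_invariant_lc) (use p in auto)
  show ?thesis
  proof (rule coset_induct[OF p _ y, where x = p])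
    fix y and t :: "'v \<times> bool" assume "y \<in> ?E" "crs ?E s p y = 0" "fst t \<in> V" "fst t \<in> nbr (fst s)"
    moreover from this have "t \<noteq> s" "t \<noteq> linv s" by (auto simp: nbr_def)
    ultimately show "crs ?E s p (y \<cdot> cl [t]) = 0"
      using crs_step[OF inv p lc_in[OF p]] by auto
  qed (use p inv in auto)
qed

lemma crs_01:
  assumes p: "p \<in> C" and s: "fst s \<in> V" and y: "y \<in> C"
  shows "crs (lc p (nbr (fst s))) s p y \<in> {0, 1}"
proof -
  let ?E = "lc p (nbr (fst s))"
  have inv: "lk_invariant ?E (fst s)" by (rule lk_invariant_lc) (use p in auto)
  have "p \<in> lc p V" "y \<in> lc p V"
    using p y lc_V by auto
  from p this show ?thesis
  proof (induction rule: coset_induct)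
    case (step y t)
    then have y: "y \<in> C" using lc_in[OF p] by auto
    then show ?case
      using step crs_step[OF inv p y step(3)] crs_lc_nbr[OF p s, of y] crs_lc_nbr[OF p s, of "y \<cdot> cl [t]"]
      by auto
  qed (use p inv in simp)
qed

lemma far_coset:
  assumes p: "p \<in> C" and s: "fst s \<in> V" and y: "y \<in> lc p (nbr (fst s))"
  shows "\<not> far p s y" "far p s (y \<cdot> cl [s])"
proof -
  have inv: "lk_invariant (lc p (nbr (fst s))) (fst s)" by (rule lk_invariant_lc) (use p in auto)
  show "\<not> far p s y" "far p s (y \<cdot> cl [s])"
    using crs_lc_nbr[OF p s y] crs_step[OF inv p lc_in[OF p y] s] y by (auto simp: far_def)
qed

lemma far_self: "p \<in> C \<Longrightarrow> fst s \<in> V \<Longrightarrow> \<not> far p s p" "p \<in> C \<Longrightarrow> fst s \<in> V \<Longrightarrow> far p s (p \<cdot> cl [s])"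
  using far_coset[of p s p] by auto

lemma far_step:
  assumes p: "p \<in> C" and s: "fst s \<in> V" and y: "y \<in> C" and t: "fst t \<in> V"
    and ne: "far p s y \<noteq> far p s (y \<cdot> cl [t])"
  shows "t = s \<and> y \<in> lc p (nbr (fst s)) \<and> \<not> far p s y \<or>
    t = linv s \<and> y \<cdot> cl [t] \<in> lc p (nbr (fst s)) \<and> far p s y"
proof -
  have inv: "lk_invariant (lc p (nbr (fst s))) (fst s)" by (rule lk_invariant_lc) (use p in auto)
  define c where "c = crs (lc p (nbr (fst s))) s p y"
  define d where "d = crs (lc p (nbr (fst s))) s p (y \<cdot> cl [t])"
  define P Q where "P \<longleftrightarrow> t = s \<and> y \<in> lc p (nbr (fst s))"
    and "Q \<longleftrightarrow> t = linv s \<and> y \<cdot> cl [t] \<in> lc p (nbr (fst s))"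
  have "d = c + (if P then 1 else if Q then -1 else 0)"
    unfolding c_def d_def P_def Q_def by (rule crs_step[OF inv p y t])
  moreover have "c = 0 \<or> c = 1" "d = 0 \<or> d = 1"
    using crs_01[OF p s] y t by (auto simp: c_def d_def)
  moreover have "(c = 1) \<noteq> (d = 1)" "far p s y \<longleftrightarrow> c = 1"
    using ne by (simp_all add: far_def c_def d_def)
  ultimately have "P \<and> \<not> far p s y \<or> Q \<and> far p s y"
    by (cases P; cases Q; elim disjE; simp)
  then show ?thesis
    unfolding P_def Q_def by simp
qed


section \<open>Geodesic words and the walls they cross\<close>

definition geo :: "'v word \<Rightarrow> bool" where
  "geo u \<longleftrightarrow> u \<in> words \<Gamma> \<and> (\<forall>w\<in>words \<Gamma>. cl w = cl u \<longrightarrow> length u \<le> length w)"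

lemma geo_words: "geo u \<Longrightarrow> u \<in> words \<Gamma>"
  by (simp add: geo_def)

lemma geo_le: "geo u \<Longrightarrow> w \<in> words \<Gamma> \<Longrightarrow> cl w = cl u \<Longrightarrow> length u \<le> length w"
  by (simp add: geo_def)

lemma geo_ex: assumes "x \<in> C" obtains u where "geo u" "cl u = x"
proof -
  obtain v where "v \<in> words \<Gamma>" "x = cl v" using cl_surj assms by blast
  then obtain u where "u \<in> words \<Gamma> \<and> cl u = x" "\<And>w. w \<in> words \<Gamma> \<and> cl w = x \<Longrightarrow> length u \<le> length w"
    using ex_has_least_nat[of "\<lambda>u. u \<in> words \<Gamma> \<and> cl u = x" v length] by blast
  then show ?thesis using that by (auto simp: geo_def)
qed

lemma geo_append: assumes "geo (u @ w)" shows "geo u" "geo w"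
proof -
  have uw: "u \<in> words \<Gamma>" "w \<in> words \<Gamma>" using geo_words[OF assms] by auto
  show "geo u" unfolding geo_def
  proof (intro conjI ballI impI)
    fix z assume "z \<in> words \<Gamma>" "cl z = cl u"
    then show "length u \<le> length z"
      using geo_le[OF assms, of "z @ w"] uw by (simp add: cl_append)
  qed (rule uw)
  show "geo w" unfolding geo_def
  proof (intro conjI ballI impI)
    fix z assume "z \<in> words \<Gamma>" "cl z = cl w"
    then show "length w \<le> length z"
      using geo_le[OF assms, of "u @ z"] uw by (simp add: cl_append)
  qed (rule uw)
qed

lemma geo_winv: assumes "geo u" shows "geo (winv u)"
  unfolding geo_def
proof (intro conjI ballI impI)
  have u: "u \<in> words \<Gamma>" by (rule geo_words[OF assms])
  show "winv u \<in> words \<Gamma>" using u by simp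
  fix z assume z: "z \<in> words \<Gamma>" "cl z = cl (winv u)"
  then have "cl (winv z) = cl u" using u by (simp add: cl_winv cl_in)
  then show "length (winv u) \<le> length z"
    using geo_le[OF assms, of "winv z"] z by simp
qed

lemma word_flip:
  assumes "x \<in> C" "u \<in> words \<Gamma>" "F x \<noteq> F (x \<cdot> cl u)"
  shows "\<exists>u1 t u2. u = u1 @ t # u2 \<and> F (x \<cdot> cl u1) = F x \<and> F (x \<cdot> cl u1 \<cdot> cl [t]) \<noteq> F x"
  using assms
proof (induction u arbitrary: x)
  case (Cons t u)
  show ?case
  proof (cases "F (x \<cdot> cl [t]) = F x")
    case True
    have e: "x \<cdot> cl [t] \<cdot> cl u = x \<cdot> cl (t # u)"
      using Cons by (simp add: cl_Cons[of t u] G.m_assoc cl_in)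
    obtain u1 t' u2 where h: "u = u1 @ t' # u2" "F (x \<cdot> cl [t] \<cdot> cl u1) = F (x \<cdot> cl [t])"
        "F (x \<cdot> cl [t] \<cdot> cl u1 \<cdot> cl [t']) \<noteq> F (x \<cdot> cl [t])"
      using Cons.IH[of "x \<cdot> cl [t]"] Cons.prems True e by auto
    moreover have "x \<cdot> cl [t] \<cdot> cl u1 = x \<cdot> cl (t # u1)"
      using Cons h by (simp add: cl_Cons[of t u1] G.m_assoc cl_in)
    ultimately show ?thesis using True by (metis append_Cons)
  next
    case False
    have "F (x \<cdot> cl []) = F x" "F (x \<cdot> cl [] \<cdot> cl [t]) \<noteq> F x" using Cons.prems False by auto
    then show ?thesis by (metis append_Nil)
  qed
qed simp

lemma far_step_iff:
  assumes p: "p \<in> C" and s: "fst s \<in> V" and y: "y \<in> C" and t: "fst t \<in> V"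
  shows "far p s y \<noteq> far p s (y \<cdot> cl [t]) \<longleftrightarrow>
    t = s \<and> y \<in> lc p (nbr (fst s)) \<or> t = linv s \<and> y \<cdot> cl [t] \<in> lc p (nbr (fst s))"
proof
  assume "far p s y \<noteq> far p s (y \<cdot> cl [t])"
  then show "t = s \<and> y \<in> lc p (nbr (fst s)) \<or> t = linv s \<and> y \<cdot> cl [t] \<in> lc p (nbr (fst s))"
    using far_step[OF p s y t] by blast
next
  assume "t = s \<and> y \<in> lc p (nbr (fst s)) \<or> t = linv s \<and> y \<cdot> cl [t] \<in> lc p (nbr (fst s))"
  then show "far p s y \<noteq> far p s (y \<cdot> cl [t])"
  proof
    assume "t = s \<and> y \<in> lc p (nbr (fst s))"
    then show ?thesis using far_coset[OF p s, of y] by simp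
  next
    assume a: "t = linv s \<and> y \<cdot> cl [t] \<in> lc p (nbr (fst s))"
    then have "y \<cdot> cl [t] \<cdot> cl [s] = y" using letter_cancel(2)[OF s y] by simp
    then show ?thesis using far_coset[OF p s, of "y \<cdot> cl [t]"] a by auto
  qed
qed

text \<open>An element of the link group commutes with \<open>s\<close>; applied to the conjugate,
  this undoes the conjugation.\<close>

lemma par_nbr_conj:
  assumes s: "fst s \<in> V" and z: "z \<in> C" and c: "cl [s] \<cdot> z \<cdot> cl [linv s] \<in> par (nbr (fst s))"
  shows "cl [s] \<cdot> z \<cdot> cl [linv s] = z"
proof -
  let ?k = "cl [s] \<cdot> z \<cdot> cl [linv s]"
  have "cl [s] \<cdot> ?k = ?k \<cdot> cl [s]" by (rule par_nbr_commute[OF c])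
  also have "\<dots> = cl [s] \<cdot> z" using s z by (simp add: letter_cancel)
  finally show ?thesis using s z by simp
qed

text \<open>Since \<open>s\<close> commutes with the link group, right multiplication by
  \<open>s\<close> carries the initial points of the edges dual to a wall to their end points. The
  converse is the same fact for \<open>linv s\<close>.\<close>

lemma lc_nbr_mult:
  assumes s: "fst s \<in> V" and p: "p \<in> C" and y: "y \<in> C"
  shows "y \<cdot> cl [s] \<in> lc (p \<cdot> cl [s]) (nbr (fst s)) \<longleftrightarrow> y \<in> lc p (nbr (fst s))"
proof -
  have *: "y \<cdot> cl [t] \<in> lc (p \<cdot> cl [t]) (nbr (fst t))"
    if t: "fst t \<in> V" and py: "p \<in> C" "y \<in> C" and m: "y \<in> lc p (nbr (fst t))" for t p y
  proof -
    obtain z where z: "z \<in> par (nbr (fst t))" "y = p \<cdot> z" using m by (auto simp: lc_def)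
    have "y \<cdot> cl [t] = p \<cdot> cl [t] \<cdot> z"
      using par_nbr_commute[OF z(1)] z py t by (simp add: G.m_assoc par_in)
    then show ?thesis using z lcI by simp
  qed
  show ?thesis
    using *[of s p y] *[of "linv s" "p \<cdot> cl [s]" "y \<cdot> cl [s]"] assms by (auto simp: letter_cancel)
qed

text \<open>Both predicates change along exactly the same edges and take opposite values at
  \<open>p\<close>, so they stay opposite on the whole group.\<close>

lemma far_flip:
  assumes p: "p \<in> C" and s: "fst s \<in> V" and y: "y \<in> C"
  shows "far (p \<cdot> cl [s]) (linv s) y \<longleftrightarrow> \<not> far p s y"
proof -
  let ?q = "p \<cdot> cl [s]"
  have q: "?q \<in> C" and ls: "fst (linv s) \<in> V" using p s by auto
  have "p \<in> lc p V" "y \<in> lc p V" using lc_V p y by auto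
  from p this show ?thesis
  proof (induction rule: coset_induct)
    case base
    have "?q \<cdot> cl [linv s] = p" using letter_cancel(1)[OF s p] .
    then show ?case using far_self(2)[OF q ls] far_self(1)[OF p s] by simp
  next
    case (step y t)
    have y: "y \<in> C" using step.hyps(1) lc_V p by simp
    have "y \<in> lc ?q (nbr (fst s)) \<longleftrightarrow> y \<cdot> cl [t] \<in> lc p (nbr (fst s))" if "t = linv s"
      using lc_nbr_mult[OF s p, of "y \<cdot> cl [t]"] y s that letter_cancel(2)[OF s y] by simp
    moreover have "y \<cdot> cl [t] \<in> lc ?q (nbr (fst s)) \<longleftrightarrow> y \<in> lc p (nbr (fst s))" if "t = s"
      using lc_nbr_mult[OF s p, of y] y that by simp
    ultimately have "far ?q (linv s) y \<noteq> far ?q (linv s) (y \<cdot> cl [t]) \<longleftrightarrow> far p s y \<noteq> far p s (y \<cdot> cl [t])"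
      unfolding far_step_iff[OF q ls y step.hyps(2)] far_step_iff[OF p s y step.hyps(2)] by auto
    then show ?case using step.IH by blast
  qed
qed

text \<open>
  A second crossing of the same hyperplane would enclose a word that commutes with \<open>s\<close>, and the two
  crossing letters could be deleted.
\<close>

lemma geo_far_end:
  assumes g: "geo (s # m)" and p: "p \<in> C"
  shows "far p s (p \<cdot> cl (s # m))"
proof (rule ccontr)
  assume nf: "\<not> far p s (p \<cdot> cl (s # m))"
  have s: "fst s \<in> V" and m: "m \<in> words \<Gamma>" using geo_words[OF g] by auto
  let ?q = "p \<cdot> cl [s]"
  have q: "?q \<in> C" and fq: "far p s ?q" using far_self p s by auto
  have e: "p \<cdot> cl (s # m) = ?q \<cdot> cl m" using p s m by (simp add: cl_Cons[of s m] G.m_assoc cl_in)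
  obtain m1 t m2 where h: "m = m1 @ t # m2" "far p s (?q \<cdot> cl m1)" "\<not> far p s (?q \<cdot> cl m1 \<cdot> cl [t])"
    using word_flip[OF q m, of "far p s"] fq nf e by auto
  have w: "m1 \<in> words \<Gamma>" "fst t \<in> V" "m2 \<in> words \<Gamma>" using m h by auto
  have t: "t = linv s" "?q \<cdot> cl m1 \<cdot> cl [t] \<in> lc p (nbr (fst s))"
    using far_step[OF p s _ w(2), of "?q \<cdot> cl m1"] h w q by (auto simp: cl_in)
  let ?k = "cl [s] \<cdot> cl m1 \<cdot> cl [linv s]"
  \<comment> \<open>Both crossings have their outer ends in the link coset of \<open>p\<close>, so
    the element leading from one to the other lies in the link group.\<close>
  have "?k \<in> par (nbr (fst s))"
    using t w p s by (simp add: lc_iff cl_in G.m_assoc inv_cancel)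
  then have k: "?k = cl m1" by (intro par_nbr_conj) (use s w in \<open>auto simp: cl_in\<close>)
  have "cl (s # m) = cl ((s # m1 @ [t]) @ m2)" using h by simp
  also have "\<dots> = ?k \<cdot> cl m2"
    using s w by (subst cl_append) (simp_all add: t cl_Cons[of s "m1 @ _"] cl_append G.m_assoc cl_in)
  finally have "cl (m1 @ m2) = cl (s # m)" using k w by (simp add: cl_append)
  then show False using geo_le[OF g, of "m1 @ m2"] w h by simp
qed

text \<open>The inverse word, read from the other end, crosses the same wall in the opposite
  direction, which reduces the claim to \<open>geo_far_end\<close> and
  \<open>far_flip\<close>.\<close>

lemma geo_far_start:
  assumes g: "geo (m @ [s])" and p: "p \<in> C"
  shows "\<not> far (p \<cdot> cl m) s p"
proof -
  have s: "fst s \<in> V" and m: "m \<in> words \<Gamma>" using geo_words[OF g] by auto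
  let ?q = "p \<cdot> cl m \<cdot> cl [s]"
  have q: "p \<cdot> cl m \<in> C" "?q \<in> C" using p s m by (auto simp: cl_in)
  have "far ?q (linv s) (?q \<cdot> cl (linv s # winv m))"
    using geo_winv[OF g] q by (intro geo_far_end) auto
  moreover have "?q \<cdot> cl (linv s # winv m) = p"
    using p s m by (simp add: cl_Cons[of "linv s" "winv m"] cl_linv cl_winv cl_in G.m_assoc inv_cancel)
  ultimately show ?thesis using far_flip[OF q(1) s p] by simp
qed

text \<open>Only edges labelled \<open>fst s\<close> cross the wall, and the coset has none.\<close>

lemma far_const:
  assumes "p \<in> C" "fst s \<in> V" "g \<in> C" "x \<in> lc g A" "y \<in> lc g A" "fst s \<notin> A"
  shows "far p s x = far p s y"
  using assms(3-5)
proof (induction rule: coset_induct)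
  case (step y t)
  have "t \<noteq> s" "t \<noteq> linv s" using assms(6) step by auto
  then show ?case
    using far_step[OF assms(1,2) lc_in[OF assms(3) step.hyps(1)] step.hyps(2)] step.IH by blast
qed simp

text \<open>The wall of each letter of a geodesic word separates the two ends of the path, while the
  same ends are joined inside \<open>par A\<close>; hence the letter is labelled in
  \<open>A\<close>. This takes the place of a normal form theorem.\<close>

lemma par_geo_labels:
  assumes z: "cl u \<in> par A" and g: "geo u"
  shows "fst ` set u \<subseteq> A"
proof
  fix a assume "a \<in> fst ` set u"
  then obtain s where s: "s \<in> set u" "a = fst s" by auto
  then obtain u0 u1 where u: "u = u0 @ s # u1" by (meson split_list)
  have w: "u0 \<in> words \<Gamma>" "fst s \<in> V" "u1 \<in> words \<Gamma>" using geo_words[OF g] u by auto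
  have g': "geo (u0 @ [s])" "geo (s # u1)"
    using geo_append[of "u0 @ [s]" u1] geo_append[of u0 "s # u1"] g u by auto
  have e: "cl u = cl u0 \<cdot> cl (s # u1)" using w u by (simp add: cl_append)
  have "far (cl u0) s (cl u)" "\<not> far (cl u0) s one_elt"
    using geo_far_end[OF g'(2), of "cl u0"] geo_far_start[OF g'(1), of one_elt] w e by (auto simp: cl_in)
  moreover have "one_elt \<in> lc one_elt A" "cl u \<in> lc one_elt A" using lcI[OF z, of one_elt] geo_words[OF g] by (auto simp: cl_in)
  ultimately show "a \<in> A"
    using far_const[of "cl u0" s one_elt _ A] w s by (metis G.one_closed cl_in)
qed

text \<open>One geodesic word for the element has its labels in \<open>A\<close> and in
  \<open>B\<close> at once.\<close>

lemma par_Int: "par (A \<inter> B) = par A \<inter> par B"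
proof (intro equalityI subsetI)
  fix z assume z: "z \<in> par A \<inter> par B"
  then obtain u where u: "geo u" "cl u = z" using geo_ex par_in by blast
  then have "fst ` set u \<subseteq> A \<inter> B" using par_geo_labels z by blast
  then show "z \<in> par (A \<inter> B)" using parI[OF geo_words[OF u(1)]] u by blast
qed (use par_mono[of "A \<inter> B"] in blast)

lemma lc_Int:
  assumes "g \<in> C" "h \<in> C" "x \<in> lc g A" "x \<in> lc h B"
  shows "lc g A \<inter> lc h B = lc x (A \<inter> B)"
proof -
  have x: "x \<in> C" using assms lc_in by blast
  have "lc g A = lc x A" "lc h B = lc x B" using lc_eq assms by blast+
  moreover have "y \<in> lc x A \<inter> lc x B \<longleftrightarrow> y \<in> lc x (A \<inter> B)" for y
    using lc_iff[OF x, of y] lc_in[OF x, of y] par_Int by blast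
  ultimately show ?thesis by blast
qed

lemma raag_eq_parity: "raag_eq \<Gamma> u w \<Longrightarrow> even (length u + length w)"
  by (induction rule: raag_eq.induct) auto

text \<open>Some geodesic word for \<open>cl u\<close> ends with the inverse of \<open>s\<close>.
  The wall of that last edge separates the identity from \<open>cl u\<close>, so \<open>u\<close>
  crosses it too; what \<open>u\<close> reads after the crossing runs along the wall and therefore
  lies in the link group.\<close>

lemma geo_exchange:
  assumes g: "geo u" and s: "fst s \<in> V" and ng: "\<not> geo (u @ [s])"
  shows "\<exists>u1 u2. u = u1 @ linv s # u2 \<and> fst ` set u2 \<subseteq> nbr (fst s)"
proof -
  have uw: "u \<in> words \<Gamma>" by (rule geo_words[OF g])
  have us: "u @ [s] \<in> words \<Gamma>" using uw s by simp
  obtain w where w: "geo w" "cl w = cl (u @ [s])" using geo_ex[OF cl_in[OF us]] .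
  note ww = geo_words[OF w(1)]
  obtain w' where "w' \<in> words \<Gamma>" "cl w' = cl (u @ [s])" "length w' < length (u @ [s])"
    using ng us by (auto simp: geo_def not_le)
  then have "length w \<le> length u" using geo_le[OF w(1), of w'] w by simp
  \<comment> \<open>Relators have even length, which excludes
    \<open>length w = length u\<close>.\<close>
  moreover have "even (length w + length (u @ [s]))"
    using raag_eq_parity cl_eqD[OF w(2) us] by blast
  ultimately have lt: "length w < length u" by (cases "length w = length u") auto
  have e: "cl u = cl w \<cdot> cl [linv s]"
    using w uw s by (simp add: cl_append letter_cancel cl_in)
  then have e': "cl (w @ [linv s]) = cl u" using ww s by (simp add: cl_append)
  then have len: "length u = length w + 1" using geo_le[OF g, of "w @ [linv s]"] ww s lt by simp
  have gw: "geo (w @ [linv s])"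
    using g len e' ww s by (simp add: geo_def)
  let ?p = "cl w"
  have p: "?p \<in> C" and ls: "fst (linv s) \<in> V" using ww s by (auto simp: cl_in)
  have "\<not> far ?p (linv s) one_elt" using geo_far_start[OF gw, of one_elt] p by simp
  moreover have "far ?p (linv s) (one_elt \<cdot> cl u)" using far_self(2)[OF p ls] cl_in[OF uw] by (simp add: e)
  ultimately obtain u1 t u2 where h: "u = u1 @ t # u2"
    "\<not> far ?p (linv s) (one_elt \<cdot> cl u1)" "far ?p (linv s) (one_elt \<cdot> cl u1 \<cdot> cl [t])"
    using word_flip[of one_elt u "far ?p (linv s)"] uw by auto
  have uu: "u1 \<in> words \<Gamma>" "fst t \<in> V" "u2 \<in> words \<Gamma>" using uw h by auto
  have t: "t = linv s" "cl u1 \<in> lc ?p (nbr (fst s))"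
    using far_step[OF p ls _ uu(2), of "cl u1"] h uu by (auto simp: cl_in)
  then obtain k where k: "k \<in> par (nbr (fst s))" "cl u1 = ?p \<cdot> k" by (auto simp: lc_def)
  have "cl w \<cdot> cl [linv s] = cl u1 \<cdot> (cl [linv s] \<cdot> cl u2)"
    using h uu s e t by (simp add: cl_append cl_Cons[of "linv s" u2])
  also have "\<dots> = ?p \<cdot> (cl [linv s] \<cdot> (k \<cdot> cl u2))"
    using par_nbr_commute[of k "linv s"] k uu p s by (simp add: G.m_assoc cl_in par_in)
      (simp flip: G.m_assoc add: par_in cl_in)
  finally have "k \<cdot> cl u2 = one_elt"
    using k uu p s by (simp add: cl_in par_in)
  then have "cl u2 = inver k" using k uu by (metis G.inv_equality G.inv_inv G.inv_closed cl_in par_in)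
  then have "cl u2 \<in> par (nbr (fst s))" using par_inv k by simp
  moreover have "geo u2" using geo_append(2)[of "u1 @ [t]" u2] g h by simp
  ultimately show ?thesis using par_geo_labels h t by blast
qed

section \<open>Gates, the Helly property and separation of cosets\<close>

lemma cl_cancel_swap:
  assumes "u1 \<in> words \<Gamma>" "u2 \<in> words \<Gamma>" "fst s \<in> V" "fst ` set u2 \<subseteq> nbr (fst s)"
  shows "cl (u1 @ linv s # u2 @ [s]) = cl (u1 @ u2)"
proof -
  have "cl u2 \<in> par (nbr (fst s))" using parI assms by blast
  then have "cl u2 \<cdot> cl [s] = cl [s] \<cdot> cl u2" using par_nbr_commute by simp
  then show ?thesis
    using assms by (simp add: cl_append cl_Cons[of "linv s" "u2 @ _"] cl_in cl_linv inv_cancel)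
qed

text \<open>If the extension by a letter \<open>s\<close> were not geodesic, exchange would cancel
  \<open>s\<close> against a letter of \<open>w\<close>, so that \<open>w\<close> followed by
  \<open>s\<close> is not geodesic, or against a letter of \<open>r\<close>, which gives a shorter
  path into the coset.\<close>

lemma gate_geo:
  assumes x: "x \<in> C" and g: "g \<in> C" and r: "r \<in> words \<Gamma>" "x \<cdot> cl r \<in> lc g A"
    and min: "\<And>r'. r' \<in> words \<Gamma> \<Longrightarrow> x \<cdot> cl r' \<in> lc g A \<Longrightarrow> length r \<le> length r'"
    and w: "geo w" "fst ` set w \<subseteq> A"
  shows "geo (r @ w)"
  using w
proof (induction w rule: rev_induct)
  case Nil
  then show ?case using r min by (auto simp: geo_def)
next
  case (snoc s w)
  have gw: "geo w" using geo_append snoc by blast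
  then have IH: "geo (r @ w)" using snoc by simp
  have s: "fst s \<in> V" "fst s \<in> A" using geo_words[OF snoc(2)] snoc by auto
  note rw = geo_words[OF IH]
  show ?case
  proof (rule ccontr)
    assume "\<not> geo (r @ w @ [s])"
    then obtain u1 u2 where u: "r @ w = u1 @ linv s # u2" "fst ` set u2 \<subseteq> nbr (fst s)"
      using geo_exchange[OF IH s(1)] by auto
    from u(1) consider w1 where "w = w1 @ linv s # u2" | r2 where "r = u1 @ linv s # r2" "u2 = r2 @ w"
      by (auto simp: append_eq_append_conv2 Cons_eq_append_conv append_eq_Cons_conv)
    then show False
    proof cases
      case 1
      then have "cl (w @ [s]) = cl (w1 @ u2)" using cl_cancel_swap[of w1 u2 s] u s rw by simp
      then show False using geo_le[OF snoc(2), of "w1 @ u2"] rw 1 by simp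
    next
      case 2
      have "cl (r @ [s]) = cl (u1 @ r2)" using cl_cancel_swap[of u1 r2 s] u s rw 2 by auto
      moreover have "x \<cdot> cl r \<cdot> cl [s] \<in> lc g A" using lc_step g r s by blast
      ultimately have "x \<cdot> cl (u1 @ r2) \<in> lc g A" using x r s by (simp add: cl_append G.m_assoc cl_in)
      then show False using min[of "u1 @ r2"] rw 2 by simp
    qed
  qed
qed

text \<open>The end of \<open>r\<close> is the gate of \<open>x\<close>: every geodesic word in
  \<open>A\<close> prolongs \<open>r\<close> to a geodesic, so each point of the coset is reached
  geodesically through the gate.\<close>

lemma gate_ex:
  assumes x: "x \<in> C" and g: "g \<in> C"
  obtains r where "geo r" "x \<cdot> cl r \<in> lc g A" "\<And>w. geo w \<Longrightarrow> fst ` set w \<subseteq> A \<Longrightarrow> geo (r @ w)"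
proof -
  obtain r0 where "r0 \<in> words \<Gamma>" "g = x \<cdot> cl r0" using path_ex[OF x g] .
  then have r0: "r0 \<in> words \<Gamma> \<and> x \<cdot> cl r0 \<in> lc g A" using g by simp
  obtain r where r: "r \<in> words \<Gamma> \<and> x \<cdot> cl r \<in> lc g A"
    and min: "\<And>r'. r' \<in> words \<Gamma> \<and> x \<cdot> cl r' \<in> lc g A \<Longrightarrow> length r \<le> length r'"
    using ex_has_least_nat[of "\<lambda>r. r \<in> words \<Gamma> \<and> x \<cdot> cl r \<in> lc g A" r0 length] r0 by blast
  have *: "geo (r @ w)" if "geo w" "fst ` set w \<subseteq> A" for w
    using gate_geo[OF x g _ _ _ that] r min by blast
  moreover have "geo []" by (simp add: geo_def)
  ultimately have "geo r" using *[of "[]"] by simp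
  then show ?thesis using that * r by blast
qed

text \<open>Some geodesic from \<open>x\<close> to the common point \<open>z\<close> starts with
  \<open>r\<close>, and all its labels lie in \<open>B\<close> because its ends lie in one coset of
  \<open>par B\<close>.\<close>

lemma gate_labels:
  assumes x: "x \<in> C" and g: "g \<in> C" and r: "r \<in> words \<Gamma>" "x \<cdot> cl r \<in> lc g A"
    "\<And>w. geo w \<Longrightarrow> fst ` set w \<subseteq> A \<Longrightarrow> geo (r @ w)"
    and z: "z \<in> lc g A" "z \<in> lc x B"
  shows "fst ` set r \<subseteq> B"
proof -
  have zC: "z \<in> C" using lc_in g z by blast
  have y: "x \<cdot> cl r \<in> C" using x r by (simp add: cl_in)
  have "z \<in> lc (x \<cdot> cl r) A" using lc_eq[OF g r(2)] z by simp
  then have "inver (x \<cdot> cl r) \<cdot> z \<in> par A" using lc_iff y zC by blast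
  then obtain w where w: "geo w" "cl w = inver (x \<cdot> cl r) \<cdot> z" using geo_ex par_in by metis
  then have "fst ` set w \<subseteq> A" using par_geo_labels \<open>_ \<in> par A\<close> by metis
  then have gg: "geo (r @ w)" using r w by blast
  have "x \<cdot> cl (r @ w) = z"
    using w r x zC geo_words[OF w(1)] by (simp add: cl_append cl_in G.inv_mult_group G.m_assoc inv_cancel)
  then have "cl (r @ w) \<in> par B"
    using z(2) lc_iff[OF x zC] x geo_words[OF gg] by (auto simp: inv_cancel cl_in)
  then show ?thesis using par_geo_labels[OF _ gg] by auto
qed

text \<open>Take a point common to the second and third cosets and move to its gate in the first. By
  \<open>gate_labels\<close> the path stays in both of the others.\<close>

lemma lc_helly3:
  assumes "g \<in> C" "h \<in> C" "k \<in> C"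
    and ab: "lc g A \<inter> lc h B \<noteq> {}" and ac: "lc g A \<inter> lc k D \<noteq> {}" and bc: "lc h B \<inter> lc k D \<noteq> {}"
  shows "lc g A \<inter> lc h B \<inter> lc k D \<noteq> {}"
proof -
  obtain x where x: "x \<in> lc h B" "x \<in> lc k D" using bc by blast
  then have xC: "x \<in> C" using lc_in assms by blast
  have e: "lc h B = lc x B" "lc k D = lc x D" using lc_eq assms x by blast+
  obtain r where r: "geo r" "x \<cdot> cl r \<in> lc g A" "\<And>w. geo w \<Longrightarrow> fst ` set w \<subseteq> A \<Longrightarrow> geo (r @ w)"
    using gate_ex[OF xC assms(1)] by metis
  note rw = geo_words[OF r(1)]
  obtain z z' where z: "z \<in> lc g A" "z \<in> lc x B" "z' \<in> lc g A" "z' \<in> lc x D" using ab ac e by blast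
  have "fst ` set r \<subseteq> B" "fst ` set r \<subseteq> D"
    using gate_labels[OF xC assms(1) rw r(2,3)] z by blast+
  then have "x \<cdot> cl r \<in> lc x B" "x \<cdot> cl r \<in> lc x D" using rw by (auto intro!: lcI parI)
  then show ?thesis using r e by blast
qed

text \<open>Intersecting the cosets with the newly added one gives cosets of smaller special
  subgroups, and these still meet pairwise by the case of three.\<close>

lemma lc_helly:
  assumes "finite I" "\<And>i. i \<in> I \<Longrightarrow> g i \<in> C" "\<And>i j. i \<in> I \<Longrightarrow> j \<in> I \<Longrightarrow> lc (g i) (A i) \<inter> lc (g j) (A j) \<noteq> {}"
  shows "\<exists>x\<in>C. \<forall>i\<in>I. x \<in> lc (g i) (A i)"
  using assms
proof (induction I arbitrary: g A rule: finite_induct)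
  case (insert j I)
  show ?case
  proof (cases "I = {}")
    case True
    then show ?thesis using insert.prems(1)[of j] by (intro bexI[of _ "g j"]) auto
  next
    case False
    define h where "h i = (SOME x. x \<in> lc (g i) (A i) \<inter> lc (g j) (A j))" for i
    have h: "h i \<in> lc (g i) (A i)" "h i \<in> lc (g j) (A j)" if "i \<in> I" for i
      using someI_ex[of "\<lambda>x. x \<in> lc (g i) (A i) \<inter> lc (g j) (A j)"] insert.prems(2)[of i j] that
      unfolding h_def by blast+
    have e: "lc (g i) (A i) \<inter> lc (g j) (A j) = lc (h i) (A i \<inter> A j)" if "i \<in> I" for i
      by (rule lc_Int) (use insert.prems(1) h that in auto)
    have "\<exists>x\<in>C. \<forall>i\<in>I. x \<in> lc (h i) (A i \<inter> A j)"
    proof (rule insert.IH)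
      show "h i \<in> C" if "i \<in> I" for i using h[OF that] lc_in insert.prems(1) by blast
      show "lc (h i) (A i \<inter> A j) \<inter> lc (h k) (A k \<inter> A j) \<noteq> {}" if "i \<in> I" "k \<in> I" for i k
        using lc_helly3[of "g i" "g k" "g j" "A i" "A k" "A j"] insert.prems that
        by (simp flip: e) blast
    qed
    then show ?thesis using e False by blast
  qed
qed (use G.one_closed in blast)

text \<open>The wall is dual to the first edge of a shortest path \<open>r\<close> between the
  cosets. Both ends of \<open>r\<close> are gates, so \<open>r\<close> or its inverse is prolonged
  to a geodesic by any geodesic running inside the coset at its end, and a geodesic does not cross
  back over the wall.\<close>

lemma lc_separation:
  assumes g: "g \<in> C" and h: "h \<in> C" and dis: "lc g A \<inter> lc h B = {}"
  obtains x s where "x \<in> C" "fst s \<in> V" "\<And>y. y \<in> lc g A \<Longrightarrow> \<not> far x s y" "\<And>y. y \<in> lc h B \<Longrightarrow> far x s y"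
proof -
  define P where "P r \<longleftrightarrow> r \<in> words \<Gamma> \<and> (\<exists>x\<in>lc g A. x \<cdot> cl r \<in> lc h B)" for r
  obtain r0 where "r0 \<in> words \<Gamma>" "h = g \<cdot> cl r0" using path_ex[OF g h] .
  then have "P r0" using g h unfolding P_def by (metis lc_self)
  then obtain r where "P r" and minP: "\<And>r'. P r' \<Longrightarrow> length r \<le> length r'"
    using ex_has_least_nat[of P r0 length] by blast
  then obtain x where x: "x \<in> lc g A" "x \<cdot> cl r \<in> lc h B" and r: "r \<in> words \<Gamma>" by (auto simp: P_def)
  have xC: "x \<in> C" using lc_in g x by blast
  have "r \<noteq> []" using x xC dis by auto
  then obtain s m where rs: "r = s # m" by (cases r) auto
  have s: "fst s \<in> V" and m: "m \<in> words \<Gamma>" using r rs by auto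
  have yC: "x \<cdot> cl r \<in> C" using xC r by (simp add: cl_in)
  have g1: "geo (r @ w)" if "geo w" "fst ` set w \<subseteq> B" for w
    by (rule gate_geo[OF xC h r x(2) _ that]) (use minP x P_def in blast)
  \<comment> \<open>Read backwards, \<open>r\<close> is a shortest path from its end into the first
    coset.\<close>
  have g2: "geo (winv r @ w)" if "geo w" "fst ` set w \<subseteq> A" for w
  proof (rule gate_geo[OF yC g _ _ _ that])
    show "winv r \<in> words \<Gamma>" using r by simp
    show "x \<cdot> cl r \<cdot> cl (winv r) \<in> lc g A" using x xC r by (simp add: cl_winv cl_in G.m_assoc)
    fix r' assume r': "r' \<in> words \<Gamma>" "x \<cdot> cl r \<cdot> cl r' \<in> lc g A"
    have "x \<cdot> cl r \<cdot> cl r' \<cdot> cl (winv r') = x \<cdot> cl r"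
      using xC r r' by (simp add: cl_winv cl_in G.m_assoc)
    then have "P (winv r')" unfolding P_def using r' x by (metis winv_words)
    then show "length (winv r) \<le> length r'" using minP by fastforce
  qed
  have A: "\<not> far x s y" if "y \<in> lc g A" for y
  proof -
    have y: "y \<in> C" using lc_in g that by blast
    have "y \<in> lc x A" using lc_eq[OF g x(1)] that by simp
    then have p: "inver x \<cdot> y \<in> par A" using lc_iff xC y by blast
    then obtain w where w: "geo w" "cl w = inver x \<cdot> y" using geo_ex par_in by metis
    then have "geo (winv r @ w)" using g2 par_geo_labels p by metis
    then have "geo (linv s # w)" using geo_append(2)[of "winv m" "linv s # w"] rs by simp
    then have "far (x \<cdot> cl [s]) (linv s) (x \<cdot> cl [s] \<cdot> cl (linv s # w))"
      using xC s by (intro geo_far_end) auto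
    moreover have "x \<cdot> cl [s] \<cdot> cl (linv s # w) = y"
      using w geo_words[OF w(1)] xC y s by (simp add: cl_Cons[of "linv s" w] cl_linv G.m_assoc inv_cancel)
    ultimately show ?thesis using far_flip[OF xC s y] by simp
  qed
  have B: "far x s y" if "y \<in> lc h B" for y
  proof -
    have y: "y \<in> C" using lc_in h that by blast
    have "y \<in> lc (x \<cdot> cl r) B" using lc_eq[OF h x(2)] that by simp
    then have p: "inver (x \<cdot> cl r) \<cdot> y \<in> par B" using lc_iff yC y by blast
    then obtain w where w: "geo w" "cl w = inver (x \<cdot> cl r) \<cdot> y" using geo_ex par_in by metis
    then have gg: "geo (s # m @ w)" using g1[of w] par_geo_labels p rs by simp
    have "x \<cdot> cl (r @ w) = y"
      using w r xC y geo_words[OF w(1)] by (simp add: cl_append cl_in G.inv_mult_group G.m_assoc inv_cancel)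
    then show ?thesis using geo_far_end[OF gg xC] rs by simp
  qed
  show ?thesis using that[OF xC s A B] .
qed


section \<open>Powers of a generator and cliques\<close>

definition gpow :: "'v \<Rightarrow> int \<Rightarrow> 'v word set" where
  "gpow v k = cl [(v, True)] [^]\<^bsub>raag \<Gamma>\<^esub> k"

lemma gpow_in [simp]: "v \<in> V \<Longrightarrow> gpow v k \<in> C"
  by (simp add: gpow_def)

lemma gpow_add: "v \<in> V \<Longrightarrow> gpow v (j + k) = gpow v j \<cdot> gpow v k"
  by (simp add: gpow_def G.int_pow_mult)

lemma gpow_0 [simp]: "gpow v 0 = one_elt"
  by (simp add: gpow_def)

lemma gpow_1: "v \<in> V \<Longrightarrow> gpow v 1 = cl [(v, True)]"
  by (simp add: gpow_def)

lemma gpow_m1: "v \<in> V \<Longrightarrow> gpow v (-1) = cl [(v, False)]"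
  using cl_linv[of "(v, True)"] by (simp add: gpow_def linv_def G.int_pow_neg)

lemma gpow_letter: "v \<in> V \<Longrightarrow> cl [(v, b)] = gpow v (if b then 1 else -1)"
  by (simp add: gpow_1 gpow_m1)

lemma gpow_induct [consumes 1, case_names zero up down]:
  assumes "v \<in> V" "P (0::int)" "\<And>k. P k \<Longrightarrow> P (k + 1)" "\<And>k. P k \<Longrightarrow> P (k - 1)"
  shows "P k"
  using int_induct[of P 0 k] assms by blast

lemma gpow_par: assumes v: "v \<in> V" and A: "v \<in> A" shows "gpow v k \<in> par A"
  using v
proof (induction k rule: gpow_induct)
  case (up k)
  then show ?case
    using par_mult[of "gpow v k" A "gpow v 1"] par_letter[of "(v, True)" A] v A by (simp add: gpow_add gpow_1)
next
  case (down k)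
  then show ?case
    using par_mult[of "gpow v k" A "gpow v (-1)"] par_letter[of "(v, False)" A] gpow_add[of v k "-1"] v A
    by (simp add: gpow_m1)
qed simp

lemma par_commute:
  assumes "y \<in> par A" "z \<in> par B" "\<And>a b. a \<in> A \<Longrightarrow> b \<in> B \<Longrightarrow> adj a b"
  shows "y \<cdot> z = z \<cdot> y"
proof -
  obtain u where u: "y = cl u" "u \<in> words \<Gamma>" "fst ` set u \<subseteq> A" using assms by (auto simp: par_def)
  have z: "z \<in> C" using assms par_in by blast
  from u(2,3) have "cl u \<cdot> z = z \<cdot> cl u"
  proof (induction u)
    case (Cons t u)
    have "B \<subseteq> nbr (fst t)" using assms(3) Cons.prems by (auto simp: nbr_def)
    then have t: "cl [t] \<cdot> z = z \<cdot> cl [t]" using par_nbr_commute assms(2) par_mono by blast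
    have "cl (t # u) \<cdot> z = cl [t] \<cdot> (z \<cdot> cl u)"
      using Cons z by (simp add: cl_Cons[of t u] G.m_assoc cl_in)
    also have "\<dots> = z \<cdot> cl (t # u)"
      using Cons z t by (simp add: cl_Cons[of t u] cl_in flip: G.m_assoc)
    finally show ?case .
  qed (use z in simp)
  then show ?thesis using u by simp
qed

lemma cliqueD: "K \<in> graph_cliques \<Gamma> \<Longrightarrow> K \<subseteq> V" "K \<in> graph_cliques \<Gamma> \<Longrightarrow> finite K"
  "K \<in> graph_cliques \<Gamma> \<Longrightarrow> a \<in> K \<Longrightarrow> b \<in> K \<Longrightarrow> a \<noteq> b \<Longrightarrow> adj a b"
  by (auto simp: cliques_def pairwise_def)

lemma clique_subset: "K \<in> graph_cliques \<Gamma> \<Longrightarrow> K' \<subseteq> K \<Longrightarrow> K' \<in> graph_cliques \<Gamma>"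
  by (auto simp: cliques_def intro: finite_subset pairwise_subset)

lemma clique_star: "K \<in> graph_cliques \<Gamma> \<Longrightarrow> v \<in> K \<Longrightarrow> K \<subseteq> star v"
  using cliqueD by (auto simp: star_def nbr_def)

lemma cliqueI: "K \<subseteq> V \<Longrightarrow> (\<And>a b. a \<in> K \<Longrightarrow> b \<in> K \<Longrightarrow> a \<noteq> b \<Longrightarrow> adj a b) \<Longrightarrow> K \<in> graph_cliques \<Gamma>"
  using finite_subset[OF _ finite_V] by (auto simp: cliques_def pairwise_def)

lemma clique_sing: "v \<in> V \<Longrightarrow> {v} \<in> graph_cliques \<Gamma>"
  by (rule cliqueI) auto

subsection \<open>Monomials\<close>

text \<open>\<open>monomial\<close> enumerates the support by a choice; an explicit list permits
  recursion and rearrangement.\<close>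

definition ml :: "('v \<Rightarrow> int) \<Rightarrow> 'v list \<Rightarrow> 'v word set" where
  "ml n vs = foldr (\<lambda>v h. gpow v (n v) \<cdot> h) vs one_elt"

lemma ml_simps [simp]: "ml n [] = one_elt" "ml n (v # vs) = gpow v (n v) \<cdot> ml n vs"
  by (simp_all add: ml_def)

lemma ml_par: "set vs \<subseteq> V \<Longrightarrow> set vs \<subseteq> A \<Longrightarrow> ml n vs \<in> par A"
  by (induction vs) (auto intro!: par_mult gpow_par)

lemma ml_in: "set vs \<subseteq> V \<Longrightarrow> ml n vs \<in> C"
  using ml_par par_in by blast

lemma ml_extract:
  assumes K: "K \<in> graph_cliques \<Gamma>" and "set vs \<subseteq> K" "distinct vs" "v \<in> set vs"
  shows "ml n vs = gpow v (n v) \<cdot> ml n (remove1 v vs)"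
  using assms(2-)
proof (induction vs)
  case (Cons w vs)
  show ?case
  proof (cases "v = w")
    case False
    then have v: "v \<in> set vs" "v \<in> K" "w \<in> K" "v \<in> V" "w \<in> V" using Cons cliqueD(1)[OF K] by auto
    have r: "ml n (remove1 v vs) \<in> C" using Cons cliqueD(1)[OF K] by (intro ml_in) (auto dest: notin_set_remove1)
    have c: "gpow v (n v) \<cdot> gpow w (n w) = gpow w (n w) \<cdot> gpow v (n v)"
      by (rule par_commute[of _ "{v}" _ "{w}"]) (use v False cliqueD(3)[OF K] in \<open>auto intro: gpow_par\<close>)
    have "ml n (w # vs) = gpow w (n w) \<cdot> (gpow v (n v) \<cdot> ml n (remove1 v vs))"
      using Cons v by simp
    also have "\<dots> = gpow v (n v) \<cdot> (gpow w (n w) \<cdot> ml n (remove1 v vs))"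
      using c v r by (simp flip: G.m_assoc)
    finally show ?thesis using False by simp
  qed simp
qed simp

lemma ml_perm:
  assumes K: "K \<in> graph_cliques \<Gamma>" and "set vs \<subseteq> K" "distinct vs" "distinct ws" "set ws = set vs"
  shows "ml n vs = ml n ws"
  using assms(2-)
proof (induction vs arbitrary: ws)
  case (Cons v vs)
  have "ml n ws = gpow v (n v) \<cdot> ml n (remove1 v ws)"
    by (rule ml_extract[OF K]) (use Cons in auto)
  moreover have "ml n vs = ml n (remove1 v ws)"
    by (rule Cons.IH) (use Cons in auto)
  ultimately show ?case by simp
qed simp

abbreviation supp :: "('v \<Rightarrow> int) \<Rightarrow> 'v set" where "supp n \<equiv> {v. n v \<noteq> 0}"

lemma monomial_ml:
  assumes K: "K \<in> graph_cliques \<Gamma>" and n: "supp n \<subseteq> K" and vs: "distinct vs" "set vs = supp n"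
  shows "monomial \<Gamma> n = ml n vs"
proof -
  define ws where "ws = (SOME vs. distinct vs \<and> set vs = supp n)"
  have "distinct ws \<and> set ws = supp n"
    unfolding ws_def by (rule someI[of _ vs]) (use vs in simp)
  then have "ml n ws = ml n vs" using ml_perm[OF K, of ws vs n] vs n by simp
  moreover have "monomial \<Gamma> n = ml n ws"
    unfolding monomial_def ml_def ws_def gpow_def cl_def gen_def ..
  ultimately show ?thesis by simp
qed

lemma monomial_0 [simp]: "monomial \<Gamma> (\<lambda>_. 0) = one_elt"
  using monomial_ml[of "{}" "\<lambda>_. 0" "[]"] by (simp add: cliques_def)

lemma monomial_list:
  assumes K: "K \<in> graph_cliques \<Gamma>" and n: "supp n \<subseteq> K"
  obtains vs where "distinct vs" "set vs = supp n"
  using finite_distinct_list[OF finite_subset[OF n cliqueD(2)[OF K]]] by blast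

lemma monomial_par:
  assumes K: "K \<in> graph_cliques \<Gamma>" and n: "supp n \<subseteq> K" and "supp n \<subseteq> A"
  shows "monomial \<Gamma> n \<in> par A"
proof -
  obtain vs where "distinct vs" "set vs = supp n" using monomial_list[OF K n] .
  then show ?thesis using monomial_ml[OF K n, of vs] ml_par[of vs A n] assms cliqueD(1)[OF K] by auto
qed

lemma monomial_in: "K \<in> graph_cliques \<Gamma> \<Longrightarrow> supp n \<subseteq> K \<Longrightarrow> monomial \<Gamma> n \<in> C"
  using monomial_par par_in by blast

text \<open>Both sides are compared with the monomial in which the exponent of \<open>v\<close> is
  0, because the support, and with it the chosen enumeration, changes when an exponent
  vanishes.\<close>

lemma monomial_upd:
  assumes K: "K \<in> graph_cliques \<Gamma>" and n: "supp n \<subseteq> K" and v: "v \<in> K"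
  shows "monomial \<Gamma> (n(v := n v + k)) = gpow v k \<cdot> monomial \<Gamma> n"
proof -
  let ?n0 = "n(v := 0)"
  have vV: "v \<in> V" using cliqueD(1)[OF K] v by blast
  have n0: "supp ?n0 \<subseteq> K" using n by auto
  have *: "monomial \<Gamma> (n(v := j)) = gpow v j \<cdot> monomial \<Gamma> ?n0" for j
  proof (cases "j = 0")
    case True
    then show ?thesis using monomial_in[OF K n0] by (simp del: fun_upd_apply)
  next
    case False
    obtain vs where vs: "distinct vs" "set vs = supp ?n0" using monomial_list[OF K n0] .
    have "ml (n(v := j)) vs = ml ?n0 vs"
      unfolding ml_def by (rule foldr_cong) (use vs in auto)
    moreover have "monomial \<Gamma> (n(v := j)) = ml (n(v := j)) (v # vs)"
      by (rule monomial_ml[OF K]) (use n v vs False in auto)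
    moreover have "monomial \<Gamma> ?n0 = ml ?n0 vs" by (rule monomial_ml[OF K n0 vs])
    ultimately show ?thesis by simp
  qed
  have "monomial \<Gamma> n = gpow v (n v) \<cdot> monomial \<Gamma> ?n0" using *[of "n v"] by simp
  then show ?thesis
    using *[of "n v + k"] vV monomial_in[OF K n0] gpow_add[OF vV, of k "n v"] by (simp add: G.m_assoc add.commute)
qed

lemma supp_induct [consumes 2, case_names zero upd]:
  assumes K: "K \<in> graph_cliques \<Gamma>" and n: "supp n \<subseteq> K" and z: "P (\<lambda>_. 0)"
    and u: "\<And>n v k. v \<in> K \<Longrightarrow> supp n \<subseteq> K \<Longrightarrow> P n \<Longrightarrow> P (n(v := n v + k))"
  shows "P n"
proof -
  have "finite S \<Longrightarrow> S \<subseteq> K \<Longrightarrow> supp n \<subseteq> S \<Longrightarrow> P n" for S n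
  proof (induction S arbitrary: n rule: finite_induct)
    case empty
    then have "n = (\<lambda>_. 0)" by auto
    then show ?case using z by simp
  next
    case (insert v S)
    have "P (n(v := 0))" using insert by (intro insert.IH) auto
    moreover have "n = (n(v := 0))(v := (n(v := 0)) v + n v)" by auto
    moreover have "v \<in> K" "supp (n(v := 0)) \<subseteq> K" using insert by auto
    ultimately show ?case using u[of v "n(v := 0)" "n v"] by simp
  qed
  then show ?thesis using cliqueD(2)[OF K] n by blast
qed

lemma monomial_single: "v \<in> V \<Longrightarrow> monomial \<Gamma> ((\<lambda>_. 0)(v := k)) = gpow v k"
  using monomial_upd[OF clique_sing, of v "\<lambda>_. 0" v k] by simp

text \<open>Needed for the flat of a clique to contain every vertex of its coset.\<close>

lemma par_monomial:
  assumes K: "K \<in> graph_cliques \<Gamma>" and z: "z \<in> par K"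
  shows "\<exists>n. supp n \<subseteq> K \<and> monomial \<Gamma> n = z"
proof -
  obtain u where u: "z = cl u" "u \<in> words \<Gamma>" "fst ` set u \<subseteq> K" using z by (auto simp: par_def)
  from u(2,3) have "\<exists>n. supp n \<subseteq> K \<and> monomial \<Gamma> n = cl u"
  proof (induction u)
    case Nil
    then show ?case by (intro exI[of _ "\<lambda>_. 0"]) simp
  next
    case (Cons t u)
    obtain v b where t: "t = (v, b)" by (cases t)
    have v: "v \<in> K" "v \<in> V" using Cons t by auto
    obtain n where n: "supp n \<subseteq> K" "monomial \<Gamma> n = cl u" using Cons by auto
    let ?n = "n(v := n v + (if b then 1 else -1))"
    have "supp ?n \<subseteq> K" using n v by auto
    moreover have "monomial \<Gamma> ?n = cl (t # u)"
      using monomial_upd[OF K n(1) v(1), of "if b then 1 else -1"] n v Cons.prems t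
        cl_Cons[of t u] gpow_letter[of v b] by (simp del: fun_upd_apply split del: if_split)
    ultimately show ?case by blast
  qed
  then show ?thesis using u by simp
qed

text \<open>The line in direction \<open>v\<close> lies wholly inside or wholly outside
  \<open>E\<close>; inside, each of its edges counts once with its sign, outside none does.\<close>

lemma crs_gpow:
  assumes inv: "lk_invariant E v" and v: "v \<in> V" and x: "x \<in> C" and y: "y \<in> C"
    and E: "\<And>z b. z \<in> C \<Longrightarrow> z \<cdot> cl [(v, b)] \<in> E \<longleftrightarrow> z \<in> E"
  shows "crs E (v, True) x (y \<cdot> gpow v k) = crs E (v, True) x y + (if y \<in> E then k else 0) \<and>
     (y \<cdot> gpow v k \<in> E \<longleftrightarrow> y \<in> E)"
  using v
proof (induction k rule: gpow_induct)
  case zero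
  then show ?case using y by simp
next
  case (up k)
  have "y \<cdot> gpow v (k + 1) = y \<cdot> gpow v k \<cdot> cl [(v, True)]"
    using v y by (simp add: gpow_add gpow_1 G.m_assoc)
  then show ?case
    using up crs_step[of E "(v, True)" x "y \<cdot> gpow v k" "(v, True)"] inv v x y E by auto
next
  case (down k)
  have "y \<cdot> gpow v (k - 1) = y \<cdot> gpow v k \<cdot> cl [(v, False)]"
    using v y gpow_add[of v k "-1"] by (simp add: gpow_m1 G.m_assoc)
  then show ?case
    using down crs_step[of E "(v, True)" x "y \<cdot> gpow v k" "(v, False)"] inv v x y E by (auto simp: linv_def)
qed

lemma crs_gpow_other:
  assumes inv: "lk_invariant E v" and w: "w \<in> V" and vw: "v \<noteq> w" and x: "x \<in> C" and y: "y \<in> C"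
  shows "crs E (v, True) x (y \<cdot> gpow w k) = crs E (v, True) x y"
  using w
proof (induction k rule: gpow_induct)
  case zero
  then show ?case using y by simp
next
  case (up k)
  have "y \<cdot> gpow w (k + 1) = y \<cdot> gpow w k \<cdot> cl [(w, True)]"
    using w y by (simp add: gpow_add gpow_1 G.m_assoc)
  then show ?case
    using up crs_step[of E "(v, True)" x "y \<cdot> gpow w k" "(w, True)"] inv vw w x y by (auto simp: linv_def)
next
  case (down k)
  have "y \<cdot> gpow w (k - 1) = y \<cdot> gpow w k \<cdot> cl [(w, False)]"
    using w y gpow_add[of w k "-1"] by (simp add: gpow_m1 G.m_assoc)
  then show ?case
    using down crs_step[of E "(v, True)" x "y \<cdot> gpow w k" "(w, False)"] inv vw w x y by (auto simp: linv_def)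
qed

subsection \<open>Line coordinates\<close>

lemma lk_invariant_star: "g \<in> C \<Longrightarrow> lk_invariant (lc g (star v)) v"
  by (rule lk_invariant_lc) (auto simp: star_def)

text \<open>Only edges labelled \<open>v\<close> count. If \<open>v\<close> is in the clique, the
  clique lies in the star of \<open>v\<close>, and the whole flat lies in the star coset or misses
  it; otherwise the exponent of \<open>v\<close> is zero.\<close>

lemma crs_star_monomial:
  assumes g: "g \<in> C" and v: "v \<in> V" and x: "x \<in> C" and y: "y \<in> C"
    and K: "K \<in> graph_cliques \<Gamma>" and n: "supp n \<subseteq> K"
  shows "crs (lc g (star v)) (v, True) x (y \<cdot> monomial \<Gamma> n) =
      crs (lc g (star v)) (v, True) x y + (if y \<in> lc g (star v) then n v else 0) \<and>
     (v \<in> K \<longrightarrow> (y \<cdot> monomial \<Gamma> n \<in> lc g (star v) \<longleftrightarrow> y \<in> lc g (star v)))"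
proof -
  let ?E = "lc g (star v)"
  have inv: "lk_invariant ?E v" by (rule lk_invariant_star[OF g])
  have E: "z \<cdot> cl [(w, b)] \<in> ?E \<longleftrightarrow> z \<in> ?E" if "z \<in> C" "w \<in> star v" for z w b
    using lc_step_iff[OF g that(1), of "(w, b)" "star v"] that star_V[OF v] by auto
  \<comment> \<open>The base point is quantified because each power that is split off moves
    it.\<close>
  from K n have "\<forall>y\<in>C. crs ?E (v, True) x (y \<cdot> monomial \<Gamma> n) =
      crs ?E (v, True) x y + (if y \<in> ?E then n v else 0) \<and>
     (v \<in> K \<longrightarrow> (y \<cdot> monomial \<Gamma> n \<in> ?E \<longleftrightarrow> y \<in> ?E))"
  proof (induction rule: supp_induct)
    case (upd n w k)
    have w: "w \<in> V" using upd cliqueD(1)[OF K] by blast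
    have m: "monomial \<Gamma> n \<in> C" by (rule monomial_in[OF K upd(2)])
    show ?case
    proof
      fix y assume y: "y \<in> C"
      have e: "y \<cdot> monomial \<Gamma> (n(w := n w + k)) = y \<cdot> gpow w k \<cdot> monomial \<Gamma> n"
        using monomial_upd[OF K upd(2,1)] y w m by (simp add: G.m_assoc)
      have IH: "crs ?E (v, True) x (y \<cdot> gpow w k \<cdot> monomial \<Gamma> n) =
          crs ?E (v, True) x (y \<cdot> gpow w k) + (if y \<cdot> gpow w k \<in> ?E then n v else 0) \<and>
         (v \<in> K \<longrightarrow> (y \<cdot> gpow w k \<cdot> monomial \<Gamma> n \<in> ?E \<longleftrightarrow> y \<cdot> gpow w k \<in> ?E))"
        using upd(3) y w by simp
      show "crs ?E (v, True) x (y \<cdot> monomial \<Gamma> (n(w := n w + k))) =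
          crs ?E (v, True) x y + (if y \<in> ?E then (n(w := n w + k)) v else 0) \<and>
         (v \<in> K \<longrightarrow> (y \<cdot> monomial \<Gamma> (n(w := n w + k)) \<in> ?E \<longleftrightarrow> y \<in> ?E))"
      proof (cases "w = v")
        case True
        have "v \<in> star v" by (simp add: star_def)
        then show ?thesis
          using IH crs_gpow[OF inv v x y E, of k] True unfolding e by auto
      next
        case False
        have c: "crs ?E (v, True) x (y \<cdot> gpow w k) = crs ?E (v, True) x y"
          by (rule crs_gpow_other[OF inv w _ x y]) (use False in simp)
        have i: "y \<cdot> gpow w k \<in> ?E \<longleftrightarrow> y \<in> ?E" if "v \<in> K"
        proof -
          have "gpow w k \<in> par (star v)" using clique_star[OF K that] upd(1) w by (intro gpow_par) auto
          then show ?thesis using y w g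
            by (simp add: lc_iff) (metis G.inv_closed G.m_assoc G.m_closed gpow_in lc_iff lc_sym lc_trans lcI par_in)
        qed
        have "n v = 0" if "v \<notin> K" using upd(2) that by auto
        then show ?thesis
          using IH c i False unfolding e by auto
      qed
    qed
  qed auto
  then show ?thesis using y by blast
qed

subsection \<open>Retractions\<close>

text \<open>The retraction of the group onto a special subgroup that kills the generators outside
  \<open>A\<close>; by \<open>ret_cl\<close> the choice of the word is immaterial.\<close>

definition ret :: "'v set \<Rightarrow> 'v word set \<Rightarrow> 'v word set" where
  "ret A x = cl (filter (\<lambda>s. fst s \<in> A) (SOME u. u \<in> words \<Gamma> \<and> cl u = x))"

lemma filter_words: "u \<in> words \<Gamma> \<Longrightarrow> filter P u \<in> words \<Gamma>"
  by (induction u) auto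

text \<open>Deleting letters turns a relator into itself, a free cancellation or the empty
  word.\<close>

lemma raag_eq_filter: "raag_eq \<Gamma> u w \<Longrightarrow> raag_eq \<Gamma> (filter (\<lambda>s. fst s \<in> A) u) (filter (\<lambda>s. fst s \<in> A) w)"
proof (induction rule: raag_eq.induct)
  case (cancel v b)
  then show ?case by (auto intro: raag_eq.cancel raag_eq.refl)
next
  case (commutator v w)
  then have "v \<in> V" "w \<in> V" using adj_V by auto
  then show ?case using commutator raag_eq.cancel[of v \<Gamma> True] raag_eq.cancel[of w \<Gamma> True]
    by (auto intro: raag_eq.commutator raag_eq.refl)
qed (auto intro: raag_eq.refl raag_eq.sym raag_eq.trans raag_eq.mult filter_words)

lemma ret_cl: assumes "u \<in> words \<Gamma>" shows "ret A (cl u) = cl (filter (\<lambda>s. fst s \<in> A) u)"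
proof -
  define w where "w = (SOME w. w \<in> words \<Gamma> \<and> cl w = cl u)"
  have "w \<in> words \<Gamma> \<and> cl w = cl u" unfolding w_def by (rule someI[of _ u]) (use assms in simp)
  then have "raag_eq \<Gamma> w u" using cl_eqD assms by blast
  from cl_eqI[OF raag_eq_filter[OF this]] show ?thesis by (simp add: ret_def w_def)
qed

lemma ret_par: assumes "x \<in> C" shows "ret A x \<in> par A"
proof -
  obtain u where "u \<in> words \<Gamma>" "x = cl u" using cl_surj assms by blast
  then show ?thesis using filter_words by (auto simp: ret_cl intro!: parI)
qed

lemma ret_in: "x \<in> C \<Longrightarrow> ret A x \<in> C"
  using ret_par par_in by blast

lemma ret_mult: assumes "x \<in> C" "y \<in> C" shows "ret A (x \<cdot> y) = ret A x \<cdot> ret A y"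
proof -
  obtain u w where "u \<in> words \<Gamma>" "x = cl u" "w \<in> words \<Gamma>" "y = cl w" using cl_surj assms by metis
  then show ?thesis using ret_cl[of "u @ w" A] by (simp add: ret_cl cl_append filter_words)
qed

lemma ret_id: assumes "x \<in> par B" "B \<subseteq> A" shows "ret A x = x"
proof -
  obtain u where u: "x = cl u" "u \<in> words \<Gamma>" "fst ` set u \<subseteq> B" using assms by (auto simp: par_def)
  have "filter (\<lambda>s. fst s \<in> A) u = u" using u assms by (intro filter_True) auto
  then show ?thesis using u ret_cl by simp
qed

lemma ret_one: assumes "x \<in> par B" "B \<inter> A = {}" shows "ret A x = one_elt"
proof -
  obtain u where u: "x = cl u" "u \<in> words \<Gamma>" "fst ` set u \<subseteq> B" using assms by (auto simp: par_def)
  have "filter (\<lambda>s. fst s \<in> A) u = []" using u assms by (intro filter_False) auto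
  then show ?thesis using u ret_cl by simp
qed

lemma ret_monomial:
  assumes K: "K \<in> graph_cliques \<Gamma>" and n: "supp n \<subseteq> K"
  shows "ret A (monomial \<Gamma> n) = monomial \<Gamma> (\<lambda>v. if v \<in> A then n v else 0)"
  using K n
proof (induction rule: supp_induct)
  case zero
  then show ?case using ret_id[of one_elt A A] by simp
next
  case (upd n v k)
  let ?r = "\<lambda>n v. if v \<in> A then n v else (0::int)"
  have v: "v \<in> V" using upd cliqueD(1)[OF K] by blast
  have r: "supp (?r n) \<subseteq> K" using upd by auto
  have e: "ret A (monomial \<Gamma> (n(v := n v + k))) = ret A (gpow v k) \<cdot> monomial \<Gamma> (?r n)"
    using monomial_upd[OF K upd(2,1)] v monomial_in[OF K upd(2)] upd(3) by (simp add: ret_mult)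
  show ?case
  proof (cases "v \<in> A")
    case True
    have "ret A (gpow v k) = gpow v k" using ret_id[OF gpow_par[OF v], of "{v}" A] True by simp
    moreover have "?r (n(v := n v + k)) = (?r n)(v := ?r n v + k)" using True by auto
    ultimately show ?thesis using e monomial_upd[OF K r upd(1), of k] by (simp del: fun_upd_apply)
  next
    case False
    have "ret A (gpow v k) = one_elt" using ret_one[OF gpow_par[OF v], of "{v}" A] False by simp
    moreover have "?r (n(v := n v + k)) = ?r n" using False by auto
    ultimately show ?thesis using e monomial_in[OF K r] by (simp del: fun_upd_apply)
  qed
qed


section \<open>Standard flats in terms of cosets\<close>

lemma flat_map_floor_clique:
  assumes "s \<in> coords K" shows "supp (\<lambda>v. \<lfloor>s v\<rfloor>) \<subseteq> K"
  using assms by (auto simp: coords_def)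

definition flat :: "'v word set \<Rightarrow> 'v set \<Rightarrow> 'v point set" where
  "flat g K = flat_map \<Gamma> g ` coords K"

text \<open>A real coordinate splits uniquely into its floor, which moves the vertex inside the
  coset, and its fractional part, which is kept.\<close>

lemma mem_flat_iff:
  assumes g: "g \<in> C" and K: "K \<in> graph_cliques \<Gamma>"
  shows "(h, t) \<in> flat g K \<longleftrightarrow> h \<in> lc g K \<and> t \<in> coords K \<and> (\<forall>v. 0 \<le> t v \<and> t v < 1)"
proof
  assume "(h, t) \<in> flat g K"
  then obtain s where s: "s \<in> coords K" "h = g \<cdot> monomial \<Gamma> (\<lambda>v. \<lfloor>s v\<rfloor>)" "t = (\<lambda>v. frac (s v))"
    by (auto simp: flat_def flat_map_def)
  then show "h \<in> lc g K \<and> t \<in> coords K \<and> (\<forall>v. 0 \<le> t v \<and> t v < 1)"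
    using monomial_par[OF K, of "\<lambda>v. \<lfloor>s v\<rfloor>" K] flat_map_floor_clique[OF s(1)] lcI
    by (auto simp: coords_def frac_lt_1)
next
  assume a: "h \<in> lc g K \<and> t \<in> coords K \<and> (\<forall>v. 0 \<le> t v \<and> t v < 1)"
  then obtain z where z: "z \<in> par K" "h = g \<cdot> z" by (auto simp: lc_def)
  then obtain n where n: "supp n \<subseteq> K" "monomial \<Gamma> n = z" using par_monomial[OF K] by blast
  let ?s = "\<lambda>v. of_int (n v) + t v"
  have f: "\<lfloor>?s v\<rfloor> = n v" "frac (?s v) = t v" for v
    using a by (auto simp: floor_eq_iff frac_unique_iff)
  have "?s \<in> coords K" using a n by (auto simp: coords_def)
  moreover have "(h, t) = flat_map \<Gamma> g ?s" unfolding flat_map_def f using z n by simp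
  ultimately show "(h, t) \<in> flat g K" unfolding flat_def by blast
qed

lemma mem_flat_vertex:
  assumes g: "g \<in> C" and K: "K \<in> graph_cliques \<Gamma>"
  shows "vertex h \<in> flat g K \<longleftrightarrow> h \<in> lc g K"
  using mem_flat_iff[OF assms] by (auto simp: vertex_def coords_def)

lemma flat_fst: "g \<in> C \<Longrightarrow> K \<in> graph_cliques \<Gamma> \<Longrightarrow> x \<in> flat g K \<Longrightarrow> fst x \<in> lc g K"
  using mem_flat_iff by (cases x) auto

lemma flat_mono_iff:
  assumes g: "g \<in> C" "h \<in> C" and K: "K \<in> graph_cliques \<Gamma>" "L \<in> graph_cliques \<Gamma>"
  shows "flat g K \<subseteq> flat h L \<longleftrightarrow> K \<subseteq> L \<and> g \<in> lc h L"
proof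
  assume sub: "flat g K \<subseteq> flat h L"
  have "vertex g \<in> flat g K" using mem_flat_vertex[OF g(1) K(1)] g by simp
  then have "g \<in> lc h L" using sub mem_flat_vertex[OF g(2) K(2)] by blast
  moreover have "v \<in> L" if "v \<in> K" for v
  proof -
    \<comment> \<open>The midpoint of the edge labelled \<open>v\<close> at \<open>g\<close>: its
      support detects \<open>v\<close> in the larger flat.\<close>
    have "(g, (\<lambda>_. 0)(v := 1/2)) \<in> flat g K" using mem_flat_iff[OF g(1) K(1)] that g by (auto simp: coords_def)
    then have "(\<lambda>_. 0)(v := 1/2) \<in> coords L" using sub mem_flat_iff[OF g(2) K(2)] by blast
    then show ?thesis by (auto simp: coords_def split: if_splits)
  qed
  ultimately show "K \<subseteq> L \<and> g \<in> lc h L" by blast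
next
  assume a: "K \<subseteq> L \<and> g \<in> lc h L"
  then have "lc g K \<subseteq> lc h L" using lc_mono[of K L g] lc_eq[OF g(2)] by blast
  moreover have "coords K \<subseteq> coords L" using a by (auto simp: coords_def)
  ultimately show "flat g K \<subseteq> flat h L"
    using mem_flat_iff[OF g(1) K(1)] mem_flat_iff[OF g(2) K(2)] by auto
qed

lemma flat_eq: "g \<in> C \<Longrightarrow> K \<in> graph_cliques \<Gamma> \<Longrightarrow> h \<in> lc g K \<Longrightarrow> flat h K = flat g K"
  using flat_mono_iff[of h g K K] flat_mono_iff[of g h K K] lc_in lc_sym by blast

subsection \<open>Strings\<close>

lemma flat_map_X:
  assumes "g \<in> C" "K \<in> graph_cliques \<Gamma>" "s \<in> coords K" shows "flat_map \<Gamma> g s \<in> X \<Gamma>"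
proof -
  have "{v. frac (s v) \<noteq> 0} \<subseteq> K" using assms(3) by (force simp: coords_def)
  then have "{v. frac (s v) \<noteq> 0} \<in> graph_cliques \<Gamma>" using clique_subset assms by blast
  then show ?thesis
    using assms monomial_in[OF assms(2) flat_map_floor_clique[OF assms(3)]]
    by (simp add: X_def flat_map_def salvetti_def frac_lt_1)
qed

lemma cube_coords_sub: "s \<in> cube_coords K \<Longrightarrow> s \<in> coords K"
  by (simp add: cube_coords_def)

lemma string_nonneg: "string_length \<Gamma> x y l \<Longrightarrow> 0 \<le> l"
  by (induction rule: string_length.induct) (auto intro!: add_nonneg_nonneg sum_nonneg)

lemma string_trans: "string_length \<Gamma> y z m \<Longrightarrow> string_length \<Gamma> x y l \<Longrightarrow> string_length \<Gamma> x z (l + m)"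
proof (induction rule: string_length.induct)
  case (extend y g s m K s')
  then show ?case using string_length.extend[of \<Gamma> x g s "l + m" K s'] by (simp add: add.assoc)
qed simp

lemma string_cube:
  assumes "g \<in> C" "K \<in> graph_cliques \<Gamma>" "s \<in> cube_coords K" "s' \<in> cube_coords K"
  shows "string_length \<Gamma> (flat_map \<Gamma> g s) (flat_map \<Gamma> g s') (sqrt (\<Sum>v\<in>K. (s v - s' v)\<^sup>2))"
proof -
  have "string_length \<Gamma> (flat_map \<Gamma> g s) (flat_map \<Gamma> g s) 0"
    using flat_map_X[OF assms(1,2)] assms(3) cube_coords_sub by (blast intro: string_length.start)
  from string_length.extend[OF this assms] show ?thesis by simp
qed

lemma flat_map_0 [simp]: "g \<in> C \<Longrightarrow> flat_map \<Gamma> g (\<lambda>_. 0) = vertex g"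
  by (simp add: flat_map_def vertex_def)

text \<open>The infimum of an empty set of reals is unspecified, so lower bounds on string lengths
  pass to \<open>X_dist\<close> only once some string is known to exist.\<close>

definition linked :: "'v point \<Rightarrow> 'v point \<Rightarrow> bool" where
  "linked x y \<longleftrightarrow> (\<exists>l. string_length \<Gamma> x y l)"

lemma linked_trans: "linked x y \<Longrightarrow> linked y z \<Longrightarrow> linked x z"
  using string_trans unfolding linked_def by blast

lemma linked_cube:
  assumes "g \<in> C" "K \<in> graph_cliques \<Gamma>" "s \<in> cube_coords K" "s' \<in> cube_coords K"
  shows "linked (flat_map \<Gamma> g s) (flat_map \<Gamma> g s')"
  using string_cube[OF assms] unfolding linked_def by blast

lemma linked_point: assumes "(h, t) \<in> X \<Gamma>" shows "linked (h, t) (vertex h)" "linked (vertex h) (h, t)"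
proof -
  let ?K = "{v. t v \<noteq> 0}"
  have h: "h \<in> C" and K: "?K \<in> graph_cliques \<Gamma>" and t: "\<And>v. 0 \<le> t v" "\<And>v. t v < 1"
    using assms by (auto simp: X_def salvetti_def)
  have "\<lfloor>t v\<rfloor> = 0" "frac (t v) = t v" for v using t by (auto simp: floor_eq_iff frac_eq)
  then have e: "flat_map \<Gamma> h t = (h, t)" using h by (simp add: flat_map_def)
  have c: "t \<in> cube_coords ?K" "(\<lambda>_. 0) \<in> cube_coords ?K"
    using t by (auto simp: cube_coords_def coords_def less_imp_le)
  show "linked (h, t) (vertex h)" "linked (vertex h) (h, t)"
    using linked_cube[OF h K c] linked_cube[OF h K c(2,1)] h by (simp_all add: e)
qed

lemma linked_step: assumes h: "h \<in> C" and s: "fst s \<in> V" shows "linked (vertex h) (vertex (h \<cdot> cl [s]))"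
proof -
  obtain v b where sv: "s = (v, b)" by (cases s)
  have v: "v \<in> V" using s sv by simp
  let ?e = "(\<lambda>_. 0)(v := 1::real)"
  have c: "?e \<in> cube_coords {v}" "(\<lambda>_. 0) \<in> cube_coords {v}" by (auto simp: cube_coords_def coords_def)
  \<comment> \<open>The far end of the unit edge has floor 1 and fractional part 0, so
    \<open>flat_map\<close> lands on the neighbouring vertex.\<close>
  have fl: "(\<lambda>w. \<lfloor>?e w\<rfloor>) = (\<lambda>_. 0)(v := 1)" "(\<lambda>w. frac (?e w)) = (\<lambda>_. 0)" by auto
  have e: "flat_map \<Gamma> k ?e = vertex (k \<cdot> cl [(v, True)])" for k
    unfolding flat_map_def fl using monomial_single[OF v, of 1] gpow_1[OF v] by (simp add: vertex_def)
  have *: "linked (vertex k) (vertex (k \<cdot> cl [(v, True)]))" "linked (vertex (k \<cdot> cl [(v, True)])) (vertex k)"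
    if "k \<in> C" for k
    using linked_cube[OF that clique_sing[OF v] c] linked_cube[OF that clique_sing[OF v] c(2,1)] that
    by (simp_all add: e del: fun_upd_apply)
  show ?thesis
  proof (cases b)
    case False
    then have "h \<cdot> cl [s] \<cdot> cl [(v, True)] = h" using letter_cancel(1)[OF s h] sv by (simp add: linv_def)
    then show ?thesis using *(2)[of "h \<cdot> cl [s]"] h s by simp
  qed (use * h sv in simp)
qed

lemma linked_X: assumes "x \<in> X \<Gamma>" "y \<in> X \<Gamma>" shows "linked x y"
proof -
  obtain g t h r where x: "x = (g, t)" and y: "y = (h, r)" by (cases x; cases y)
  have g: "g \<in> C" and h: "h \<in> C" using assms x y by (auto simp: X_def)
  have "g \<in> lc g V" "h \<in> lc g V" using lc_V g h by auto
  from g this have "linked (vertex g) (vertex h)"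
  proof (induction rule: coset_induct)
    case base
    have "(g, \<lambda>_. 0) \<in> X \<Gamma>" using g by (auto simp: X_def salvetti_def cliques_def)
    then show ?case unfolding linked_def vertex_def by (blast intro: string_length.start)
  next
    case (step y t)
    then show ?case using linked_trans linked_step lc_in[OF g] by blast
  qed
  then show ?thesis using linked_point assms x y linked_trans by blast
qed

lemma string_exists: "x \<in> X \<Gamma> \<Longrightarrow> y \<in> X \<Gamma> \<Longrightarrow> {l. string_length \<Gamma> x y l} \<noteq> {}"
  using linked_X unfolding linked_def by blast

lemma X_dist_le: "string_length \<Gamma> x y l \<Longrightarrow> X_dist \<Gamma> x y \<le> l"
  unfolding X_dist_def by (rule cInf_lower) (auto intro!: bdd_belowI[of _ 0] string_nonneg)

lemma X_dist_ge:
  assumes "x \<in> X \<Gamma>" "y \<in> X \<Gamma>" "\<And>l. string_length \<Gamma> x y l \<Longrightarrow> b \<le> l" shows "b \<le> X_dist \<Gamma> x y"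
  unfolding X_dist_def by (rule cInf_greatest) (use string_exists[OF assms(1,2)] assms(3) in auto)

lemma X_dist_nonneg: "x \<in> X \<Gamma> \<Longrightarrow> y \<in> X \<Gamma> \<Longrightarrow> 0 \<le> X_dist \<Gamma> x y"
  by (rule X_dist_ge) (auto intro: string_nonneg)

lemma flat_X: "g \<in> C \<Longrightarrow> K \<in> graph_cliques \<Gamma> \<Longrightarrow> flat g K \<subseteq> X \<Gamma>"
  unfolding flat_def using flat_map_X by blast

subsection \<open>Lines in the same class\<close>

text \<open>
  Fold \<open>X(\<Gamma>)\<close> onto the link of a standard geodesic of label \<open>v\<close> through \<open>g\<close>, and move the result
  to height \<open>a\<close>. This does not lengthen strings, so in a class of geodesics differing by the star
  group the distance between two of them is the same at all heights.
\<close>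

definition slide :: "'v word set \<Rightarrow> 'v \<Rightarrow> real \<Rightarrow> 'v point \<Rightarrow> 'v point" where
  "slide g v a x = (g \<cdot> ret (nbr v) (inver g \<cdot> fst x) \<cdot> gpow v \<lfloor>a\<rfloor>,
     \<lambda>w. if w = v then frac a else if w \<in> nbr v then snd x w else 0)"

text \<open>\<open>ret\<close> deletes the exponents outside the link, and the power of
  \<open>v\<close> commutes with those that remain. Hence the image of a cube is again described by
  \<open>flat_map\<close> from a single base vertex.\<close>

lemma slide_flat_map:
  assumes g: "g \<in> C" and v: "v \<in> V" and h: "h \<in> C" and K: "K \<in> graph_cliques \<Gamma>" and s: "s \<in> coords K"
  shows "slide g v a (flat_map \<Gamma> h s) =
    flat_map \<Gamma> (g \<cdot> ret (nbr v) (inver g \<cdot> h) \<cdot> gpow v \<lfloor>a\<rfloor>)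
      (\<lambda>w. if w = v then frac a else if w \<in> nbr v then s w else 0)"
proof -
  let ?m = "\<lambda>w. \<lfloor>s w\<rfloor>"
  let ?s = "\<lambda>w. if w = v then frac a else if w \<in> nbr v then s w else 0"
  have m: "supp ?m \<subseteq> K" by (rule flat_map_floor_clique[OF s])
  let ?r = "\<lambda>w. if w \<in> nbr v then ?m w else 0"
  have r: "supp ?r \<subseteq> K" "supp ?r \<subseteq> nbr v" using m by auto
  have fl: "(\<lambda>w. \<lfloor>?s w\<rfloor>) = ?r" by (auto simp: fun_eq_iff nbr_def floor_eq_iff frac_lt_1)
  have fr: "(\<lambda>w. frac (?s w)) = (\<lambda>w. if w = v then frac a else if w \<in> nbr v then frac (s w) else 0)" by auto
  have "inver g \<cdot> (h \<cdot> monomial \<Gamma> ?m) = inver g \<cdot> h \<cdot> monomial \<Gamma> ?m"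
    using g h monomial_in[OF K m] by (simp add: G.m_assoc)
  then have e: "ret (nbr v) (inver g \<cdot> (h \<cdot> monomial \<Gamma> ?m)) = ret (nbr v) (inver g \<cdot> h) \<cdot> monomial \<Gamma> ?r"
    using g h monomial_in[OF K m] by (simp add: ret_mult ret_monomial[OF K m])
  have c: "gpow v \<lfloor>a\<rfloor> \<cdot> monomial \<Gamma> ?r = monomial \<Gamma> ?r \<cdot> gpow v \<lfloor>a\<rfloor>"
    by (rule par_commute[of _ "{v}" _ "nbr v"]) (use v monomial_par[OF K r] in \<open>auto simp: nbr_def intro: gpow_par\<close>)
  have "ret (nbr v) (inver g \<cdot> h) \<in> C" using g h by (intro ret_in) auto
  then show ?thesis
    unfolding slide_def flat_map_def fst_conv snd_conv fl fr
    using e c g v monomial_in[OF K r(1)] by (simp add: G.m_assoc)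
qed

text \<open>On each cube the map forgets the coordinates outside the link and freezes that of
  \<open>v\<close>, so no piece of the string becomes longer.\<close>

lemma string_slide:
  assumes g: "g \<in> C" and v: "v \<in> V" and str: "string_length \<Gamma> x y l"
  shows "\<exists>l'\<le>l. string_length \<Gamma> (slide g v a x) (slide g v a y) l'"
  using str
proof (induction rule: string_length.induct)
  case (start x)
  obtain h t where x: "x = (h, t)" by (cases x)
  then have "h \<in> C" and K: "{v. t v \<noteq> 0} \<in> graph_cliques \<Gamma>" "\<forall>v. 0 \<le> t v \<and> t v < 1"
    using start by (auto simp: X_def salvetti_def)
  let ?K = "insert v ({v. t v \<noteq> 0} \<inter> nbr v)"
  have "?K \<in> graph_cliques \<Gamma>"
    using cliqueD(3)[OF K(1)] cliqueD(1)[OF K(1)] v adj_sym by (intro cliqueI) (auto simp: nbr_def)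
  moreover define f where "f = (\<lambda>w. if w = v then frac a else if w \<in> nbr v then t w else 0)"
  moreover have "{w. f w \<noteq> 0} \<subseteq> ?K" by (auto simp: f_def)
  ultimately have "{w. f w \<noteq> 0} \<in> graph_cliques \<Gamma>"
    using clique_subset by blast
  moreover have "0 \<le> f w \<and> f w < 1" for w using K(2) by (simp add: f_def frac_lt_1)
  moreover have "g \<cdot> ret (nbr v) (inver g \<cdot> h) \<cdot> gpow v \<lfloor>a\<rfloor> \<in> C"
    using \<open>h \<in> C\<close> g v by (simp add: ret_in)
  ultimately have "slide g v a x \<in> X \<Gamma>"
    unfolding x slide_def X_def salvetti_def fst_conv snd_conv f_def[symmetric] by simp
  then show ?case by (intro exI[of _ 0]) (auto intro: string_length.start)
next
  case (extend x h s l K s')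
  let ?f = "\<lambda>s w. if w = v then frac a else if w \<in> nbr v then s w else (0::real)"
  let ?h = "g \<cdot> ret (nbr v) (inver g \<cdot> h) \<cdot> gpow v \<lfloor>a\<rfloor>"
  let ?K = "insert v (K \<inter> nbr v)"
  obtain l' where l': "l' \<le> l" "string_length \<Gamma> (slide g v a x) (slide g v a (flat_map \<Gamma> h s)) l'"
    using extend.IH by blast
  have h: "?h \<in> C" using g v extend.hyps(2) by (simp add: ret_in)
  have K: "?K \<in> graph_cliques \<Gamma>"
    using cliqueD(3)[OF extend.hyps(3)] cliqueD(1)[OF extend.hyps(3)] v adj_sym by (intro cliqueI) (auto simp: nbr_def)
  have cube: "?f s \<in> cube_coords ?K" if "s \<in> cube_coords K" for s
    using that by (auto simp: cube_coords_def coords_def frac_lt_1 less_imp_le)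
  have e: "slide g v a (flat_map \<Gamma> h s) = flat_map \<Gamma> ?h (?f s)" if "s \<in> cube_coords K" for s
    by (rule slide_flat_map[OF g v extend.hyps(2,3) cube_coords_sub[OF that]])
  have fin: "finite K" by (rule cliqueD(2)[OF extend.hyps(3)])
  have "(\<Sum>w\<in>?K. (?f s w - ?f s' w)\<^sup>2) = (\<Sum>w\<in>K \<inter> nbr v. (s w - s' w)\<^sup>2)"
    using fin by (subst sum.insert) (auto simp: nbr_def intro!: sum.cong)
  also have "\<dots> \<le> (\<Sum>w\<in>K. (s w - s' w)\<^sup>2)"
    by (rule sum_mono2) (use fin in auto)
  finally have "sqrt (\<Sum>w\<in>?K. (?f s w - ?f s' w)\<^sup>2) \<le> sqrt (\<Sum>w\<in>K. (s w - s' w)\<^sup>2)" by simp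
  moreover have "string_length \<Gamma> (slide g v a x) (flat_map \<Gamma> ?h (?f s'))
      (l' + sqrt (\<Sum>w\<in>?K. (?f s w - ?f s' w)\<^sup>2))"
    by (rule string_length.extend[OF _ h K cube[OF extend.hyps(4)] cube[OF extend.hyps(5)]])
      (use l' e[OF extend.hyps(4)] in simp)
  ultimately show ?case
    using l'(1) unfolding e[OF extend.hyps(5)] by (blast intro: add_mono)
qed

definition axis :: "'v \<Rightarrow> real \<Rightarrow> 'v \<Rightarrow> real" where
  "axis v a = (\<lambda>w. if w = v then a else 0)"

lemma coords_single: "coords {v} = range (axis v)"
proof (intro equalityI subsetI)
  fix s :: "'v \<Rightarrow> real" assume "s \<in> coords {v}"
  then have "s = axis v (s v)" by (auto simp: coords_def axis_def)
  then show "s \<in> range (axis v)" by blast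
qed (auto simp: coords_def axis_def)

lemma flat_map_axis:
  assumes v: "v \<in> V" and g: "g \<in> C"
  shows "flat_map \<Gamma> g (axis v a) = (g \<cdot> gpow v \<lfloor>a\<rfloor>, axis v (frac a))"
proof -
  have "(\<lambda>w. \<lfloor>axis v a w\<rfloor>) = (\<lambda>_. 0)(v := \<lfloor>a\<rfloor>)" "(\<lambda>w. frac (axis v a w)) = axis v (frac a)"
    by (auto simp: axis_def)
  then show ?thesis unfolding flat_map_def using monomial_single[OF v] by (simp del: fun_upd_apply)
qed

lemma line_points: "v \<in> V \<Longrightarrow> g \<in> C \<Longrightarrow> flat g {v} = range (\<lambda>a. (g \<cdot> gpow v \<lfloor>a\<rfloor>, axis v (frac a)))"
  unfolding flat_def coords_single by (auto simp: flat_map_axis image_image)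

lemma slide_line:
  assumes v: "v \<in> V" and g: "g \<in> C" and m: "m \<in> par (nbr v)"
  shows "slide g v a (g \<cdot> m \<cdot> gpow v k, axis v b) = (g \<cdot> m \<cdot> gpow v \<lfloor>a\<rfloor>, axis v (frac a))"
proof -
  have "ret (nbr v) (gpow v k) = one_elt" by (rule ret_one[of _ "{v}"]) (use v in \<open>auto simp: nbr_def intro: gpow_par\<close>)
  moreover have "ret (nbr v) m = m" using ret_id[OF m] by simp
  ultimately have "ret (nbr v) (inver g \<cdot> (g \<cdot> m \<cdot> gpow v k)) = m"
    using par_in[OF m] g v by (simp add: G.m_assoc inv_cancel ret_mult)
  then show ?thesis by (auto simp: slide_def axis_def nbr_def fun_eq_iff)
qed

text \<open>Sliding to the height of \<open>x0\<close> takes \<open>x\<close> to \<open>x0\<close>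
  and the second geodesic into itself, without lengthening strings. Exchanging the two points gives
  the reverse inequality.\<close>

lemma setdist_slide_le:
  assumes v: "v \<in> V" and g: "g \<in> C" and m: "m \<in> par (nbr v)" and n: "n \<in> par (nbr v)"
    and x: "x \<in> flat (g \<cdot> m) {v}" and x0: "x0 \<in> flat (g \<cdot> m) {v}"
  shows "X_setdist \<Gamma> x0 (flat (g \<cdot> n) {v}) \<le> X_setdist \<Gamma> x (flat (g \<cdot> n) {v})"
proof -
  have mC: "g \<cdot> m \<in> C" "g \<cdot> n \<in> C" using g m n par_in by auto
  have sub: "flat (g \<cdot> m) {v} \<subseteq> X \<Gamma>" "flat (g \<cdot> n) {v} \<subseteq> X \<Gamma>"
    using flat_X mC clique_sing[OF v] by blast+
  obtain a where a: "x0 = (g \<cdot> m \<cdot> gpow v \<lfloor>a\<rfloor>, axis v (frac a))"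
    using x0 line_points[OF v mC(1)] by auto
  have sx: "slide g v a x = x0"
    using x slide_line[OF v g m] a unfolding line_points[OF v mC(1)] by auto
  let ?L = "flat (g \<cdot> n) {v}"
  have ne: "X_dist \<Gamma> x ` ?L \<noteq> {}" using line_points[OF v mC(2)] by auto
  show ?thesis
    unfolding X_setdist_def[of _ x]
  proof (rule cInf_greatest[OF ne])
    fix d assume "d \<in> X_dist \<Gamma> x ` ?L"
    then obtain y where y: "y \<in> ?L" "d = X_dist \<Gamma> x y" by blast
    have sy: "slide g v a y \<in> ?L"
      using y(1) slide_line[OF v g n] unfolding line_points[OF v mC(2)] by auto
    have "X_setdist \<Gamma> x0 ?L \<le> X_dist \<Gamma> x0 (slide g v a y)"
      unfolding X_setdist_def
      proof (rule cInf_lower)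
      show "bdd_below (X_dist \<Gamma> x0 ` ?L)"
        by (rule bdd_belowI[of _ 0]) (use sub x0 X_dist_nonneg in blast)
    qed (use sy in blast)
    also have "\<dots> \<le> X_dist \<Gamma> x y"
    proof (rule X_dist_ge)
      fix l assume "string_length \<Gamma> x y l"
      from string_slide[OF g v this, of a] obtain l' where "l' \<le> l" "string_length \<Gamma> x0 (slide g v a y) l'"
        using sx by auto
      then show "X_dist \<Gamma> x0 (slide g v a y) \<le> l" using X_dist_le by fastforce
    qed (use sub x y in auto)
    finally show "X_setdist \<Gamma> x0 ?L \<le> d" using y by simp
  qed
qed

lemma parallel_nbr:
  assumes v: "v \<in> V" and g: "g \<in> C" and m: "m \<in> par (nbr v)"
  shows "parallel \<Gamma> (flat g {v}) (flat (g \<cdot> m) {v})"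
proof -
  have "X_setdist \<Gamma> x0 (flat (g \<cdot> n) {v}) = X_setdist \<Gamma> x (flat (g \<cdot> n) {v})"
    if "m \<in> par (nbr v)" "n \<in> par (nbr v)" "x \<in> flat (g \<cdot> m) {v}" "x0 \<in> flat (g \<cdot> m) {v}" for m n x x0
    using setdist_slide_le[OF v g that(1,2)] that(3,4) by (meson order_antisym)
  note * = this
  have "X_setdist \<Gamma> x (flat g {v}) = X_setdist \<Gamma> (vertex (g \<cdot> m)) (flat g {v})" if "x \<in> flat (g \<cdot> m) {v}" for x
    using *[OF m par_one _ that, of "vertex (g \<cdot> m)"] mem_flat_vertex[OF _ clique_sing[OF v], of "g \<cdot> m"] g par_in[OF m]
    by simp
  moreover have "X_setdist \<Gamma> x (flat (g \<cdot> m) {v}) = X_setdist \<Gamma> (vertex g) (flat (g \<cdot> m) {v})" if "x \<in> flat g {v}" for x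
    using *[OF par_one m, of "vertex g" x] mem_flat_vertex[OF g clique_sing[OF v], of g] g that by simp
  ultimately show ?thesis
    unfolding parallel_def by blast
qed

text \<open>\<open>v\<close> commutes with \<open>N\<close>, so all its occurrences can be collected
  on the right.\<close>

lemma par_insert_decomp:
  assumes v: "v \<in> V" and N: "N \<subseteq> nbr v" and z: "z \<in> par (insert v N)"
  shows "\<exists>m\<in>par N. \<exists>k. z = m \<cdot> gpow v k"
proof -
  obtain u where u: "z = cl u" "u \<in> words \<Gamma>" "fst ` set u \<subseteq> insert v N" using z by (auto simp: par_def)
  from u(2,3) have "\<exists>m\<in>par N. \<exists>k. cl u = m \<cdot> gpow v k"
  proof (induction u)
    case Nil
    then show ?case by (intro bexI[of _ one_elt] exI[of _ 0]) auto
  next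
    case (Cons t u)
    then obtain m k where m: "m \<in> par N" "cl u = m \<cdot> gpow v k" by auto
    have mC: "m \<in> C" using m par_in by blast
    obtain w b where t: "t = (w, b)" by (cases t)
    show ?case
    proof (cases "w = v")
      case True
      have "cl [t] \<cdot> m = m \<cdot> cl [t]" using par_nbr_commute[of m t] par_mono[OF N] m True t by auto
      moreover have "cl (t # u) = cl [t] \<cdot> m \<cdot> gpow v k"
        using Cons.prems m mC v by (simp add: cl_Cons[of t u] G.m_assoc)
      ultimately have "cl (t # u) = m \<cdot> (cl [t] \<cdot> gpow v k)"
        using Cons.prems mC v by (simp add: G.m_assoc)
      then have "cl (t # u) = m \<cdot> (gpow v (if b then 1 else -1) \<cdot> gpow v k)"
        unfolding t True gpow_letter[OF v, of b] .
      then show ?thesis using m gpow_add[OF v] by metis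
    next
      case False
      then have "cl [t] \<in> par N" using Cons.prems t by (intro par_letter) auto
      moreover have "cl (t # u) = cl [t] \<cdot> m \<cdot> gpow v k"
        using Cons.prems m mC v by (simp add: cl_Cons[of t u] G.m_assoc)
      ultimately show ?thesis using par_mult m by blast
    qed
  qed
  then show ?thesis using u by simp
qed

text \<open>The link part of the translation is covered by sliding; the remaining power of
  \<open>v\<close> moves the geodesic along itself.\<close>

lemma parallel_star:
  assumes v: "v \<in> V" and g: "g \<in> C" and h: "h \<in> lc g (star v)"
  shows "parallel \<Gamma> (flat g {v}) (flat h {v})"
proof -
  obtain z where z: "z \<in> par (star v)" "h = g \<cdot> z" using h by (auto simp: lc_def)
  obtain m k where m: "m \<in> par (nbr v)" "z = m \<cdot> gpow v k" using par_insert_decomp[OF v, of "nbr v" z] z(1) by (auto simp: star_def)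
  have mC: "m \<in> C" using m par_in by blast
  have "h = g \<cdot> m \<cdot> gpow v k" using z m mC g v by (simp add: G.m_assoc)
  then have "h \<in> lc (g \<cdot> m) {v}" using gpow_par[OF v, of "{v}"] lcI by simp
  then have "flat h {v} = flat (g \<cdot> m) {v}" using flat_eq clique_sing[OF v] mC g by simp
  then show ?thesis using parallel_nbr[OF v g m(1)] by simp
qed

subsection \<open>Lines in different classes\<close>

text \<open>Extends the arc length coordinate of \<open>flat g {v}\<close> to all of
  \<open>X \<Gamma>\<close>: a signed count of the walls that meet this geodesic. The fractional
  part is added only over the star coset, since edges labelled \<open>v\<close> elsewhere cross no
  such wall.\<close>

definition line_coord :: "'v word set \<Rightarrow> 'v \<Rightarrow> 'v point \<Rightarrow> real" where
  "line_coord g v x = of_int (crs (lc g (star v)) (v, True) g (fst x)) +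
     (if fst x \<in> lc g (star v) then snd x v else 0)"

lemma line_coord_flat_map:
  assumes g: "g \<in> C" and v: "v \<in> V" and h: "h \<in> C" and K: "K \<in> graph_cliques \<Gamma>" and s: "s \<in> coords K"
  shows "line_coord g v (flat_map \<Gamma> h s) =
    of_int (crs (lc g (star v)) (v, True) g h) + (if h \<in> lc g (star v) then s v else 0)"
proof -
  have m: "supp (\<lambda>v. \<lfloor>s v\<rfloor>) \<subseteq> K" by (rule flat_map_floor_clique[OF s])
  have "s v = 0" if "v \<notin> K" using s that by (simp add: coords_def)
  then show ?thesis
    using crs_star_monomial[OF g v g h K m] by (auto simp: line_coord_def flat_map_def frac_def)
qed

text \<open>On each cube \<open>line_coord\<close> is constant or differs from the coordinate of
  \<open>v\<close> by a constant.\<close>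

lemma line_coord_lipschitz:
  assumes g: "g \<in> C" and v: "v \<in> V" and str: "string_length \<Gamma> x y l"
  shows "\<bar>line_coord g v x - line_coord g v y\<bar> \<le> l"
  using str
proof (induction rule: string_length.induct)
  case (extend x h s l K s')
  have "\<bar>line_coord g v (flat_map \<Gamma> h s) - line_coord g v (flat_map \<Gamma> h s')\<bar> \<le> \<bar>s v - s' v\<bar>"
    using extend.hyps by (auto simp: line_coord_flat_map[OF g v _ _ cube_coords_sub])
  also have "\<dots> \<le> sqrt (\<Sum>w\<in>K. (s w - s' w)\<^sup>2)"
  proof (cases "v \<in> K")
    case True
    have "(s v - s' v)\<^sup>2 \<le> (\<Sum>w\<in>K. (s w - s' w)\<^sup>2)"
      by (rule member_le_sum[OF True]) (use cliqueD(2)[OF extend.hyps(3)] in auto)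
    then show ?thesis by (metis real_sqrt_abs real_sqrt_le_mono)
  next
    case False
    then have "s v = 0" "s' v = 0" using extend.hyps by (auto simp: cube_coords_def coords_def)
    then show ?thesis by (simp add: sum_nonneg)
  qed
  finally show ?case using extend.IH by linarith
qed simp

lemma line_coord_own:
  assumes g: "g \<in> C" and v: "v \<in> V" shows "line_coord g v (flat_map \<Gamma> g (axis v a)) = a"
proof -
  have "axis v a \<in> coords {v}" using coords_single by blast
  from line_coord_flat_map[OF g v g clique_sing[OF v] this] show ?thesis
    using lk_invariant_star[OF g, of v] g by (simp add: axis_def)
qed

lemma line_coord_other:
  assumes g: "g \<in> C" and v: "v \<in> V" and h: "h \<in> C" and w: "w \<in> V"
    and ne: "\<not> (v = w \<and> h \<in> lc g (star v))" and x: "x \<in> flat h {w}"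
  shows "line_coord g v x = of_int (crs (lc g (star v)) (v, True) g h)"
proof -
  obtain a where a: "x = flat_map \<Gamma> h (axis w a)" using x unfolding flat_def coords_single by auto
  have "axis w a \<in> coords {w}" using coords_single by blast
  from line_coord_flat_map[OF g v h clique_sing[OF w] this] show ?thesis
    using a ne by (auto simp: axis_def)
qed

text \<open>If the right-hand side fails, \<open>line_coord\<close> is constant on the second
  geodesic but takes all real values on the first, so the distance to the second is unbounded on the
  first.\<close>

lemma parallel_lines_iff:
  assumes g: "g \<in> C" and v: "v \<in> V" and h: "h \<in> C" and w: "w \<in> V"
  shows "parallel \<Gamma> (flat g {v}) (flat h {w}) \<longleftrightarrow> v = w \<and> h \<in> lc g (star v)"
proof
  assume p: "parallel \<Gamma> (flat g {v}) (flat h {w})"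
  show "v = w \<and> h \<in> lc g (star v)"
  proof (rule ccontr)
    assume ne: "\<not> (v = w \<and> h \<in> lc g (star v))"
    let ?c = "of_int (crs (lc g (star v)) (v, True) g h) :: real"
    obtain c where c: "\<And>x. x \<in> flat g {v} \<Longrightarrow> X_setdist \<Gamma> x (flat h {w}) = c" using p by (auto simp: parallel_def)
    \<comment> \<open>Far enough along the first geodesic for its distance to exceed the supposed
      constant \<open>c\<close>, whatever the sign of \<open>c\<close>.\<close>
    let ?x = "flat_map \<Gamma> g (axis v (?c + \<bar>c\<bar> + 1))"
    have x: "?x \<in> flat g {v}" unfolding flat_def coords_single by blast
    have "\<bar>c\<bar> + 1 \<le> X_setdist \<Gamma> ?x (flat h {w})"
      unfolding X_setdist_def
    proof (rule cInf_greatest)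
      show "X_dist \<Gamma> ?x ` flat h {w} \<noteq> {}" using line_points[OF w h] by auto
      fix d assume "d \<in> X_dist \<Gamma> ?x ` flat h {w}"
      then obtain y where y: "y \<in> flat h {w}" "d = X_dist \<Gamma> ?x y" by blast
      have "\<bar>c\<bar> + 1 \<le> X_dist \<Gamma> ?x y"
      proof (rule X_dist_ge)
        show "?x \<in> X \<Gamma>" "y \<in> X \<Gamma>" using x y flat_X g h clique_sing v w by blast+
        fix l assume "string_length \<Gamma> ?x y l"
        from line_coord_lipschitz[OF g v this] show "\<bar>c\<bar> + 1 \<le> l"
          unfolding line_coord_own[OF g v] line_coord_other[OF g v h w ne y(1)] by simp
      qed
      then show "\<bar>c\<bar> + 1 \<le> d" using y by simp
    qed
    then show False using c[OF x] by simp
  qed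
next
  assume "v = w \<and> h \<in> lc g (star v)"
  then show "parallel \<Gamma> (flat g {v}) (flat h {w})" using parallel_star[OF v g] by blast
qed

end

section \<open>Full subcomplexes and connected complements\<close>

lemma verts_flag_complex [simp]: "verts (flag_complex V R) = V"
proof (intro equalityI subsetI)
  fix v assume "v \<in> V"
  then have "{v} \<in> flag_complex V R" by (simp add: flag_complex_def cliques_def)
  then show "v \<in> verts (flag_complex V R)" by (auto simp: verts_def)
qed (auto simp: verts_def flag_complex_def cliques_def)

lemma adjacent_flag_complex:
  "adjacent (flag_complex V R) a b \<longleftrightarrow> a \<noteq> b \<and> a \<in> V \<and> b \<in> V \<and> R a b \<and> R b a"
  by (auto simp: adjacent_def flag_complex_def cliques_def pairwise_def)

lemma verts_full_subcomplex:
  assumes "\<And>v. v \<in> verts K \<Longrightarrow> {v} \<in> K" shows "verts (full_subcomplex K A) = verts K \<inter> A"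
proof (intro equalityI subsetI)
  fix v assume "v \<in> verts K \<inter> A"
  then have "{v} \<in> full_subcomplex K A" using assms by (simp add: full_subcomplex_def)
  then show "v \<in> verts (full_subcomplex K A)" by (auto simp: verts_def)
qed (auto simp: verts_def full_subcomplex_def)

lemma connected_remove:
  assumes "\<And>v. v \<in> verts K \<Longrightarrow> {v} \<in> K"
  shows "connected_complex (remove K L) \<longleftrightarrow>
    (\<forall>a\<in>verts K - verts L. \<forall>b\<in>verts K - verts L.
      (a, b) \<in> {(c, d). adjacent K c d \<and> c \<notin> verts L \<and> d \<notin> verts L}\<^sup>*)"
proof -
  have "verts (remove K L) = verts K - verts L"
    using verts_full_subcomplex[of K, OF assms] by (auto simp: remove_def)
  moreover have "edge_rel (remove K L) = {(c, d). adjacent K c d \<and> c \<notin> verts L \<and> d \<notin> verts L}"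
    by (auto simp: edge_rel_def remove_def full_subcomplex_def adjacent_def verts_def)
  ultimately show ?thesis by (simp add: connected_complex_def)
qed

context raag_graph
begin

subsection \<open>Connectivity in the graph\<close>

definition joined :: "'v set \<Rightarrow> ('v \<times> 'v) set" where
  "joined S = {(c, d). adj c d \<and> c \<notin> S \<and> d \<notin> S}\<^sup>*"

definition conn :: "'v set \<Rightarrow> bool" where
  "conn S \<longleftrightarrow> (\<forall>a\<in>V - S. \<forall>b\<in>V - S. (a, b) \<in> joined S)"

lemma joined_edge: "adj a b \<Longrightarrow> a \<notin> S \<Longrightarrow> b \<notin> S \<Longrightarrow> (a, b) \<in> joined S"
  by (auto simp: joined_def)

lemma joined_refl: "(a, a) \<in> joined S"
  by (simp add: joined_def)

lemma joined_trans: "(a, b) \<in> joined S \<Longrightarrow> (b, c) \<in> joined S \<Longrightarrow> (a, c) \<in> joined S"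
  by (auto simp: joined_def)

lemma joined_sym: "(a, b) \<in> joined S \<Longrightarrow> (b, a) \<in> joined S"
proof -
  have "sym {(c, d). adj c d \<and> c \<notin> S \<and> d \<notin> S}" using adj_sym by (auto simp: sym_def)
  from sym_rtrancl[OF this] show "(a, b) \<in> joined S \<Longrightarrow> (b, a) \<in> joined S"
    by (auto simp: joined_def sym_def)
qed

lemma joined_mono: "S \<subseteq> T \<Longrightarrow> joined T \<subseteq> joined S"
  unfolding joined_def by (rule rtrancl_mono) auto

text \<open>Each vertex of \<open>L - S\<close> has a neighbour outside \<open>L\<close>, so putting
  it back creates no new component.\<close>

lemma conn_extend:
  assumes L: "conn L" and S: "S \<subseteq> L" and ex: "\<And>a. a \<in> V \<Longrightarrow> a \<in> L - S \<Longrightarrow> \<exists>b\<in>V - L. adj a b"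
  shows "conn S"
proof -
  have near: "\<exists>b\<in>V - L. (a, b) \<in> joined S" if "a \<in> V - S" for a
    using that ex[of a] joined_edge[of a _ S] joined_refl S by (cases "a \<in> L") blast+
  show ?thesis unfolding conn_def
  proof (intro ballI)
    fix a b assume "a \<in> V - S" "b \<in> V - S"
    then obtain a' b' where "a' \<in> V - L" "(a, a') \<in> joined S" "b' \<in> V - L" "(b, b') \<in> joined S"
      using near by meson
    moreover from this have "(a', b') \<in> joined S" using L joined_mono[OF S] unfolding conn_def by blast
    ultimately show "(a, b) \<in> joined S" using joined_trans joined_sym by meson
  qed
qed

lemma verts_St: "v \<in> V \<Longrightarrow> verts (St \<Gamma> v) = star v"
  unfolding St_def using verts_full_subcomplex[OF singleton_simplex] star_V by (auto simp: star_def nbr_def)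

lemma verts_lk_Int: "verts (lk \<Gamma> v \<inter> lk \<Gamma> w) = nbr v \<inter> nbr w"
proof -
  have "lk \<Gamma> v \<inter> lk \<Gamma> w = full_subcomplex \<Gamma> (nbr v \<inter> nbr w)"
    by (auto simp: lk_def full_subcomplex_def nbr_def)
  moreover have "V \<inter> (nbr v \<inter> nbr w) = nbr v \<inter> nbr w" using nbr_V[of v] by blast
  ultimately show ?thesis using verts_full_subcomplex[OF singleton_simplex, of "nbr v \<inter> nbr w"] by simp
qed

lemma connected_remove_conn: "connected_complex (remove \<Gamma> L) \<longleftrightarrow> conn (verts L)"
  using connected_remove[OF singleton_simplex] by (simp add: conn_def joined_def)

lemma connected_conn: "connected_complex \<Gamma> \<longleftrightarrow> conn {}"
  by (simp add: connected_complex_def conn_def joined_def edge_rel_def)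

text \<open>Eliminates distances and the separate connectedness condition. A non-adjacent pair
  without common neighbours has empty common link, so its condition is connectedness of the graph;
  conversely, the conditions on pairs join any two vertices.\<close>

lemma weak_type_I_iff:
  "weak_type_I \<Gamma> \<longleftrightarrow> (\<forall>v\<in>V. conn (star v)) \<and>
     (\<forall>v\<in>V. \<forall>w\<in>V. v \<noteq> w \<and> \<not> adj v w \<longrightarrow> conn (nbr v \<inter> nbr w))" (is "_ \<longleftrightarrow> ?R")
proof
  assume *: "weak_type_I \<Gamma>"
  then have c: "conn {}" and d: "\<And>v w. v \<in> V \<Longrightarrow> w \<in> V \<Longrightarrow> comb_dist \<Gamma> v w = 2 \<Longrightarrow> conn (nbr v \<inter> nbr w)"
    by (auto simp: weak_type_I_def weak_type_II_def connected_conn connected_remove_conn verts_lk_Int)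
  have "conn (nbr v \<inter> nbr w)" if vw: "v \<in> V" "w \<in> V" "v \<noteq> w" "\<not> adj v w" for v w
  proof (cases "nbr v \<inter> nbr w = {}")
    case False
    then obtain u where u: "adj v u" "adj w u" by (auto simp: nbr_def)
    have "comb_dist \<Gamma> v w = 2" unfolding comb_dist_def
    proof (rule Least_equality)
      show "(v, w) \<in> edge_rel \<Gamma> ^^ 2"
        using u adj_sym by (auto simp: numeral_2_eq_2 edge_rel_def)
      fix n assume n: "(v, w) \<in> edge_rel \<Gamma> ^^ n"
      have "n \<noteq> 0" "n \<noteq> 1" using n vw by (auto simp: edge_rel_def intro: gr0I)
      then show "2 \<le> n" by linarith
    qed
    then show ?thesis using d vw by blast
  qed (use c in simp)
  then show ?R using * by (auto simp: weak_type_I_def connected_remove_conn verts_St)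
next
  assume R: ?R
  have "conn {}" unfolding conn_def
  proof (intro ballI)
    fix a b assume ab: "a \<in> V - {}" "b \<in> V - {}"
    consider "a = b" | "adj a b" | "a \<noteq> b" "\<not> adj a b" by blast
    then show "(a, b) \<in> joined {}"
    proof cases
      case 3
      then have "(a, b) \<in> joined (nbr a \<inter> nbr b)"
        using R ab unfolding conn_def by (auto simp: nbr_def)
      then show ?thesis using joined_mono[of "{}"] by blast
    qed (auto intro: joined_refl joined_edge)
  qed
  moreover have "conn (nbr v \<inter> nbr w)" if "v \<in> V" "w \<in> V" "comb_dist \<Gamma> v w = 2" for v w
  proof -
    \<comment> \<open>\<open>comb_dist\<close> is a \<open>LEAST\<close>, so the value 2 excludes
      paths of length 0 and 1 even when there is no path at all.\<close>
    have "comb_dist \<Gamma> v w \<le> n" if "(v, w) \<in> edge_rel \<Gamma> ^^ n" for n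
      unfolding comb_dist_def using that by (rule Least_le)
    from this[of 0] this[of 1] have "v \<noteq> w" "\<not> adj v w" using that(3) by (auto simp: edge_rel_def)
    then show ?thesis using R that by blast
  qed
  ultimately show "weak_type_I \<Gamma>"
    using R by (auto simp: weak_type_I_def weak_type_II_def connected_conn connected_remove_conn verts_lk_Int verts_St)
qed

subsection \<open>The extension complex\<close>

lemma standard_flats_iff: "F \<in> standard_flats \<Gamma> \<longleftrightarrow> (\<exists>g\<in>C. \<exists>K\<in>graph_cliques \<Gamma>. F = flat g K)"
  by (auto simp: standard_flats_def standard_flats_dim_def flat_def)

lemma standard_flats_dim_iff:
  "F \<in> standard_flats_dim \<Gamma> n \<longleftrightarrow> (\<exists>g\<in>C. \<exists>K\<in>graph_cliques \<Gamma>. card K = n \<and> F = flat g K)"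
  by (auto simp: standard_flats_dim_def flat_def)

definition lines :: "'v point set set" where
  "lines = {flat g {v} | g v. g \<in> C \<and> v \<in> V}"

lemma linesI: "g \<in> C \<Longrightarrow> v \<in> V \<Longrightarrow> flat g {v} \<in> lines"
  by (auto simp: lines_def)

lemma geodesics_eq: "standard_geodesics \<Gamma> = lines"
proof (intro equalityI subsetI)
  fix l assume "l \<in> standard_geodesics \<Gamma>"
  then obtain g K where g: "g \<in> C" "K \<in> graph_cliques \<Gamma>" "card K = 1" "l = flat g K"
    using standard_flats_dim_iff[of l 1] by blast
  obtain v where "K = {v}" using card_1_singletonE[OF g(3)] .
  then show "l \<in> lines" using g cliqueD(1)[OF g(2)] by (auto simp: lines_def)
next
  fix l assume "l \<in> lines"
  then obtain g v where "g \<in> C" "v \<in> V" "l = flat g {v}" by (auto simp: lines_def)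
  then have "g \<in> C" "{v} \<in> graph_cliques \<Gamma>" "card {v} = 1" "l = flat g {v}" using clique_sing by auto
  then show "l \<in> standard_geodesics \<Gamma>" using standard_flats_dim_iff[of l 1] by blast
qed

lemma parallel_class_eq: "parallel_class \<Gamma> l = {l' \<in> lines. parallel \<Gamma> l l'}"
  unfolding parallel_class_def geodesics_eq ..

lemma Delta_eq: "Delta \<Gamma> F = parallel_class \<Gamma> ` {l \<in> lines. l \<subseteq> F}"
  unfolding Delta_def geodesics_eq ..

definition cls :: "'v \<Rightarrow> 'v word set \<Rightarrow> 'v point set set" where
  "cls v g = parallel_class \<Gamma> (flat g {v})"

definition PV :: "'v point set set set" where
  "PV = {cls v g | v g. v \<in> V \<and> g \<in> C}"

lemma clsE: assumes "q \<in> PV" obtains v g where "v \<in> V" "g \<in> C" "q = cls v g"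
  using assms by (auto simp: PV_def)

lemma clsI [simp]: "v \<in> V \<Longrightarrow> g \<in> C \<Longrightarrow> cls v g \<in> PV"
  by (auto simp: PV_def)

lemma cls_mem:
  assumes v: "v \<in> V" and g: "g \<in> C"
  shows "l \<in> cls v g \<longleftrightarrow> (\<exists>h\<in>lc g (star v). l = flat h {v})"
proof
  assume "l \<in> cls v g"
  then obtain h w where h: "h \<in> C" "w \<in> V" "l = flat h {w}" "parallel \<Gamma> (flat g {v}) l"
    by (auto simp: cls_def parallel_class_eq lines_def)
  then show "\<exists>h\<in>lc g (star v). l = flat h {v}"
    using parallel_lines_iff[OF g v h(1,2)] by blast
next
  assume "\<exists>h\<in>lc g (star v). l = flat h {v}"
  then obtain h where h: "h \<in> lc g (star v)" "l = flat h {v}" by blast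
  have "h \<in> C" by (rule lc_in[OF g h(1)])
  then show "l \<in> cls v g"
    using parallel_lines_iff[OF g v _ v] h v by (simp add: cls_def parallel_class_eq linesI)
qed

lemma cls_eq_iff:
  assumes v: "v \<in> V" and g: "g \<in> C" and w: "w \<in> V" and h: "h \<in> C"
  shows "cls v g = cls w h \<longleftrightarrow> v = w \<and> h \<in> lc g (star v)"
proof
  assume "cls v g = cls w h"
  then have "flat h {w} \<in> cls v g" using cls_mem[OF w h] h by auto
  then have "parallel \<Gamma> (flat g {v}) (flat h {w})" by (simp add: cls_def parallel_class_eq)
  then show "v = w \<and> h \<in> lc g (star v)" using parallel_lines_iff[OF g v h w] by blast
next
  assume a: "v = w \<and> h \<in> lc g (star v)"
  then have "lc h (star v) = lc g (star v)" using lc_eq[OF g] by blast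
  then have "l \<in> cls v g \<longleftrightarrow> l \<in> cls w h" for l
    using cls_mem[OF v g, of l] cls_mem[OF w h, of l] a by simp
  then show "cls v g = cls w h" by blast
qed

definition padj :: "'v point set set \<Rightarrow> 'v point set set \<Rightarrow> bool" where
  "padj a b \<longleftrightarrow> a \<noteq> b \<and> (\<exists>l\<in>a. \<exists>l'\<in>b. span_2_flat \<Gamma> l l')"

lemma extension_flag: "extension_complex \<Gamma> = flag_complex PV padj"
proof -
  have "parallel_class \<Gamma> ` standard_geodesics \<Gamma> = PV"
    unfolding geodesics_eq lines_def PV_def cls_def by blast
  then show ?thesis unfolding extension_complex_def padj_def[abs_def] by simp
qed

text \<open>A flat containing both geodesics is a coset of a clique through both labels, hence lies
  in both star cosets. Conversely, at a common point of these cosets the two geodesics through it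
  span a 2-flat.\<close>

lemma padj_iff:
  assumes v: "v \<in> V" and g: "g \<in> C" and w: "w \<in> V" and h: "h \<in> C"
  shows "padj (cls v g) (cls w h) \<longleftrightarrow> adj v w \<and> lc g (star v) \<inter> lc h (star w) \<noteq> {}"
proof
  assume p: "padj (cls v g) (cls w h)"
  then obtain l l' F where l: "l \<in> cls v g" "l' \<in> cls w h" "F \<in> standard_flats_dim \<Gamma> 2" "l \<union> l' \<subseteq> F"
    by (auto simp: padj_def span_2_flat_def)
  obtain a b where a: "a \<in> lc g (star v)" "l = flat a {v}" and b: "b \<in> lc h (star w)" "l' = flat b {w}"
    using l(1,2) cls_mem[OF v g] cls_mem[OF w h] by auto
  have ab: "a \<in> C" "b \<in> C" using a b lc_in g h by blast+
  obtain k K where k: "k \<in> C" "K \<in> graph_cliques \<Gamma>" "F = flat k K" using l by (auto simp: standard_flats_dim_iff)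
  have inc: "v \<in> K" "w \<in> K" "a \<in> lc k K" "b \<in> lc k K"
    using flat_mono_iff[OF ab(1) k(1) clique_sing[OF v] k(2)] flat_mono_iff[OF ab(2) k(1) clique_sing[OF w] k(2)]
      l(4) a b k(3) by auto
  have stars: "lc k K \<subseteq> lc k (star v)" "lc k K \<subseteq> lc k (star w)"
    using clique_star[OF k(2)] inc lc_mono by blast+
  have kv: "k \<in> lc g (star v)" and kw: "k \<in> lc h (star w)"
    using a b inc stars lc_sym[OF k(1)] lc_trans g h by blast+
  \<comment> \<open>With equal labels \<open>k\<close> would represent both classes, but adjacent
    classes are distinct.\<close>
  have "v \<noteq> w"
  proof
    assume "v = w"
    then have "cls v g = cls w k" "cls w k = cls w h"
      using cls_eq_iff[OF v g w k(1)] cls_eq_iff[OF w h w k(1)] kv kw by auto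
    then show False using p by (simp add: padj_def)
  qed
  then show "adj v w \<and> lc g (star v) \<inter> lc h (star w) \<noteq> {}"
    using cliqueD(3)[OF k(2) inc(1,2)] kv kw by blast
next
  assume *: "adj v w \<and> lc g (star v) \<inter> lc h (star w) \<noteq> {}"
  then obtain k where k: "k \<in> lc g (star v)" "k \<in> lc h (star w)" by blast
  have kC: "k \<in> C" using k lc_in g by blast
  have vw: "v \<noteq> w" using * by auto
  have K: "{v, w} \<in> graph_cliques \<Gamma>" using * v w adj_sym by (intro cliqueI) auto
  have "span_2_flat \<Gamma> (flat k {v}) (flat k {w})"
    unfolding span_2_flat_def
  proof (intro bexI[of _ "flat k {v, w}"] conjI ballI impI)
    show "flat k {v} \<union> flat k {w} \<subseteq> flat k {v, w}"
      using flat_mono_iff[OF kC kC clique_sing[OF v] K] flat_mono_iff[OF kC kC clique_sing[OF w] K] kC by simp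
    show "flat k {v, w} \<in> standard_flats_dim \<Gamma> 2"
      using standard_flats_dim_iff kC K vw by (metis card_2_iff)
    fix F assume F: "F \<in> standard_flats \<Gamma>" "flat k {v} \<union> flat k {w} \<subseteq> F"
    then obtain m L where m: "m \<in> C" "L \<in> graph_cliques \<Gamma>" "F = flat m L" by (auto simp: standard_flats_iff)
    then show "flat k {v, w} \<subseteq> F"
      using F(2) flat_mono_iff[OF kC m(1) clique_sing[OF v] m(2)]
        flat_mono_iff[OF kC m(1) clique_sing[OF w] m(2)] flat_mono_iff[OF kC m(1) K m(2)] by simp
  qed
  moreover have "flat k {v} \<in> cls v g" "flat k {w} \<in> cls w h" using cls_mem v g w h k by blast+
  moreover have "cls v g \<noteq> cls w h" using cls_eq_iff[OF v g w h] vw by simp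
  ultimately show "padj (cls v g) (cls w h)" unfolding padj_def by blast
qed

lemma padj_sym: "a \<in> PV \<Longrightarrow> b \<in> PV \<Longrightarrow> padj a b \<Longrightarrow> padj b a"
  by (elim clsE) (auto simp: padj_iff intro: adj_sym)

lemma verts_P [simp]: "verts (extension_complex \<Gamma>) = PV"
  by (simp add: extension_flag)

lemma adjacent_P: "adjacent (extension_complex \<Gamma>) a b \<longleftrightarrow> a \<in> PV \<and> b \<in> PV \<and> padj a b"
  unfolding extension_flag adjacent_flag_complex using padj_sym[of a b] padj_def[of a b] by blast

lemma P_simplex_iff: "s \<in> extension_complex \<Gamma> \<longleftrightarrow> s \<noteq> {} \<and> s \<subseteq> PV \<and> finite s \<and> pairwise padj s"
  by (auto simp: extension_flag flag_complex_def cliques_def)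

lemma verts_St_P:
  assumes "q \<in> PV" shows "verts (St (extension_complex \<Gamma>) q) = {r \<in> PV. r = q \<or> padj q r}"
proof -
  have "{r} \<in> extension_complex \<Gamma>" if "r \<in> verts (extension_complex \<Gamma>)" for r
    using that by (simp add: P_simplex_iff)
  from verts_full_subcomplex[OF this] show ?thesis
    unfolding St_def using assms by (auto simp: adjacent_P)
qed

lemma Delta_flat:
  assumes g: "g \<in> C" and K: "K \<in> graph_cliques \<Gamma>"
  shows "Delta \<Gamma> (flat g K) = (\<lambda>v. cls v g) ` K"
proof (intro equalityI subsetI)
  fix q assume "q \<in> Delta \<Gamma> (flat g K)"
  then obtain h v where h: "h \<in> C" "v \<in> V" "q = cls v h" "flat h {v} \<subseteq> flat g K"
    by (auto simp: Delta_eq lines_def cls_def)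
  then have "v \<in> K" "h \<in> lc g K" using flat_mono_iff[OF h(1) g clique_sing[OF h(2)] K] by auto
  then have "cls v g = cls v h" using cls_eq_iff[OF h(2) g h(2,1)] clique_star[OF K] lc_mono by blast
  then show "q \<in> (\<lambda>v. cls v g) ` K" using h(3) \<open>v \<in> K\<close> by (metis image_eqI)
next
  fix q assume "q \<in> (\<lambda>v. cls v g) ` K"
  then obtain v where v: "v \<in> K" "q = cls v g" by blast
  then have "v \<in> V" using cliqueD(1)[OF K] by blast
  moreover have "flat g {v} \<subseteq> flat g K" using flat_mono_iff[OF g g clique_sing[OF \<open>v \<in> V\<close>] K] v g by simp
  ultimately show "q \<in> Delta \<Gamma> (flat g K)" using v g linesI[OF g \<open>v \<in> V\<close>] unfolding Delta_eq cls_def by blast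
qed

definition mcl :: "'v set \<Rightarrow> bool" where
  "mcl K \<longleftrightarrow> K \<in> graph_cliques \<Gamma> \<and> (\<forall>L\<in>graph_cliques \<Gamma>. K \<subseteq> L \<longrightarrow> L = K)"

lemma mclD: "mcl K \<Longrightarrow> K \<in> graph_cliques \<Gamma>"
  by (simp add: mcl_def)

lemma maximal_flats_iff: "F \<in> maximal_standard_flats \<Gamma> \<longleftrightarrow> (\<exists>g\<in>C. \<exists>K. mcl K \<and> F = flat g K)"
proof
  assume F: "F \<in> maximal_standard_flats \<Gamma>"
  then obtain g K where g: "g \<in> C" "K \<in> graph_cliques \<Gamma>" "F = flat g K"
    by (auto simp: maximal_standard_flats_def standard_flats_iff)
  have "L = K" if L: "L \<in> graph_cliques \<Gamma>" "K \<subseteq> L" for L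
  proof (rule ccontr)
    assume "L \<noteq> K"
    then have "F \<subset> flat g L"
      using flat_mono_iff[OF g(1) g(1) g(2) L(1)] flat_mono_iff[OF g(1) g(1) L(1) g(2)] L g(1,3) by auto
    moreover have "flat g L \<in> standard_flats \<Gamma>" using standard_flats_iff g L by blast
    ultimately show False using F unfolding maximal_standard_flats_def by blast
  qed
  then show "\<exists>g\<in>C. \<exists>K. mcl K \<and> F = flat g K" using g by (auto simp: mcl_def)
next
  assume "\<exists>g\<in>C. \<exists>K. mcl K \<and> F = flat g K"
  then obtain g K where g: "g \<in> C" "mcl K" "F = flat g K" by blast
  note K = mclD[OF g(2)]
  have "\<not> F \<subset> F'" if F': "F' \<in> standard_flats \<Gamma>" for F'
  proof
    assume sub: "F \<subset> F'"
    obtain h L where h: "h \<in> C" "L \<in> graph_cliques \<Gamma>" "F' = flat h L" using F' unfolding standard_flats_iff by blast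
    then have "K \<subseteq> L" "g \<in> lc h L" using sub g flat_mono_iff[OF g(1) h(1) K h(2)] by auto
    then show False using g(2) h sub g flat_eq[of h L g] by (auto simp: mcl_def)
  qed
  then show "F \<in> maximal_standard_flats \<Gamma>"
    using g K by (auto simp: maximal_standard_flats_def standard_flats_iff)
qed

lemma mcl_ex: assumes "K \<in> graph_cliques \<Gamma>" obtains L where "mcl L" "K \<subseteq> L"
proof -
  have "finite {L \<in> graph_cliques \<Gamma>. K \<subseteq> L}"
    by (rule finite_subset[of _ "Pow V"]) (use cliqueD(1) finite_V in auto)
  moreover have "K \<in> {L \<in> graph_cliques \<Gamma>. K \<subseteq> L}" using assms by blast
  ultimately obtain L where L: "L \<in> graph_cliques \<Gamma>" "K \<subseteq> L"
    "\<And>M. M \<in> graph_cliques \<Gamma> \<Longrightarrow> K \<subseteq> M \<Longrightarrow> L \<subseteq> M \<Longrightarrow> L = M"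
    using finite_has_maximal2[of "{L \<in> graph_cliques \<Gamma>. K \<subseteq> L}" K] by auto
  then have "mcl L" unfolding mcl_def by blast
  then show ?thesis using that L by blast
qed

lemma mcl_add: "mcl K \<Longrightarrow> a \<in> V \<Longrightarrow> (\<And>b. b \<in> K \<Longrightarrow> a \<in> star b) \<Longrightarrow> a \<in> K"
proof (rule ccontr)
  assume K: "mcl K" "a \<in> V" "\<And>b. b \<in> K \<Longrightarrow> a \<in> star b" "a \<notin> K"
  note cK = mclD[OF K(1)]
  have ak: "adj a b \<and> adj b a" if "b \<in> K" for b
    using K(3)[OF that] K(4) that adj_sym by (auto simp: star_def nbr_def)
  have "insert a K \<in> graph_cliques \<Gamma>"
    using K(2) cliqueD(1,3)[OF cK] ak by (intro cliqueI) auto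
  then show False using K by (auto simp: mcl_def)
qed

lemma flag_at_iff:
  assumes x: "x \<in> C"
  shows "s \<in> flag_at \<Gamma> (vertex x) \<longleftrightarrow> s \<noteq> {} \<and> (\<exists>K\<in>graph_cliques \<Gamma>. s \<subseteq> (\<lambda>v. cls v x) ` K)"
proof -
  have "(\<exists>F\<in>standard_flats \<Gamma>. vertex x \<in> F \<and> s \<subseteq> Delta \<Gamma> F) \<longleftrightarrow>
      (\<exists>K\<in>graph_cliques \<Gamma>. s \<subseteq> (\<lambda>v. cls v x) ` K)"
  proof
    assume "\<exists>F\<in>standard_flats \<Gamma>. vertex x \<in> F \<and> s \<subseteq> Delta \<Gamma> F"
    then obtain g K where g: "g \<in> C" "K \<in> graph_cliques \<Gamma>" "vertex x \<in> flat g K" "s \<subseteq> Delta \<Gamma> (flat g K)"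
      by (auto simp: standard_flats_iff)
    then have "flat x K = flat g K" using mem_flat_vertex flat_eq by blast
    then show "\<exists>K\<in>graph_cliques \<Gamma>. s \<subseteq> (\<lambda>v. cls v x) ` K" using g Delta_flat[OF x g(2)] by auto
  next
    assume "\<exists>K\<in>graph_cliques \<Gamma>. s \<subseteq> (\<lambda>v. cls v x) ` K"
    then obtain K where K: "K \<in> graph_cliques \<Gamma>" "s \<subseteq> (\<lambda>v. cls v x) ` K" by blast
    then have "flat x K \<in> standard_flats \<Gamma>" "vertex x \<in> flat x K" "s \<subseteq> Delta \<Gamma> (flat x K)"
      using x Delta_flat mem_flat_vertex[OF x K(1)] by (auto simp: standard_flats_iff)
    then show "\<exists>F\<in>standard_flats \<Gamma>. vertex x \<in> F \<and> s \<subseteq> Delta \<Gamma> F" by blast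
  qed
  then show ?thesis by (simp add: flag_at_def)
qed

lemma cls_inj: "x \<in> C \<Longrightarrow> inj_on (\<lambda>v. cls v x) V"
  by (rule inj_onI) (simp add: cls_eq_iff)

lemma verts_flag_at: assumes x: "x \<in> C" shows "verts (flag_at \<Gamma> (vertex x)) = (\<lambda>v. cls v x) ` V"
proof (intro equalityI subsetI)
  fix q assume "q \<in> verts (flag_at \<Gamma> (vertex x))"
  then obtain s where "q \<in> s" "s \<in> flag_at \<Gamma> (vertex x)" by (auto simp: verts_def)
  then obtain K where "K \<in> graph_cliques \<Gamma>" "q \<in> (\<lambda>v. cls v x) ` K" unfolding flag_at_iff[OF x] by blast
  then show "q \<in> (\<lambda>v. cls v x) ` V" using cliqueD(1) by blast
next
  fix q assume "q \<in> (\<lambda>v. cls v x) ` V"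
  then have "{q} \<in> flag_at \<Gamma> (vertex x)" using flag_at_iff[OF x] clique_sing by auto
  then show "q \<in> verts (flag_at \<Gamma> (vertex x))" by (auto simp: verts_def)
qed

lemma adjacent_flag_at:
  assumes x: "x \<in> C" and ab: "a \<in> V" "b \<in> V"
  shows "adjacent (flag_at \<Gamma> (vertex x)) (cls a x) (cls b x) \<longleftrightarrow> adj a b"
proof
  assume "adjacent (flag_at \<Gamma> (vertex x)) (cls a x) (cls b x)"
  then obtain K where K: "K \<in> graph_cliques \<Gamma>" "{cls a x, cls b x} \<subseteq> (\<lambda>v. cls v x) ` K" "cls a x \<noteq> cls b x"
    using flag_at_iff[OF x] by (auto simp: adjacent_def)
  then have "a \<in> K" "b \<in> K" using cls_inj[OF x] ab cliqueD(1)[OF K(1)] by (auto simp: inj_on_def)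
  then show "adj a b" using cliqueD(3)[OF K(1)] K(3) by blast
next
  assume adj: "adj a b"
  have "{a, b} \<in> graph_cliques \<Gamma>" using ab adj adj_sym by (intro cliqueI) auto
  then have "{cls a x, cls b x} \<in> flag_at \<Gamma> (vertex x)"
    unfolding flag_at_iff[OF x] by (intro conjI bexI[of _ "{a, b}"]) auto
  moreover have "cls a x \<noteq> cls b x" using adj ab x by (auto simp: cls_eq_iff)
  ultimately show "adjacent (flag_at \<Gamma> (vertex x)) (cls a x) (cls b x)" by (simp add: adjacent_def)
qed

definition trace :: "'v word set \<Rightarrow> 'v point set set set \<Rightarrow> 'v set" where
  "trace x L = {u \<in> V. cls u x \<in> L}"

text \<open>Taking \<open>u\<close> to \<open>cls u x\<close> is an isomorphism of the graph onto
  the one-skeleton of the flag complex at \<open>x\<close>, so paths avoiding \<open>L\<close>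
  correspond.\<close>

lemma connected_flag_at:
  assumes x: "x \<in> C"
  shows "connected_complex (remove (flag_at \<Gamma> (vertex x)) L) \<longleftrightarrow> conn (trace x (verts L))"
proof -
  let ?K = "flag_at \<Gamma> (vertex x)"
  let ?R = "{(c, d). adjacent ?K c d \<and> c \<notin> verts L \<and> d \<notin> verts L}"
  let ?S = "trace x (verts L)"
  have sing: "{v} \<in> ?K" if "v \<in> verts ?K" for v
    using that flag_at_iff[OF x] clique_sing unfolding verts_flag_at[OF x] by auto
  have up: "(cls a x, cls b x) \<in> ?R\<^sup>*" if "(a, b) \<in> joined ?S" "a \<in> V" for a b
    using that unfolding joined_def
  proof (induction rule: rtrancl_induct)
    case (step b c)
    then have bc: "b \<in> V" "c \<in> V" "adj b c" "b \<notin> ?S" "c \<notin> ?S" using adj_V by auto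
    then have "(cls b x, cls c x) \<in> ?R" using adjacent_flag_at[OF x bc(1,2)] by (auto simp: trace_def)
    then show ?case using step by (meson rtrancl.rtrancl_into_rtrancl)
  qed simp
  have down: "\<exists>b\<in>V. q = cls b x \<and> (a, b) \<in> joined ?S" if "(cls a x, q) \<in> ?R\<^sup>*" "a \<in> V" for a q
    using that
  proof (induction rule: rtrancl_induct)
    case base
    then show ?case using joined_refl by blast
  next
    case (step q r)
    then obtain b where b: "b \<in> V" "q = cls b x" "(a, b) \<in> joined ?S" by blast
    have "r \<in> verts ?K" using step(2) by (auto simp: adjacent_def verts_def)
    then obtain c where c: "c \<in> V" "r = cls c x" unfolding verts_flag_at[OF x] by blast
    then have "adj b c" "b \<notin> ?S" "c \<notin> ?S" using step(2) b adjacent_flag_at[OF x b(1) c(1)] by (auto simp: trace_def)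
    then show ?case using b c joined_edge joined_trans by blast
  qed
  have "connected_complex (remove ?K L) \<longleftrightarrow>
      (\<forall>a\<in>(\<lambda>v. cls v x) ` V - verts L. \<forall>b\<in>(\<lambda>v. cls v x) ` V - verts L. (a, b) \<in> ?R\<^sup>*)"
    using connected_remove[of ?K L, OF sing] unfolding verts_flag_at[OF x] .
  also have "\<dots> \<longleftrightarrow> (\<forall>a\<in>V - ?S. \<forall>b\<in>V - ?S. (a, b) \<in> joined ?S)"
  proof (intro iffI ballI)
    fix a b assume *: "\<forall>a\<in>(\<lambda>v. cls v x) ` V - verts L. \<forall>b\<in>(\<lambda>v. cls v x) ` V - verts L. (a, b) \<in> ?R\<^sup>*"
      and ab: "a \<in> V - ?S" "b \<in> V - ?S"
    then have "(cls a x, cls b x) \<in> ?R\<^sup>*" by (auto simp: trace_def)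
    from down[OF this] ab obtain b' where "b' \<in> V" "cls b x = cls b' x" "(a, b') \<in> joined ?S" by auto
    then show "(a, b) \<in> joined ?S" using cls_inj[OF x] ab by (auto simp: inj_on_def)
  next
    fix q r assume *: "\<forall>a\<in>V - ?S. \<forall>b\<in>V - ?S. (a, b) \<in> joined ?S"
      and "q \<in> (\<lambda>v. cls v x) ` V - verts L" "r \<in> (\<lambda>v. cls v x) ` V - verts L"
    then show "(q, r) \<in> ?R\<^sup>*" using up by (auto simp: trace_def)
  qed
  finally show ?thesis unfolding conn_def .
qed


section \<open>Traces of stars and the second condition\<close>

abbreviation "P \<equiv> extension_complex \<Gamma>"

lemma geo_letter: "fst s \<in> V \<Longrightarrow> geo [s]"
proof -
  assume s: "fst s \<in> V"
  have "1 \<le> length w" if "w \<in> words \<Gamma>" "cl w = cl [s]" for w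
    using raag_eq_parity[OF cl_eqD[OF that(2)]] s by (cases w) auto
  then show ?thesis using s by (simp add: geo_def)
qed

lemma letter_par: assumes "fst s \<in> V" "cl [s] \<in> par A" shows "fst s \<in> A"
  using par_geo_labels[OF assms(2) geo_letter[OF assms(1)]] by simp

lemma cls_in_St:
  assumes v: "v \<in> V" and g: "g \<in> C" and u: "u \<in> V" and x: "x \<in> C"
  shows "cls u x \<in> verts (St P (cls v g)) \<longleftrightarrow>
    u = v \<and> x \<in> lc g (star v) \<or> adj v u \<and> lc g (star v) \<inter> lc x (star u) \<noteq> {}"
proof -
  have "cls u x = cls v g \<longleftrightarrow> u = v \<and> x \<in> lc g (star v)"
    using cls_eq_iff[OF v g u x] by auto
  then show ?thesis using verts_St_P[of "cls v g"] padj_iff[OF v g u x] assms by simp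
qed

lemma trace_star:
  assumes v: "v \<in> V" and g: "g \<in> C" and x: "x \<in> lc g (star v)"
  shows "trace x (verts (St P (cls v g))) = star v"
proof -
  have xC: "x \<in> C" by (rule lc_in[OF g x])
  have "cls u x \<in> verts (St P (cls v g)) \<longleftrightarrow> u \<in> star v" if u: "u \<in> V" for u
    unfolding cls_in_St[OF v g u xC] using x lc_self[OF xC, of "star u"] by (auto simp: star_def nbr_def)
  then show ?thesis using star_V[OF v] by (auto simp: trace_def)
qed

text \<open>When \<open>x\<close> is off the star coset of \<open>v\<close>, the vertex
  \<open>w\<close> is the label of the last edge on the path from \<open>x\<close> to its gate
  there.\<close>

lemma weak_type_I_conn_trace:
  assumes I: "weak_type_I \<Gamma>" and v: "v \<in> V" and g: "g \<in> C" and x: "x \<in> C"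
  shows "conn (trace x (verts (St P (cls v g))))"
proof (cases "x \<in> lc g (star v)")
  case True
  then show ?thesis using I v by (simp add: trace_star[OF v g] weak_type_I_iff)
next
  case False
  let ?S = "trace x (verts (St P (cls v g)))"
  obtain r where r: "geo r" "x \<cdot> cl r \<in> lc g (star v)" "\<And>w. geo w \<Longrightarrow> fst ` set w \<subseteq> star v \<Longrightarrow> geo (r @ w)"
    using gate_ex[OF x g, of "star v"] by metis
  have "r \<noteq> []" using r(2) False x by auto
  then obtain r' s where rs: "r = r' @ [s]" by (cases r rule: rev_cases) auto
  let ?w = "fst s"
  have rw: "r' \<in> words \<Gamma>" "?w \<in> V" using geo_words[OF r(1)] rs by auto
  have w: "?w \<notin> star v"
  proof
    \<comment> \<open>The gate property would make \<open>r\<close> followed by the inverse of its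
      last letter geodesic, although the two letters cancel.\<close>
    assume "?w \<in> star v"
    then have "geo (r @ [linv s])" using r(3)[OF geo_letter[of "linv s"]] rw by simp
    moreover have "cl (r @ [linv s]) = cl r'"
      using rs rw cl_append[of "r' @ [s]" "[linv s]"] by (simp add: cl_append[of r' "[s]"] letter_cancel cl_in)
    ultimately show False using geo_le[of "r @ [linv s]" r'] rs rw by simp
  qed
  have vw: "v \<noteq> ?w" "\<not> adj v ?w" using w by (auto simp: star_def nbr_def)
  let ?L = "nbr v \<inter> nbr ?w"
  have L: "conn ?L" using I v rw vw by (simp add: weak_type_I_iff)
  have "?S \<subseteq> ?L"
  proof
    fix u assume u: "u \<in> ?S"
    then have uV: "u \<in> V" by (simp add: trace_def)
    have a: "adj v u" "lc g (star v) \<inter> lc x (star u) \<noteq> {}"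
      using u cls_in_St[OF v g uV x] False by (auto simp: trace_def)
    then obtain z where "z \<in> lc g (star v)" "z \<in> lc x (star u)" by blast
    \<comment> \<open>The star coset of \<open>u\<close> through \<open>x\<close> meets that of
      \<open>v\<close>, so it contains the whole path to the gate.\<close>
    from gate_labels[OF x g geo_words[OF r(1)] r(2,3) this] have "?w \<in> star u" using rs by simp
    moreover have "?w \<noteq> u" using a vw by auto
    ultimately show "u \<in> ?L" using a adj_sym by (auto simp: star_def nbr_def)
  qed
  moreover have "\<exists>b\<in>V - ?L. adj a b" if "a \<in> ?L - ?S" for a
    using that v adj_sym by (intro bexI[of _ v]) (auto simp: nbr_def)
  ultimately show ?thesis using conn_extend[OF L] by blast
qed

text \<open>The identity is one edge, labelled \<open>w\<close>, away from the star coset.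
  Retracting to the generator \<open>w\<close> kills \<open>star v\<close> but not
  \<open>?g\<close>, so the cosets meet only if \<open>w\<close> survives in
  \<open>star u\<close>.\<close>

lemma trace_link:
  assumes v: "v \<in> V" and w: "w \<in> V" and vw: "v \<noteq> w" "\<not> adj v w"
  shows "trace one_elt (verts (St P (cls v (cl [(w, True)])))) = nbr v \<inter> nbr w"
proof -
  let ?g = "cl [(w, True)]"
  have g: "?g \<in> C" using w by simp
  have wv: "w \<notin> star v" using vw by (auto simp: star_def nbr_def)
  have 1: "one_elt \<notin> lc ?g (star v)"
  proof
    assume "one_elt \<in> lc ?g (star v)"
    then have "cl [linv (w, True)] \<in> par (star v)"
      using cl_linv[of "(w, True)"] w lc_iff[OF g G.one_closed] by simp
    then show False using letter_par[of "linv (w, True)" "star v"] w wv by simp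
  qed
  have "lc ?g (star v) \<inter> lc one_elt (star u) \<noteq> {} \<longleftrightarrow> w \<in> star u" if u: "u \<in> V" for u
  proof
    assume "lc ?g (star v) \<inter> lc one_elt (star u) \<noteq> {}"
    then obtain a z where a: "a \<in> par (star v)" "z \<in> par (star u)" "?g \<cdot> a = one_elt \<cdot> z"
      by (auto simp: lc_def)
    have "ret {w} ?g = ?g" by (rule ret_id[OF par_letter[of _ "{w}"]]) (use w in auto)
    moreover have "ret {w} a = one_elt" by (rule ret_one[OF a(1)]) (use wv in auto)
    ultimately have e: "ret {w} z = ?g" using a ret_mult[of ?g a "{w}"] g par_in[OF a(1)] par_in[OF a(2)] by simp
    show "w \<in> star u"
    proof (rule ccontr)
      assume "w \<notin> star u"
      then have "ret {w} z = one_elt" by (intro ret_one[OF a(2)]) auto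
      then have "?g \<in> par {}" using e by simp
      then show False using letter_par[of "(w, True)" "{}"] w by simp
    qed
  next
    assume "w \<in> star u"
    then have "?g \<in> lc one_elt (star u)" using par_letter[of "(w, True)" "star u"] w lcI[of ?g "star u" one_elt] g by simp
    then show "lc ?g (star v) \<inter> lc one_elt (star u) \<noteq> {}" using lc_self[OF g] by blast
  qed
  then have "cls u one_elt \<in> verts (St P (cls v ?g)) \<longleftrightarrow> u \<in> nbr v \<inter> nbr w" if "u \<in> V" for u
    unfolding cls_in_St[OF v g that G.one_closed] using that 1 vw adj_sym by (auto simp: star_def nbr_def)
  then show ?thesis using nbr_V[of v] by (auto simp: trace_def)
qed

lemma weak_type_I_iff_trace:
  "weak_type_I \<Gamma> \<longleftrightarrow> (\<forall>x\<in>C. \<forall>q\<in>PV. conn (trace x (verts (St P q))))"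
proof
  assume "weak_type_I \<Gamma>"
  then show "\<forall>x\<in>C. \<forall>q\<in>PV. conn (trace x (verts (St P q)))"
    using weak_type_I_conn_trace by (auto elim!: clsE)
next
  assume *: "\<forall>x\<in>C. \<forall>q\<in>PV. conn (trace x (verts (St P q)))"
  have "conn (star v)" if "v \<in> V" for v
    using * trace_star[OF that G.one_closed lc_self] that by (metis G.one_closed clsI)
  moreover have "conn (nbr v \<inter> nbr w)" if "v \<in> V" "w \<in> V" "v \<noteq> w" "\<not> adj v w" for v w
    using * trace_link[OF that] clsI[OF that(1), of "cl [(w, True)]"] that(2) by (metis G.one_closed fst_conv letter_in)
  ultimately show "weak_type_I \<Gamma>" unfolding weak_type_I_iff by blast
qed

lemma condition_2_iff:
  "(\<exists>x\<in>X_vertices \<Gamma>. \<exists>v\<in>verts P. \<not> connected_complex (remove (flag_at \<Gamma> x) (St P v))) \<longleftrightarrow>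
   \<not> (\<forall>x\<in>C. \<forall>q\<in>PV. conn (trace x (verts (St P q))))"
  by (auto simp: X_vertices_def connected_flag_at)

subsection \<open>Sides of a wall in the extension complex\<close>

text \<open>An edge of the coset that crosses the wall has its label in \<open>star u\<close> and an
  end in the link coset of the wall, which puts the class into the star of the class of the
  wall.\<close>

lemma far_const_class:
  assumes p: "p \<in> C" and s: "fst s \<in> V" and u: "u \<in> V" and g: "g \<in> C"
    and out: "cls u g \<notin> verts (St P (cls (fst s) p))" and y: "y \<in> lc g (star u)"
  shows "far p s y = far p s g"
  using g lc_self[OF g] y
proof (induction rule: coset_induct)
  case (step y t)
  have yC: "y \<in> C" by (rule lc_in[OF g step.hyps(1)])
  have yt: "y \<cdot> cl [t] \<in> lc g (star u)" using lc_step[OF g step.hyps] .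
  show ?case
  proof (rule ccontr)
    assume "\<not> ?case"
    then have "far p s y \<noteq> far p s (y \<cdot> cl [t])" using step.IH by simp
    then have "fst t = fst s \<and> (y \<in> lc p (nbr (fst s)) \<or> y \<cdot> cl [t] \<in> lc p (nbr (fst s)))"
      using far_step[OF p s yC step.hyps(2)] by auto
    then obtain z where z: "z \<in> lc g (star u)" "z \<in> lc p (star (fst s))" "fst s \<in> star u"
      using step.hyps yt lc_mono[of "nbr (fst s)" "star (fst s)" p] by (auto simp: star_def)
    show False
    proof (cases "u = fst s")
      case True
      then have "g \<in> lc p (star (fst s))" using z lc_trans[OF p z(2)] lc_sym[OF g z(1)] by simp
      then show False using out cls_in_St[OF s p u g] True by simp
    next
      case False
      then have "adj (fst s) u" using z(3) adj_sym by (auto simp: star_def nbr_def)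
      then show False using out cls_in_St[OF s p u g] z by blast
    qed
  qed
qed simp

text \<open>Meant for vertices outside the star of \<open>cls (fst s) p\<close>, where by
  \<open>far_const_class\<close> all representatives lie on the same side of the wall.\<close>

definition far_side :: "'v word set \<Rightarrow> 'v \<times> bool \<Rightarrow> 'v point set set \<Rightarrow> bool" where
  "far_side p s q \<longleftrightarrow> (\<exists>u\<in>V. \<exists>g\<in>C. q = cls u g \<and> far p s g)"

lemma far_side_cls:
  assumes p: "p \<in> C" and s: "fst s \<in> V" and u: "u \<in> V" and g: "g \<in> C"
    and out: "cls u g \<notin> verts (St P (cls (fst s) p))"
  shows "far_side p s (cls u g) \<longleftrightarrow> far p s g"
proof
  assume "far_side p s (cls u g)"
  then obtain w h where "w \<in> V" "h \<in> C" "cls u g = cls w h" "far p s h" by (auto simp: far_side_def)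
  then show "far p s g" using cls_eq_iff[OF u g] far_const_class[OF p s u g out] by blast
qed (use u g in \<open>auto simp: far_side_def\<close>)

text \<open>Adjacent classes have a common point in their cosets, and its side decides for
  both.\<close>

lemma far_side_padj:
  assumes p: "p \<in> C" and s: "fst s \<in> V" and qr: "q \<in> PV" "r \<in> PV" "padj q r"
    and out: "q \<notin> verts (St P (cls (fst s) p))" "r \<notin> verts (St P (cls (fst s) p))"
  shows "far_side p s q \<longleftrightarrow> far_side p s r"
proof -
  obtain u g where u: "u \<in> V" "g \<in> C" "q = cls u g" using qr clsE by metis
  obtain w h where w: "w \<in> V" "h \<in> C" "r = cls w h" using qr clsE by metis
  obtain z where "z \<in> lc g (star u)" "z \<in> lc h (star w)" using qr u w padj_iff by blast
  then have "far p s g = far p s h"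
    using far_const_class[OF p s u(1,2)] far_const_class[OF p s w(1,2)] out u w by metis
  then show ?thesis using far_side_cls[OF p s] u w out by simp
qed

text \<open>If all vertices of the simplex lay in the star, maximality would put
  \<open>fst s\<close> into the clique, and a geodesic of the flat in the class of the wall would
  cross it.\<close>

lemma uncrossed_flat:
  assumes p: "p \<in> C" and s: "fst s \<in> V" and h: "h \<in> C" and K: "mcl K"
    and c: "\<And>y. y \<in> lc h K \<Longrightarrow> far p s y = far p s h"
  shows "\<exists>k\<in>K. cls k h \<notin> verts (St P (cls (fst s) p))"
proof (rule ccontr)
  assume "\<not> ?thesis"
  then have St: "cls k h \<in> verts (St P (cls (fst s) p))" if "k \<in> K" for k using that by blast
  let ?a = "fst s"
  have KV: "K \<subseteq> V" using cliqueD(1)[OF mclD[OF K]] .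
  have "?a \<in> star k" if "k \<in> K" for k
    using St[OF that] cls_in_St[OF s p _ h, of k] that KV adj_sym by (auto simp: star_def nbr_def)
  then have a: "?a \<in> K" using mcl_add[OF K s] by blast
  then have "h \<in> lc p (star ?a)" using St[OF a] cls_in_St[OF s p _ h, of ?a] s by simp
  then obtain z where z: "z \<in> par (star ?a)" "h = p \<cdot> z" by (auto simp: lc_def)
  obtain m k where m: "m \<in> par (nbr ?a)" "z = m \<cdot> gpow ?a k"
    using par_insert_decomp[OF s, of "nbr ?a" z] z(1) by (auto simp: star_def)
  have mC: "m \<in> C" by (rule par_in[OF m(1)])
  have "gpow ?a (k + (-k)) = one_elt" by simp
  then have "gpow ?a k \<cdot> gpow ?a (-k) = one_elt" using gpow_add[OF s, of k "-k"] by simp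
  then have e: "p \<cdot> m = h \<cdot> gpow ?a (-k)" using z m mC p s by (simp add: G.m_assoc)
  have 1: "p \<cdot> m \<in> lc h K" unfolding e using gpow_par[OF s a] by (rule lcI)
  have 2: "p \<cdot> m \<cdot> cl [s] \<in> lc h K" by (rule lc_step[OF h 1 s a])
  have "p \<cdot> m \<in> lc p (nbr ?a)" by (rule lcI[OF m(1)])
  from far_coset[OF p s this] c[OF 1] c[OF 2] show False by simp
qed

subsection \<open>Simplices and maximal flats\<close>

definition simplex_or_empty :: "'v point set set set \<Rightarrow> bool" where
  "simplex_or_empty t \<longleftrightarrow> t \<subseteq> PV \<and> finite t \<and> pairwise padj t"

lemma simplex_or_empty_iff: "simplex_or_empty t \<longleftrightarrow> t = {} \<or> t \<in> P"
  by (auto simp: simplex_or_empty_def P_simplex_iff)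

lemma simplex_flat:
  assumes h: "h \<in> C" and K: "K \<in> graph_cliques \<Gamma>"
  shows "simplex_or_empty ((\<lambda>v. cls v h) ` K)"
proof -
  have KV: "K \<subseteq> V" by (rule cliqueD(1)[OF K])
  have "padj (cls a h) (cls b h)" if "a \<in> K" "b \<in> K" "cls a h \<noteq> cls b h" for a b
    using that padj_iff[of a h b h] KV h cliqueD(3)[OF K, of a b] lc_self[OF h] by blast
  then show ?thesis
    using KV h cliqueD(2)[OF K] by (auto simp: simplex_or_empty_def pairwise_def)
qed

text \<open>The star cosets of the vertices meet pairwise, so by the Helly property they have a
  common point, through which all the geodesics can be chosen; adjacency makes the labels a
  clique.\<close>

lemma simplex_is_flat:
  assumes "simplex_or_empty t"
  obtains h K where "h \<in> C" "K \<in> graph_cliques \<Gamma>" "t = (\<lambda>v. cls v h) ` K"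
proof -
  have t: "t \<subseteq> PV" "finite t" "pairwise padj t" using assms by (auto simp: simplex_or_empty_def)
  have "\<forall>q\<in>t. \<exists>v g. v \<in> V \<and> g \<in> C \<and> q = cls v g" using t(1) unfolding PV_def by blast
  then obtain lab rep where lr: "\<And>q. q \<in> t \<Longrightarrow> lab q \<in> V" "\<And>q. q \<in> t \<Longrightarrow> rep q \<in> C" "\<And>q. q \<in> t \<Longrightarrow> q = cls (lab q) (rep q)"
    by metis
  have adj: "adj (lab q) (lab r) \<and> lc (rep q) (star (lab q)) \<inter> lc (rep r) (star (lab r)) \<noteq> {}"
    if "q \<in> t" "r \<in> t" "q \<noteq> r" for q r
    using padj_iff[of "lab q" "rep q" "lab r" "rep r"] lr that t(3) by (auto simp: pairwise_def)
  have "\<exists>x\<in>C. \<forall>q\<in>t. x \<in> lc (rep q) (star (lab q))"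
  proof (rule lc_helly[OF t(2)])
    fix q r assume "q \<in> t" "r \<in> t"
    then show "lc (rep q) (star (lab q)) \<inter> lc (rep r) (star (lab r)) \<noteq> {}"
      using adj lc_self lr(2) by (cases "q = r") blast+
  qed (rule lr)
  then obtain x where x: "x \<in> C" "\<And>q. q \<in> t \<Longrightarrow> x \<in> lc (rep q) (star (lab q))" by blast
  have q: "q = cls (lab q) x" if "q \<in> t" for q
    using cls_eq_iff[of "lab q" "rep q" "lab q" x] lr that x by simp
  have "lab ` t \<in> graph_cliques \<Gamma>" using adj lr by (intro cliqueI) auto
  moreover have "t = (\<lambda>v. cls v x) ` (lab ` t)" using q by (force simp: image_image)
  ultimately show ?thesis using that x by blast
qed

lemma cls_image_eq:
  assumes h: "h \<in> C" "k \<in> C" and K: "K \<subseteq> V" "L \<subseteq> V" and sub: "(\<lambda>v. cls v h) ` K \<subseteq> (\<lambda>v. cls v k) ` L"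
  shows "K \<subseteq> L" "\<And>v. v \<in> K \<Longrightarrow> cls v h = cls v k"
proof -
  have *: "v \<in> L \<and> cls v h = cls v k" if "v \<in> K" for v
  proof -
    have "cls v h \<in> (\<lambda>v. cls v k) ` L" using sub \<open>v \<in> K\<close> by blast
    then obtain w where w: "w \<in> L" "cls v h = cls w k" by blast
    then have "v = w" using cls_eq_iff[of v h w k] h K that by blast
    then show ?thesis using w by simp
  qed
  then show "K \<subseteq> L" "\<And>v. v \<in> K \<Longrightarrow> cls v h = cls v k" by blast+
qed

text \<open>\<open>inver h \<cdot> k\<close> lies in the star group of every vertex of the clique,
  so the labels of a geodesic word for it are in all these stars, hence in the clique by
  maximality.\<close>

lemma mcl_flat_unique:
  assumes K: "mcl K" "mcl L" and h: "h \<in> C" "k \<in> C"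
    and e: "(\<lambda>v. cls v h) ` K = (\<lambda>v. cls v k) ` L"
  shows "flat h K = flat k L"
proof -
  have KV: "K \<subseteq> V" "L \<subseteq> V" using cliqueD(1) mclD K by blast+
  have KL: "K = L" using cls_image_eq(1)[OF h KV] cls_image_eq(1)[OF h(2,1) KV(2,1)] e by blast
  have "k \<in> lc h (star v)" if "v \<in> K" for v
    using cls_image_eq(2)[OF h KV] e that cls_eq_iff[of v h v k] h KV by blast
  then have st: "inver h \<cdot> k \<in> par (star v)" if "v \<in> K" for v using lc_iff h that by blast
  obtain u where u: "geo u" "cl u = inver h \<cdot> k" using geo_ex h by (metis G.inv_closed G.m_closed)
  have "fst ` set u \<subseteq> K"
  proof
    fix a assume a: "a \<in> fst ` set u"
    then have "a \<in> V" using geo_words[OF u(1)] words_iff by blast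
    moreover have "a \<in> star v" if "v \<in> K" for v using par_geo_labels[OF _ u(1)] st[OF that] u(2) a by auto
    ultimately show "a \<in> K" using mcl_add[OF K(1)] by blast
  qed
  then have "inver h \<cdot> k \<in> par K" using parI[OF geo_words[OF u(1)]] u(2) by auto
  then have "k \<in> lc h K" using lc_iff h by blast
  then show ?thesis using flat_eq[OF h(1) mclD[OF K(1)]] KL by simp
qed

end

section \<open>Automorphisms of the extension complex and visibility\<close>

locale automorphism = raag_graph \<Gamma> for \<Gamma> :: "'v set set" +
  fixes \<alpha> :: "'v point set set \<Rightarrow> 'v point set set"
  assumes iso: "simplicial_iso (extension_complex \<Gamma>) (extension_complex \<Gamma>) \<alpha>"
begin

lemma bij_vertices: "bij_betw \<alpha> PV PV"
  using iso by (simp add: simplicial_iso_def)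

lemma image_vertex [simp]: "q \<in> PV \<Longrightarrow> \<alpha> q \<in> PV"
  using bij_vertices bij_betwE by blast

lemma image_eq_iff: "q \<in> PV \<Longrightarrow> r \<in> PV \<Longrightarrow> \<alpha> q = \<alpha> r \<longleftrightarrow> q = r"
  using bij_vertices by (auto simp: bij_betw_def inj_on_def)

lemma preimage_vertex: assumes "q \<in> PV" obtains r where "r \<in> PV" "\<alpha> r = q"
proof -
  have "q \<in> \<alpha> ` PV" using bij_vertices assms by (simp add: bij_betw_def)
  then show ?thesis using that by blast
qed

lemma simplex_image: "t \<subseteq> PV \<Longrightarrow> simplex_or_empty (\<alpha> ` t) \<longleftrightarrow> simplex_or_empty t"
  using iso by (auto simp: simplicial_iso_def simplex_or_empty_iff)

lemma padj_image: assumes "q \<in> PV" "r \<in> PV" shows "padj (\<alpha> q) (\<alpha> r) \<longleftrightarrow> padj q r"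
proof -
  have *: "padj a b \<longleftrightarrow> a \<noteq> b \<and> simplex_or_empty {a, b}" if "a \<in> PV" "b \<in> PV" for a b
  proof -
    have "padj a b \<longrightarrow> padj b a \<and> a \<noteq> b" using padj_sym[OF that] by (simp add: padj_def[of a b])
    then show ?thesis using that by (auto simp: simplex_or_empty_def pairwise_def)
  qed
  show ?thesis using *[OF assms] *[of "\<alpha> q" "\<alpha> r"] simplex_image[of "{q, r}"] assms image_eq_iff by simp
qed

text \<open>A larger simplex around the image pulls back to a simplex around the given one, which is
  maximal.\<close>

lemma image_mcl:
  assumes h: "h \<in> C" and K: "mcl K"
  obtains k L where "k \<in> C" "mcl L" "\<alpha> ` (\<lambda>v. cls v h) ` K = (\<lambda>v. cls v k) ` L"
proof -
  let ?s = "(\<lambda>v. cls v h) ` K"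
  have KV: "K \<subseteq> V" by (rule cliqueD(1)[OF mclD[OF K]])
  have sPV: "?s \<subseteq> PV" using KV h by auto
  have "simplex_or_empty (\<alpha> ` ?s)" using simplex_image[OF sPV] simplex_flat[OF h mclD[OF K]] by simp
  then obtain k L where k: "k \<in> C" "L \<in> graph_cliques \<Gamma>" "\<alpha> ` ?s = (\<lambda>v. cls v k) ` L"
    using simplex_is_flat by metis
  have LV: "L \<subseteq> V" by (rule cliqueD(1)[OF k(2)])
  have "M = L" if M: "M \<in> graph_cliques \<Gamma>" "L \<subseteq> M" for M
  proof -
    have MV: "M \<subseteq> V" by (rule cliqueD(1)[OF M(1)])
    let ?t = "(\<lambda>v. cls v k) ` M"
    define t0 where "t0 = {q \<in> PV. \<alpha> q \<in> ?t}"
    have t: "simplex_or_empty ?t" by (rule simplex_flat[OF k(1) M(1)])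
    have at: "\<alpha> ` t0 = ?t"
    proof
      show "?t \<subseteq> \<alpha> ` t0"
      proof
        fix q assume q: "q \<in> ?t"
        then have "q \<in> PV" using t by (auto simp: simplex_or_empty_def)
        then obtain r where "r \<in> PV" "\<alpha> r = q" using preimage_vertex by blast
        then show "q \<in> \<alpha> ` t0" using q by (auto simp: t0_def)
      qed
    qed (auto simp: t0_def)
    then have "simplex_or_empty t0" using simplex_image[of t0] t by (auto simp: t0_def)
    then obtain k0 L0 where k0: "k0 \<in> C" "L0 \<in> graph_cliques \<Gamma>" "t0 = (\<lambda>v. cls v k0) ` L0"
      using simplex_is_flat by metis
    have "\<alpha> ` ?s \<subseteq> ?t" using k(3) M(2) by auto
    then have sub: "?s \<subseteq> t0" using sPV by (auto simp: t0_def)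
    then have c: "K \<subseteq> L0" "\<And>v. v \<in> K \<Longrightarrow> cls v h = cls v k0"
      using cls_image_eq[OF h k0(1) KV cliqueD(1)[OF k0(2)]] k0(3) by auto
    then have "L0 = K" using K k0(2) by (auto simp: mcl_def)
    then have "t0 = ?s" using k0(3) c(2) by (auto intro: image_cong)
    then have "?t = (\<lambda>v. cls v k) ` L" using at k(3) by simp
    then show ?thesis using cls_inj[OF k(1)] inj_on_image_eq_iff[of "\<lambda>v. cls v k" V M L] MV LV by simp
  qed
  then have "mcl L" using k(2) by (auto simp: mcl_def)
  then show ?thesis using that k by blast
qed

definition target :: "'v point set \<Rightarrow> 'v point set" where
  "target F = (THE F'. F' \<in> maximal_standard_flats \<Gamma> \<and> Delta \<Gamma> F' = \<alpha> ` Delta \<Gamma> F)"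

lemma visible_target:
  "visible \<Gamma> \<Gamma> \<alpha> \<longleftrightarrow>
    (\<forall>p\<in>C. \<exists>x. \<forall>F. F \<in> maximal_standard_flats \<Gamma> \<longrightarrow> vertex p \<in> F \<longrightarrow> x \<in> target F)"
proof -
  have "(\<Inter>F\<in>{F \<in> maximal_standard_flats \<Gamma>. vertex p \<in> F}. target F) \<noteq> {} \<longleftrightarrow>
      (\<exists>x. \<forall>F. F \<in> maximal_standard_flats \<Gamma> \<longrightarrow> vertex p \<in> F \<longrightarrow> x \<in> target F)" for p
    by blast
  then show ?thesis unfolding visible_def target_def[symmetric] by simp
qed

text \<open>Evaluates the definite description in \<open>target\<close>: existence comes from
  \<open>image_mcl\<close>, uniqueness from \<open>mcl_flat_unique\<close>.\<close>

lemma image_flat: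
  assumes h: "h \<in> C" and K: "mcl K"
  obtains k L where "k \<in> C" "mcl L" "\<alpha> ` (\<lambda>v. cls v h) ` K = (\<lambda>v. cls v k) ` L"
    "target (flat h K) = flat k L"
proof -
  obtain k L where k: "k \<in> C" "mcl L" "\<alpha> ` (\<lambda>v. cls v h) ` K = (\<lambda>v. cls v k) ` L"
    using image_mcl[OF h K] .
  have D: "\<alpha> ` Delta \<Gamma> (flat h K) = (\<lambda>v. cls v k) ` L" using Delta_flat[OF h mclD[OF K]] k(3) by simp
  have "target (flat h K) = flat k L"
    unfolding target_def D
  proof (rule the_equality)
    have "flat k L \<in> maximal_standard_flats \<Gamma>" unfolding maximal_flats_iff using k by blast
    then show "flat k L \<in> maximal_standard_flats \<Gamma> \<and> Delta \<Gamma> (flat k L) = (\<lambda>v. cls v k) ` L"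
      using Delta_flat[OF k(1) mclD[OF k(2)]] by simp
    fix F assume F: "F \<in> maximal_standard_flats \<Gamma> \<and> Delta \<Gamma> F = (\<lambda>v. cls v k) ` L"
    then obtain f M where f: "f \<in> C" "mcl M" "F = flat f M" unfolding maximal_flats_iff by blast
    then have "(\<lambda>v. cls v f) ` M = (\<lambda>v. cls v k) ` L" using F Delta_flat[OF f(1) mclD[OF f(2)]] by simp
    then show "F = flat k L" using mcl_flat_unique[OF f(2) k(2) f(1) k(1)] f by simp
  qed
  then show ?thesis using that k by blast
qed

lemma images_meet:
  assumes cond: "\<And>q. q \<in> PV \<Longrightarrow> conn (trace p (verts (St P q)))"
    and p: "p \<in> C" and K: "mcl K1" "mcl K2" and L: "mcl L1" "mcl L2" and h: "h1 \<in> C" "h2 \<in> C"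
    and e1: "\<alpha> ` (\<lambda>v. cls v p) ` K1 = (\<lambda>v. cls v h1) ` L1"
    and e2: "\<alpha> ` (\<lambda>v. cls v p) ` K2 = (\<lambda>v. cls v h2) ` L2"
  shows "lc h1 L1 \<inter> lc h2 L2 \<noteq> {}"
proof
  assume "lc h1 L1 \<inter> lc h2 L2 = {}"
  then obtain x s where x: "x \<in> C" "fst s \<in> V" "\<And>y. y \<in> lc h1 L1 \<Longrightarrow> \<not> far x s y" "\<And>y. y \<in> lc h2 L2 \<Longrightarrow> far x s y"
    using lc_separation[OF h] by metis
  let ?q = "cls (fst s) x"
  let ?St = "verts (St P ?q)"
  have q: "?q \<in> PV" using x by simp
  obtain q0 where q0: "q0 \<in> PV" "\<alpha> q0 = ?q" using preimage_vertex[OF q] .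
  let ?S = "trace p (verts (St P q0))"
  have St_iff: "\<alpha> r \<in> ?St \<longleftrightarrow> r \<in> verts (St P q0)" if "r \<in> PV" for r
    using that q q0 padj_image[OF q0(1) that] image_eq_iff[OF that q0(1)] by (simp add: verts_St_P)
  \<comment> \<open>Each image flat lies on one side of the wall, and by
    \<open>uncrossed_flat\<close> the simplex of the original flat has a vertex outside the star of
    \<open>q0\<close> that is sent to that side.\<close>
  have pick: "\<exists>u\<in>V - ?S. \<alpha> (cls u p) \<notin> ?St \<and> (far_side x s (\<alpha> (cls u p)) \<longleftrightarrow> far x s h)"
    if KL: "mcl K" "mcl L" "h \<in> C" "\<alpha> ` (\<lambda>v. cls v p) ` K = (\<lambda>v. cls v h) ` L"
      "\<And>y. y \<in> lc h L \<Longrightarrow> far x s y = far x s h" for K L h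
  proof -
    obtain k where k: "k \<in> L" "cls k h \<notin> ?St" using uncrossed_flat[OF x(1,2) KL(3,2,5)] by blast
    have "cls k h \<in> \<alpha> ` (\<lambda>v. cls v p) ` K" using k KL(4) by blast
    then obtain u where u: "u \<in> K" "cls k h = \<alpha> (cls u p)" by blast
    have uV: "u \<in> V" and kV: "k \<in> V" using u k cliqueD(1) mclD KL(1,2) by blast+
    have "u \<notin> ?S" using St_iff[of "cls u p"] k u uV p by (auto simp: trace_def)
    moreover have "far_side x s (cls k h) \<longleftrightarrow> far x s h" by (rule far_side_cls[OF x(1,2) kV KL(3) k(2)])
    ultimately show ?thesis using u k uV by auto
  qed
  obtain u1 where u1: "u1 \<in> V - ?S" "\<alpha> (cls u1 p) \<notin> ?St" "\<not> far_side x s (\<alpha> (cls u1 p))"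
    using pick[OF K(1) L(1) h(1) e1] x(3) lc_self[OF h(1)] by blast
  obtain u2 where u2: "u2 \<in> V - ?S" "far_side x s (\<alpha> (cls u2 p))"
    using pick[OF K(2) L(2) h(2) e2] x(4) lc_self[OF h(2)] by blast
  have "(u1, u2) \<in> joined ?S" using cond[OF q0(1)] u1 u2 unfolding conn_def by blast
  \<comment> \<open>Outside the star adjacent vertices have images on the same side, so the path
    carries the side of \<open>u1\<close> to \<open>u2\<close>.\<close>
  then have "\<not> far_side x s (\<alpha> (cls u2 p)) \<and> u2 \<in> V - ?S"
    unfolding joined_def
  proof (induction rule: rtrancl_induct)
    case (step b c)
    then have bc: "b \<in> V" "c \<in> V" "adj b c" "b \<notin> ?S" "c \<notin> ?S" using adj_V by auto
    have PVbc: "cls b p \<in> PV" "cls c p \<in> PV" using bc p by auto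
    have "padj (cls b p) (cls c p)" using padj_iff[OF bc(1) p bc(2) p] bc(3) lc_self[OF p] by blast
    then have "padj (\<alpha> (cls b p)) (\<alpha> (cls c p))" using padj_image[OF PVbc] by simp
    moreover have "\<alpha> (cls b p) \<notin> ?St" "\<alpha> (cls c p) \<notin> ?St"
      using St_iff PVbc bc by (auto simp: trace_def)
    ultimately have "far_side x s (\<alpha> (cls b p)) \<longleftrightarrow> far_side x s (\<alpha> (cls c p))"
      using PVbc by (intro far_side_padj[OF x(1,2)]) auto
    then show ?case using step.IH bc by simp
  qed (use u1 in simp)
  then show False using u2 by blast
qed

lemma visible_if:
  assumes cond: "\<And>p q. p \<in> C \<Longrightarrow> q \<in> PV \<Longrightarrow> conn (trace p (verts (St P q)))"
  shows "visible \<Gamma> \<Gamma> \<alpha>"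
  unfolding visible_target
proof (rule ballI)
  fix p assume p: "p \<in> C"
  define ok where "ok K k L \<longleftrightarrow> k \<in> C \<and> mcl L \<and>
    \<alpha> ` (\<lambda>v. cls v p) ` K = (\<lambda>v. cls v k) ` L \<and> target (flat p K) = flat k L" for K k L
  have "\<exists>k L. ok K k L" if "mcl K" for K
    by (rule image_flat[OF p that]) (auto simp: ok_def)
  then obtain k L where ok: "\<And>K. mcl K \<Longrightarrow> ok K (k K) (L K)" by metis
  then have kL: "k K \<in> C" "mcl (L K)" "\<alpha> ` (\<lambda>v. cls v p) ` K = (\<lambda>v. cls v (k K)) ` L K"
    "target (flat p K) = flat (k K) (L K)" if K: "mcl K" for K
    using ok[OF K] unfolding ok_def by simp_all
  \<comment> \<open>Maximal flats through \<open>p\<close> correspond to maximal cliques. There are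
    finitely many of these, as the Helly property requires.\<close>
  have "Collect mcl \<subseteq> Pow V" using mclD cliqueD(1) by blast
  then have "finite (Collect mcl)" using finite_V finite_subset by blast
  then have "\<exists>x\<in>C. \<forall>K\<in>Collect mcl. x \<in> lc (k K) (L K)"
  proof (rule lc_helly)
    show "lc (k K) (L K) \<inter> lc (k K') (L K') \<noteq> {}" if KK: "K \<in> Collect mcl" "K' \<in> Collect mcl" for K K'
    proof -
      have K: "mcl K" "mcl K'" using KK by auto
      show ?thesis
        by (rule images_meet[OF cond[OF p] p K kL(2)[OF K(1)] kL(2)[OF K(2)] kL(1)[OF K(1)] kL(1)[OF K(2)]
            kL(3)[OF K(1)] kL(3)[OF K(2)]])
    qed
  qed (use kL(1) in simp)
  then obtain x where x: "x \<in> C" "\<And>K. mcl K \<Longrightarrow> x \<in> lc (k K) (L K)" by blast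
  have "vertex x \<in> target F" if F: "F \<in> maximal_standard_flats \<Gamma>" "vertex p \<in> F" for F
  proof -
    obtain g K where g: "g \<in> C" "mcl K" "F = flat g K" using F(1) unfolding maximal_flats_iff by blast
    then have "p \<in> lc g K" using F(2) mem_flat_vertex[OF g(1) mclD[OF g(2)]] by simp
    then have "flat p K = F" using flat_eq[OF g(1) mclD[OF g(2)], of p] g(3) by simp
    then show ?thesis
      using kL(4)[OF g(2)] x(2)[OF g(2)] mem_flat_vertex[OF kL(1)[OF g(2)] mclD[OF kL(2)[OF g(2)]]] by simp
  qed
  then show "\<exists>x. \<forall>F. F \<in> maximal_standard_flats \<Gamma> \<longrightarrow> vertex p \<in> F \<longrightarrow> x \<in> target F" by blast
qed

text \<open>A maximal flat through the identity containing a geodesic labelled \<open>a\<close> is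
  sent into the star coset of the image class, and likewise for \<open>b\<close>. A common point of
  the targets would therefore lie over both cosets.\<close>

lemma not_visible_if:
  assumes a: "a \<in> V" and b: "b \<in> V" and g: "g \<in> C" and h: "h \<in> C"
    and \<alpha>: "\<alpha> (cls a one_elt) = cls a g" "\<alpha> (cls b one_elt) = cls b h"
    and dis: "lc g (star a) \<inter> lc h (star b) = {}"
  shows "\<not> visible \<Gamma> \<Gamma> \<alpha>"
proof
  assume vis: "visible \<Gamma> \<Gamma> \<alpha>"
  obtain x where x: "\<And>F. F \<in> maximal_standard_flats \<Gamma> \<Longrightarrow> vertex one_elt \<in> F \<Longrightarrow> x \<in> target F"
    using vis G.one_closed unfolding visible_target by blast
  have *: "fst x \<in> lc g (star a)" if a: "a \<in> V" and g: "g \<in> C" and e: "\<alpha> (cls a one_elt) = cls a g" for a g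
  proof -
    obtain K where K: "mcl K" "{a} \<subseteq> K" using mcl_ex[OF clique_sing[OF a]] .
    obtain k L where k: "k \<in> C" "mcl L" "\<alpha> ` (\<lambda>v. cls v one_elt) ` K = (\<lambda>v. cls v k) ` L" "target (flat one_elt K) = flat k L"
      using image_flat[OF G.one_closed K(1)] .
    have LV: "L \<subseteq> V" by (rule cliqueD(1)[OF mclD[OF k(2)]])
    have "flat one_elt K \<in> maximal_standard_flats \<Gamma>" unfolding maximal_flats_iff using K by blast
    moreover have "vertex one_elt \<in> flat one_elt K" using mem_flat_vertex[OF G.one_closed mclD[OF K(1)]] by simp
    ultimately have "x \<in> flat k L" using x[of "flat one_elt K"] k(4) by simp
    then have "fst x \<in> lc k L" by (rule flat_fst[OF k(1) mclD[OF k(2)]])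
    moreover have "cls a g \<in> (\<lambda>v. cls v k) ` L" using k(3) K(2) e by (metis (no_types, lifting) image_eqI insert_subset)
    then obtain v where v: "v \<in> L" "cls a g = cls v k" by blast
    then have "a = v" "k \<in> lc g (star a)" using cls_eq_iff[OF a g _ k(1), of v] LV by auto
    ultimately show ?thesis
      using lc_mono[OF clique_star[OF mclD[OF k(2)] v(1)], of k] lc_eq[OF g] by blast
  qed
  show False using *[OF a g \<alpha>(1)] *[OF b h \<alpha>(2)] dis by blast
qed

end

context raag_graph
begin

text \<open>Translation by \<open>k\<close> carries the edges dual to one wall to those dual to the
  other, so both predicates change along corresponding edges, starting from false at
  \<open>p\<close>.\<close>

lemma far_mult_left:
  assumes k: "k \<in> C" and p: "p \<in> C" and s: "fst s \<in> V" and y: "y \<in> C"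
  shows "far (k \<cdot> p) s (k \<cdot> y) \<longleftrightarrow> far p s y"
proof -
  have "p \<in> lc p V" "y \<in> lc p V" using lc_V p y by auto
  from p this show ?thesis
  proof (induction rule: coset_induct)
    case base
    then show ?case using far_self(1) p k s by simp
  next
    case (step y t)
    have y: "y \<in> C" using step.hyps(1) lc_V p by simp
    have kp: "k \<cdot> p \<in> C" "k \<cdot> y \<in> C" and t: "fst t \<in> V" "y \<cdot> cl [t] \<in> C" using k p y step.hyps(2) by auto
    have e: "k \<cdot> y \<cdot> cl [t] = k \<cdot> (y \<cdot> cl [t])" using k y t(1) by (simp add: G.m_assoc)
    have "far (k \<cdot> p) s (k \<cdot> y) \<noteq> far (k \<cdot> p) s (k \<cdot> (y \<cdot> cl [t])) \<longleftrightarrow> far p s y \<noteq> far p s (y \<cdot> cl [t])"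
      using far_step_iff[OF kp(1) s kp(2) t(1)] far_step_iff[OF p s y t(1)]
        lc_mult_left[OF k p y] lc_mult_left[OF k p t(2)] unfolding e by simp
    then show ?case using step.IH by blast
  qed
qed

subsection \<open>Translations of the extension complex\<close>

text \<open>Left translation on the vertices of the extension complex, given on representatives
  instead of on points of geodesics; \<open>act_cls\<close> shows independence of the
  representative.\<close>

definition act :: "'v word set \<Rightarrow> 'v point set set \<Rightarrow> 'v point set set" where
  "act k q = (SOME r. \<exists>v\<in>V. \<exists>g\<in>C. q = cls v g \<and> r = cls v (k \<cdot> g))"

lemma act_cls: assumes k: "k \<in> C" and v: "v \<in> V" and g: "g \<in> C" shows "act k (cls v g) = cls v (k \<cdot> g)"
proof -
  have "\<exists>r. \<exists>w\<in>V. \<exists>h\<in>C. cls v g = cls w h \<and> r = cls w (k \<cdot> h)" using v g by blast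
  from someI_ex[OF this] obtain w h where w: "w \<in> V" "h \<in> C" "cls v g = cls w h" "act k (cls v g) = cls w (k \<cdot> h)"
    unfolding act_def by blast
  then have "v = w" "h \<in> lc g (star v)" using cls_eq_iff[OF v g] by auto
  then have "cls v (k \<cdot> g) = cls w (k \<cdot> h)"
    using cls_eq_iff[OF v _ w(1), of "k \<cdot> g" "k \<cdot> h"] lc_mult_left[OF k g w(2)] k g w by simp
  then show ?thesis using w by simp
qed

lemma act_PV [simp]: "k \<in> C \<Longrightarrow> q \<in> PV \<Longrightarrow> act k q \<in> PV"
  by (erule clsE) (simp add: act_cls)

lemma act_one [simp]: "q \<in> PV \<Longrightarrow> act one_elt q = q"
  by (erule clsE) (simp add: act_cls)

lemma act_mult: "k \<in> C \<Longrightarrow> l \<in> C \<Longrightarrow> q \<in> PV \<Longrightarrow> act k (act l q) = act (k \<cdot> l) q"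
  by (erule clsE) (simp add: act_cls G.m_assoc)

lemma act_inv [simp]:
  "k \<in> C \<Longrightarrow> q \<in> PV \<Longrightarrow> act k (act (inver k) q) = q"
  "k \<in> C \<Longrightarrow> q \<in> PV \<Longrightarrow> act (inver k) (act k q) = q"
  by (simp_all add: act_mult)

lemma act_padj: assumes k: "k \<in> C" and q: "q \<in> PV" and r: "r \<in> PV" and a: "padj q r"
  shows "padj (act k q) (act k r)"
proof -
  obtain u g where u: "u \<in> V" "g \<in> C" "q = cls u g" using q clsE by metis
  obtain w h where w: "w \<in> V" "h \<in> C" "r = cls w h" using r clsE by metis
  obtain z where z: "adj u w" "z \<in> lc g (star u)" "z \<in> lc h (star w)" using a u w padj_iff by blast
  have "z \<in> C" by (rule lc_in[OF u(2) z(2)])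
  then have "k \<cdot> z \<in> lc (k \<cdot> g) (star u)" "k \<cdot> z \<in> lc (k \<cdot> h) (star w)"
    using z lc_mult_left[OF k] u w by blast+
  then have "padj (cls u (k \<cdot> g)) (cls w (k \<cdot> h))"
    using padj_iff[of u "k \<cdot> g" w "k \<cdot> h"] z(1) k u w by auto
  then show ?thesis using act_cls k u w by simp
qed

text \<open>In a flag complex the edges determine the simplices, so a bijection preserving edges
  both ways is a simplicial isomorphism.\<close>

lemma automorphismI:
  assumes map: "\<And>q. q \<in> PV \<Longrightarrow> \<alpha> q \<in> PV" "\<And>q. q \<in> PV \<Longrightarrow> \<beta> q \<in> PV"
    and inv: "\<And>q. q \<in> PV \<Longrightarrow> \<beta> (\<alpha> q) = q" "\<And>q. q \<in> PV \<Longrightarrow> \<alpha> (\<beta> q) = q"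
    and adj: "\<And>q r. q \<in> PV \<Longrightarrow> r \<in> PV \<Longrightarrow> padj q r \<Longrightarrow> padj (\<alpha> q) (\<alpha> r)"
      "\<And>q r. q \<in> PV \<Longrightarrow> r \<in> PV \<Longrightarrow> padj q r \<Longrightarrow> padj (\<beta> q) (\<beta> r)"
  shows "automorphism \<Gamma> \<alpha>"
proof -
  have bij: "bij_betw \<alpha> PV PV" by (rule bij_betwI[of _ _ _ \<beta>]) (use map inv in auto)
  have "s \<in> P \<longleftrightarrow> \<alpha> ` s \<in> P" if s: "s \<subseteq> PV" for s
  proof -
    have "inj_on \<alpha> s" using bij s by (meson bij_betw_def inj_on_subset)
    then have "finite (\<alpha> ` s) \<longleftrightarrow> finite s" by (rule finite_image_iff)
    moreover have "pairwise padj (\<alpha> ` s) \<longleftrightarrow> pairwise padj s"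
    proof
      assume a: "pairwise padj (\<alpha> ` s)"
      show "pairwise padj s"
      proof (rule pairwiseI)
        fix q r assume qr: "q \<in> s" "r \<in> s" "q \<noteq> r"
        then have PVqr: "q \<in> PV" "r \<in> PV" using s by auto
        then have "\<alpha> q \<noteq> \<alpha> r" using inv(1) qr(3) by metis
        then have "padj (\<alpha> q) (\<alpha> r)" using a qr by (auto simp: pairwise_def)
        then show "padj q r" using adj(2)[of "\<alpha> q" "\<alpha> r"] PVqr map inv by simp
      qed
    next
      assume a: "pairwise padj s"
      have "padj (\<alpha> q) (\<alpha> r)" if "q \<in> s" "r \<in> s" "\<alpha> q \<noteq> \<alpha> r" for q r
      proof -
        have "q \<noteq> r" using that(3) by blast
        then show ?thesis using adj(1)[of q r] pairwiseD[OF a that(1,2)] s that by blast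
      qed
      then show "pairwise padj (\<alpha> ` s)" unfolding pairwise_def by blast
    qed
    moreover have "\<alpha> ` s \<subseteq> PV" using map s by blast
    ultimately show ?thesis using s by (auto simp: P_simplex_iff)
  qed
  then have "simplicial_iso P P \<alpha>" using bij by (simp add: simplicial_iso_def)
  then show ?thesis by (simp add: automorphism_def automorphism_axioms_def raag_graph_axioms)
qed

end

text \<open>
  The hyperplanes dual to edges that leave the subgroup of \<open>A\<close> along a label in \<open>D\<close>. The condition on
  links makes them cut the extension complex along vertices labelled in \<open>A\<close>.
\<close>

locale wall_family = raag_graph \<Gamma> for \<Gamma> :: "'v set set" +
  fixes A D :: "'v set"
  assumes AV: "A \<subseteq> V" and DV: "D \<subseteq> V" and AD: "A \<inter> D = {}" and nbrD: "\<And>d. d \<in> D \<Longrightarrow> nbr d \<subseteq> A \<union> D"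
begin

text \<open>The intersection of the half-spaces that contain \<open>par A\<close> and are bounded by
  these hyperplanes; the letter \<open>d\<close> may carry either sign.\<close>

definition near :: "'v word set set" where
  "near = {x \<in> C. \<forall>y\<in>par A. \<forall>d. fst d \<in> D \<longrightarrow> \<not> far y d x}"

lemma nearD: "x \<in> near \<Longrightarrow> y \<in> par A \<Longrightarrow> fst d \<in> D \<Longrightarrow> \<not> far y d x"
  unfolding near_def by blast

lemma nearI: "x \<in> C \<Longrightarrow> (\<And>y d. y \<in> par A \<Longrightarrow> fst d \<in> D \<Longrightarrow> \<not> far y d x) \<Longrightarrow> x \<in> near"
  unfolding near_def by blast

definition near_class :: "'v point set set \<Rightarrow> bool" where
  "near_class q \<longleftrightarrow> (\<exists>v\<in>V. \<exists>g\<in>C. q = cls v g \<and> lc g (star v) \<subseteq> near)"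

lemma near_class_cls: assumes "v \<in> V" "g \<in> C" shows "near_class (cls v g) \<longleftrightarrow> lc g (star v) \<subseteq> near"
proof
  assume "near_class (cls v g)"
  then obtain w h where w: "w \<in> V" "h \<in> C" "cls v g = cls w h" "lc h (star w) \<subseteq> near"
    unfolding near_class_def by blast
  then have "v = w" "h \<in> lc g (star v)" using cls_eq_iff[OF assms w(1,2)] by blast+
  then show "lc g (star v) \<subseteq> near" using lc_eq[OF assms(2), of h "star v"] w(4) by simp
qed (use assms in \<open>auto simp: near_class_def\<close>)

text \<open>In a geodesic word for \<open>m\<close>, the first letter labelled in \<open>D\<close>
  would start at a point of \<open>par A\<close> and cross a bounding hyperplane for good.\<close>

lemma near_par:
  assumes y: "y \<in> par A" and m: "m \<in> par (A \<union> D)" and n: "y \<cdot> m \<in> near"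
  shows "y \<cdot> m \<in> par A"
proof -
  obtain u where u: "geo u" "cl u = m" using geo_ex par_in[OF m] by blast
  have lab: "fst ` set u \<subseteq> A \<union> D" using par_geo_labels u m by blast
  have "fst ` set u \<subseteq> A"
  proof (rule ccontr)
    assume "\<not> ?thesis"
    then have "\<exists>s\<in>set u. fst s \<in> D" using lab by blast
    then obtain u1 s u2 where s: "u = u1 @ s # u2" "fst s \<in> D" "\<forall>t\<in>set u1. fst t \<notin> D"
      using split_list_first_prop[of u "\<lambda>s. fst s \<in> D"] by blast
    have w: "u1 \<in> words \<Gamma>" "fst s \<in> V" "u2 \<in> words \<Gamma>" using geo_words[OF u(1)] s by auto
    have u1: "cl u1 \<in> par A" by (rule parI[OF w(1)]) (use lab s in auto)
    have "geo (s # u2)" using geo_append(2)[of u1 "s # u2"] u s by simp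
    then have "far (y \<cdot> cl u1) s (y \<cdot> cl u1 \<cdot> cl (s # u2))"
      using par_in[OF y] w by (intro geo_far_end) (auto simp: cl_in)
    moreover have "y \<cdot> cl u1 \<cdot> cl (s # u2) = y \<cdot> m"
      using u(2) s w par_in[OF y] cl_append[of u1 "s # u2"] by (simp add: G.m_assoc cl_in)
    ultimately show False using nearD[OF n par_mult[OF y u1] s(2)] by simp
  qed
  then have "m \<in> par A" using parI[OF geo_words[OF u(1)]] u(2) by blast
  then show ?thesis by (rule par_mult[OF y])
qed

text \<open>Suppose the coset of \<open>r\<close> leaves \<open>near\<close>. It does so from a
  point of \<open>par A\<close> along an edge labelled in \<open>D\<close>, so \<open>r\<close> is
  in \<open>M\<close> unless its own label is in \<open>D\<close>. In that case the common point of
  the two cosets is in \<open>par A\<close> as well, and \<open>q\<close> is in \<open>M\<close> or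
  has itself an edge that leaves \<open>near\<close>.\<close>

lemma near_class_closed:
  assumes M: "\<And>a x d. a \<in> A \<Longrightarrow> x \<in> par A \<Longrightarrow> d \<in> D \<Longrightarrow> adj a d \<Longrightarrow> cls a x \<in> M"
    and q: "q \<in> PV" "q \<notin> M" "near_class q" and r: "r \<in> PV" "r \<notin> M" and qr: "padj q r"
  shows "near_class r"
proof -
  obtain u g where u: "u \<in> V" "g \<in> C" "q = cls u g" using q(1) clsE by metis
  obtain w h where w: "w \<in> V" "h \<in> C" "r = cls w h" using r(1) clsE by metis
  obtain y where y: "adj u w" "y \<in> lc g (star u)" "y \<in> lc h (star w)" using qr u w padj_iff by blast
  have yC: "y \<in> C" by (rule lc_in[OF u(2) y(2)])
  have qn: "lc g (star u) \<subseteq> near" using q(3) near_class_cls u by simp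
  have z: "z \<in> near" if "z \<in> lc h (star w)" for z
    using w(2) y(3) that
  proof (induction rule: coset_induct)
    case base
    then show ?case using qn y(2) by blast
  next
    case (step x t)
    have xC: "x \<in> C" by (rule lc_in[OF w(2) step.hyps(1)])
    show ?case
    proof (rule ccontr)
      assume "x \<cdot> cl [t] \<notin> near"
      then obtain y1 d where d: "y1 \<in> par A" "fst d \<in> D" "far y1 d (x \<cdot> cl [t])"
        using nearI[of "x \<cdot> cl [t]"] xC step.hyps(2) by auto
      have y1: "y1 \<in> C" and dV: "fst d \<in> V" using d par_in DV by blast+
      have "\<not> far y1 d x" by (rule nearD[OF step.IH d(1,2)])
      then have t: "t = d" "x \<in> lc y1 (nbr (fst d))" using far_step[OF y1 dV xC step.hyps(2)] d(3) by auto
      then obtain m where m: "m \<in> par (nbr (fst d))" "x = y1 \<cdot> m" by (auto simp: lc_def)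
      have xA: "x \<in> par A"
        using near_par[OF d(1), of m] m step.IH par_mono[OF nbrD[OF d(2)]] by blast
      have "w = fst d \<or> adj w (fst d)" using step.hyps(3) t(1) adj_sym by (auto simp: star_def nbr_def)
      have rx: "r = cls w x" using cls_eq_iff[OF w(1,2,1) xC] w step.hyps(1) by simp
      have "w \<in> D"
      proof (rule ccontr)
        assume nD: "w \<notin> D"
        then have wd: "adj w (fst d)" using \<open>w = fst d \<or> _\<close> d(2) by blast
        then have "w \<in> A" using nbrD[OF d(2)] adj_sym nD by (auto simp: nbr_def)
        then show False using M[OF _ xA d(2) wd] rx r(2) by simp
      qed
      have "y \<in> lc x (star w)" using lc_trans[OF xC lc_sym[OF w(2) step.hyps(1)]] y(3) by blast
      then obtain m' where m': "m' \<in> par (star w)" "y = x \<cdot> m'" by (auto simp: lc_def)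
      have "star w \<subseteq> A \<union> D" using nbrD \<open>w \<in> D\<close> by (auto simp: star_def)
      then have yA: "y \<in> par A"
        using near_par[OF xA, of m'] m' qn y(2) par_mono by blast
      have qy: "q = cls u y" using cls_eq_iff[OF u(1,2,1) yC] u y by simp
      have "u \<in> A \<union> D" using nbrD[OF \<open>w \<in> D\<close>] y(1) adj_sym by (auto simp: nbr_def)
      then show False
      proof
        assume "u \<in> A"
        then show False using M[OF _ yA \<open>w \<in> D\<close> y(1)] qy q(2) by simp
      next
        assume uD: "u \<in> D"
        have "y \<cdot> cl [(u, True)] \<in> near"
          using lc_step[OF u(2) y(2), of "(u, True)"] u(1) qn by (auto simp: star_def)
        then show False using far_self(2)[OF yC, of "(u, True)"] u(1) yA uD by (auto simp: near_def)
      qed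
    qed
  qed
  then show ?thesis using near_class_cls w by blast
qed

text \<open>Neither the star coset of \<open>a\<close> nor \<open>par A\<close> has an edge labelled
  in \<open>D\<close>, so no bounding hyperplane separates their points from the identity.\<close>

lemma near_class_base: assumes a: "a \<in> V" "star a \<inter> D = {}" shows "near_class (cls a one_elt)"
proof -
  have "x \<in> near" if x: "x \<in> lc one_elt (star a)" for x
  proof -
    have "\<not> far y d x" if y: "y \<in> par A" "fst d \<in> D" for y d
    proof -
      have yC: "y \<in> C" and dV: "fst d \<in> V" using y par_in DV by blast+
      have "far y d x = far y d one_elt"
        by (rule far_const[OF yC dV G.one_closed x]) (use y a in auto)
      also have "\<dots> = far y d y"
        by (rule far_const[OF yC dV G.one_closed, where A = A])
          (use y AD lcI[OF y(1), of one_elt] yC in auto)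
      finally show ?thesis using far_self(1)[OF yC dV] by simp
    qed
    then show ?thesis using lc_in[OF G.one_closed x] by (intro nearI) auto
  qed
  then show ?thesis using near_class_cls[OF a(1) G.one_closed] by blast
qed

lemma not_near_class: assumes "d \<in> D" shows "\<not> near_class (cls d one_elt)"
proof
  have d: "d \<in> V" using assms DV by blast
  assume "near_class (cls d one_elt)"
  moreover have "one_elt \<cdot> cl [(d, True)] \<in> lc one_elt (star d)"
    by (rule lc_step) (use d in \<open>auto simp: star_def\<close>)
  ultimately have "cl [(d, True)] \<in> near" using near_class_cls[OF d G.one_closed] d by auto
  then show False using far_self(2)[OF G.one_closed, of "(d, True)"] d assms by (auto simp: near_def)
qed

text \<open>Left multiplication by an element of \<open>par A\<close> permutes the bounding
  hyperplanes.\<close>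

lemma near_translate: assumes k: "k \<in> par A" and x: "x \<in> C" shows "k \<cdot> x \<in> near \<longleftrightarrow> x \<in> near"
proof -
  have *: "k \<cdot> x \<in> near" if k: "k \<in> par A" and x: "x \<in> near" for k x
  proof -
    have kC: "k \<in> C" and xC: "x \<in> C" using k x par_in by (auto simp: near_def)
    have "\<not> far y d (k \<cdot> x)" if y: "y \<in> par A" "fst d \<in> D" for y d
    proof -
      have yC: "y \<in> C" and dV: "fst d \<in> V" using y par_in DV by blast+
      have "far y d (k \<cdot> x) \<longleftrightarrow> far (inver k \<cdot> y) d x"
        using far_mult_left[OF kC _ dV xC, of "inver k \<cdot> y"] kC yC by (simp add: inv_cancel)
      then show ?thesis using nearD[OF x par_mult[OF par_inv[OF k] y(1)] y(2)] by simp
    qed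
    then show ?thesis using kC xC by (intro nearI) auto
  qed
  show ?thesis using *[OF k] *[OF par_inv[OF k], of "k \<cdot> x"] par_in[OF k] x by (auto simp: inv_cancel)
qed

lemma near_class_translate_imp:
  assumes k: "k \<in> par A" and q: "q \<in> PV" "near_class q" shows "near_class (act k q)"
proof -
  have kC: "k \<in> C" by (rule par_in[OF k])
  obtain u g where u: "u \<in> V" "g \<in> C" "q = cls u g" using q clsE by metis
  have "x \<in> near" if x: "x \<in> lc (k \<cdot> g) (star u)" for x
  proof -
    have xC: "x \<in> C" using lc_in[OF _ x] kC u by simp
    have "inver k \<cdot> x \<in> lc g (star u)"
      using lc_mult_left[OF kC u(2), of "inver k \<cdot> x" "star u"] x kC xC by (simp add: inv_cancel)
    then have "inver k \<cdot> x \<in> near" using q(2) u near_class_cls by blast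
    then show ?thesis using near_translate[OF k, of "inver k \<cdot> x"] kC xC by (simp add: inv_cancel)
  qed
  then show ?thesis using near_class_cls[of u "k \<cdot> g"] act_cls[OF kC u(1,2)] u kC by auto
qed

lemma near_class_translate: "k \<in> par A \<Longrightarrow> q \<in> PV \<Longrightarrow> near_class (act k q) \<longleftrightarrow> near_class q"
  using near_class_translate_imp[of k q] near_class_translate_imp[of "inver k" "act k q"] par_inv[of k A] par_in[of k A]
  by auto

end

section \<open>Construction of automorphisms that are not visible\<close>

context raag_graph
begin

lemma gen_commute_star:
  assumes v: "v \<in> V" and z: "z \<in> par (star v)" shows "gpow v j \<cdot> z = z \<cdot> gpow v j"
proof -
  obtain m k where m: "m \<in> par (nbr v)" "z = m \<cdot> gpow v k"
    using par_insert_decomp[OF v, of "nbr v" z] z by (auto simp: star_def)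
  have mC: "m \<in> C" by (rule par_in[OF m(1)])
  have c: "gpow v j \<cdot> m = m \<cdot> gpow v j"
    by (rule par_commute[of _ "{v}" _ "nbr v"]) (use m v in \<open>auto simp: nbr_def intro: gpow_par\<close>)
  have "gpow v j \<cdot> z = m \<cdot> (gpow v j \<cdot> gpow v k)"
    using c m mC v by (simp flip: G.m_assoc)
  also have "\<dots> = z \<cdot> gpow v j"
    using m mC v by (simp add: G.m_assoc add.commute flip: gpow_add)
  finally show ?thesis .
qed

lemma St_P_central:
  assumes v: "v \<in> V" and r: "r \<in> verts (St P (cls v one_elt))"
  obtains u z where "u \<in> V" "z \<in> par (star v)" "r = cls u z" "v \<in> star u"
proof -
  have rPV: "r \<in> PV" using r v verts_St_P[of "cls v one_elt"] by simp
  obtain u g where u: "u \<in> V" "g \<in> C" "r = cls u g" using rPV clsE by metis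
  have "u = v \<and> g \<in> lc one_elt (star v) \<or> adj v u \<and> lc one_elt (star v) \<inter> lc g (star u) \<noteq> {}"
    using r cls_in_St[OF v G.one_closed u(1,2)] u by simp
  then obtain z where z: "z \<in> lc one_elt (star v)" "z \<in> lc g (star u)" "v \<in> star u"
    using lc_self[OF u(2)] adj_sym by (auto simp: star_def nbr_def)
  have zC: "z \<in> C" by (rule lc_in[OF u(2) z(2)])
  have "r = cls u z" using cls_eq_iff[OF u(1,2,1) zC] z u by simp
  moreover have "z \<in> par (star v)" using z(1) lc_iff[OF G.one_closed zC] zC by simp
  ultimately show ?thesis using that u z by blast
qed

text \<open>\<open>gpow v j\<close> is central in the star group of \<open>v\<close> and belongs to
  the star group of \<open>u\<close>, so it moves the representative within its own coset.\<close>

lemma St_P_fixed: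
  assumes v: "v \<in> V" and r: "r \<in> verts (St P (cls v one_elt))" shows "act (gpow v j) r = r"
proof -
  obtain u z where u: "u \<in> V" "z \<in> par (star v)" "r = cls u z" "v \<in> star u" using St_P_central[OF assms] .
  have zC: "z \<in> C" by (rule par_in[OF u(2)])
  have "act (gpow v j) r = cls u (z \<cdot> gpow v j)"
    using act_cls[OF gpow_in[OF v] u(1) zC] gen_commute_star[OF v u(2)] u by simp
  also have "\<dots> = cls u z"
    using cls_eq_iff[OF u(1) zC u(1), of "z \<cdot> gpow v j"] lcI[OF gpow_par[OF v u(4)], of z] zC v by simp
  finally show ?thesis using u by simp
qed

text \<open>
  Translation along \<open>v\<close> fixes the star of the class of \<open>v\<close> pointwise. It is applied on one side of
  that star only.
\<close>

lemma separating_star_not_visible: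
  assumes v: "v \<in> V" and nc: "\<not> conn (star v)"
  shows "\<exists>\<alpha>. simplicial_iso P P \<alpha> \<and> \<not> visible \<Gamma> \<Gamma> \<alpha>"
proof -
  obtain a b where ab: "a \<in> V" "a \<notin> star v" "b \<in> V" "b \<notin> star v" "(a, b) \<notin> joined (star v)"
    using nc by (auto simp: conn_def)
  \<comment> \<open>The component of \<open>b\<close> outside the star; the class of
    \<open>a\<close> will belong to the piece that is moved.\<close>
  define D where "D = {d \<in> V. d \<notin> star v \<and> (b, d) \<in> joined (star v)}"
  have bD: "b \<in> D" using ab joined_refl by (simp add: D_def)
  interpret wall_family \<Gamma> "star v" D
  proof unfold_locales
    fix d assume d: "d \<in> D"
    show "nbr d \<subseteq> star v \<union> D"
    proof
      fix e assume "e \<in> nbr d"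
      then have e: "adj d e" "e \<in> V" using adj_V by (auto simp: nbr_def)
      then show "e \<in> star v \<union> D"
        using d joined_edge[of d e "star v"] joined_trans by (auto simp: D_def)
    qed
  qed (use star_V[OF v] in \<open>auto simp: D_def\<close>)
  let ?M = "verts (St P (cls v one_elt))"
  let ?g = "gpow v 1"
  let ?k = "gpow v (-1)"
  have g: "?g \<in> C" "?k \<in> C" using v by auto
  have gA: "gpow v j \<in> par (star v)" for j by (rule gpow_par) (use v in \<open>auto simp: star_def\<close>)
  have gk: "?g \<cdot> ?k = one_elt" "?k \<cdot> ?g = one_elt" using gpow_add[OF v, of 1 "-1"] gpow_add[OF v, of "-1" 1] by auto
  have MPV: "?M \<subseteq> PV" using verts_St_P[of "cls v one_elt"] v by auto
  have HM: "cls e x \<in> ?M" if "e \<in> star v" "x \<in> par (star v)" for e x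
  proof -
    have e: "e \<in> V" using star_V[OF v] that by blast
    have xC: "x \<in> C" by (rule par_in[OF that(2)])
    have "x \<in> lc one_elt (star v)" using lcI[OF that(2), of one_elt] xC by simp
    then show ?thesis using cls_in_St[OF v G.one_closed e xC] that(1) lc_self[OF xC] by (auto simp: star_def nbr_def)
  qed
  have fixed: "act (gpow v j) r = r" if "r \<in> ?M" for j r by (rule St_P_fixed[OF v that])
  have notM: "act (gpow v j) q \<notin> ?M" if "q \<in> PV" "q \<notin> ?M" for j q
  proof
    assume "act (gpow v j) q \<in> ?M"
    from fixed[OF this, of "-j"] have "act (gpow v (-j)) (act (gpow v j) q) \<in> ?M" using \<open>act (gpow v j) q \<in> ?M\<close> by simp
    moreover have "gpow v (-j) \<cdot> gpow v j = one_elt" using gpow_add[OF v, of "-j" j] by simp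
    ultimately show False using act_mult[of "gpow v (-j)" "gpow v j" q] that v by simp
  qed
  define Q where "Q = {q \<in> PV. q \<notin> ?M \<and> near_class q}"
  have Qact: "act (gpow v j) q \<in> Q" if "q \<in> Q" for j q
    using that notM near_class_translate[OF gA] v by (auto simp: Q_def)
  \<comment> \<open>The exponent stays variable so that \<open>f (-1)\<close> serves as the inverse
    of \<open>f 1\<close>.\<close>
  define f where "f j q = (if q \<in> Q then act (gpow v j) q else q)" for j q
  have fPV: "f j q \<in> PV" if "q \<in> PV" for j q using that v by (simp add: f_def)
  have ff: "f j (f i q) = q" if "q \<in> PV" "i + j = 0" for i j q
  proof (cases "q \<in> Q")
    case True
    have "gpow v j \<cdot> gpow v i = one_elt" using gpow_add[OF v, of j i] that(2) by (simp add: add.commute)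
    then show ?thesis using True Qact that v by (simp add: f_def act_mult)
  qed (simp add: f_def)
  have fadj1: "padj (f j q) (f j r)" if qr: "q \<in> PV" "r \<in> PV" "padj q r" "q \<in> Q" for j q r
  proof -
    \<comment> \<open>An edge that leaves \<open>Q\<close> ends in the star, where the translation
      is the identity. So \<open>f\<close> agrees with the translation at both ends.\<close>
    have "r \<in> Q \<or> r \<in> ?M" using near_class_closed[OF HM, of q r] qr by (auto simp: Q_def)
    then have "f j r = act (gpow v j) r" using fixed by (auto simp: f_def Q_def)
    then show ?thesis using act_padj[OF gpow_in[OF v] qr(1,2,3)] qr(4) by (simp add: f_def)
  qed
  have fadj: "padj (f j q) (f j r)" if qr: "q \<in> PV" "r \<in> PV" "padj q r" for j q r
  proof -
    consider "q \<in> Q" | "r \<in> Q" | "q \<notin> Q" "r \<notin> Q" by blast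
    then show ?thesis
    proof cases
      case 2
      have "padj (f j r) (f j q)" using fadj1[OF qr(2,1) padj_sym[OF qr] 2] .
      then show ?thesis using padj_sym[OF fPV[OF qr(2)] fPV[OF qr(1)]] by blast
    qed (use fadj1 qr in \<open>auto simp: f_def\<close>)
  qed
  interpret automorphism \<Gamma> "f 1"
    by (rule automorphismI[of _ "f (-1)"]) (use fPV ff fadj in auto)
  have "cls u one_elt \<notin> ?M" if "u \<in> V" "u \<notin> star v" for u
    using cls_in_St[OF v G.one_closed that(1) G.one_closed] that by (auto simp: star_def nbr_def)
  then have nM: "cls a one_elt \<notin> ?M" "cls b one_elt \<notin> ?M" using ab by auto
  have "star a \<inter> D = {}"
  proof (rule ccontr)
    assume "star a \<inter> D \<noteq> {}"
    then obtain d where d: "d \<in> D" "d = a \<or> adj d a" using adj_sym by (auto simp: star_def nbr_def)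
    then have "(d, a) \<in> joined (star v)" using joined_refl joined_edge[of d a] ab by (auto simp: D_def)
    then have "(b, a) \<in> joined (star v)" using d joined_trans by (auto simp: D_def)
    then show False using ab joined_sym by blast
  qed
  then have aQ: "cls a one_elt \<in> Q" using near_class_base ab nM by (simp add: Q_def)
  have bQ: "cls b one_elt \<notin> Q" using not_near_class[OF bD] by (simp add: Q_def)
  have "lc ?g (star a) \<inter> lc one_elt (star b) = {}"
  proof (rule ccontr)
    assume "\<not> ?thesis"
    then obtain y z where y: "y \<in> par (star a)" "z \<in> par (star b)" "?g \<cdot> y = one_elt \<cdot> z" by (auto simp: lc_def)
    \<comment> \<open>Retracting to the generator \<open>v\<close> kills both star groups but not
      \<open>?g\<close>, so the cosets cannot meet.\<close>
    have out: "v \<notin> star a" "v \<notin> star b" using ab adj_sym by (auto simp: star_def nbr_def)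
    have "ret {v} ?g = ?g" by (rule ret_id[OF gpow_par[of v "{v}"]]) (use v in auto)
    moreover have "ret {v} y = one_elt" "ret {v} z = one_elt" using ret_one[OF y(1)] ret_one[OF y(2)] out by auto
    ultimately have "?g = one_elt"
      using ret_mult[of ?g y "{v}"] y g par_in[OF y(1)] par_in[OF y(2)] by simp
    then have "cl [(v, True)] \<in> par {}" using gpow_1[OF v] by simp
    then show False using letter_par[of "(v, True)" "{}"] v by simp
  qed
  then have "\<not> visible \<Gamma> \<Gamma> (f 1)"
    using ab g aQ bQ by (intro not_visible_if[of a b ?g one_elt]) (auto simp: f_def act_cls)
  then show ?thesis using iso by blast
qed

text \<open>
  The piece containing the class of \<open>v\<close> is exchanged with its translate by \<open>v \<cdot> w\<close>, which fixes the cut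
  pointwise. This automorphism need not come from one of the group.
\<close>

lemma separated_pair_not_visible:
  assumes v: "v \<in> V" and w: "w \<in> V" and vw: "v \<noteq> w" "\<not> adj v w"
    and sep: "(v, w) \<notin> joined (nbr v \<inter> nbr w)"
  shows "\<exists>\<alpha>. simplicial_iso P P \<alpha> \<and> \<not> visible \<Gamma> \<Gamma> \<alpha>"
proof -
  let ?L = "nbr v \<inter> nbr w"
  \<comment> \<open>\<open>v\<close> is included so that the wall of label \<open>w\<close> based at
    the generator \<open>v\<close> is a bounding hyperplane; it lies between \<open>near\<close> and
    its translate.\<close>
  define A where "A = insert v ?L"
  define D where "D = {d \<in> V. d \<notin> ?L \<and> (w, d) \<in> joined ?L}"
  have nL: "v \<notin> ?L" "w \<notin> ?L" by (auto simp: nbr_def)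
  have wD: "w \<in> D" using w nL joined_refl by (simp add: D_def)
  have vD: "v \<notin> D" using sep joined_sym by (auto simp: D_def)
  have starv: "star v \<inter> D = {}"
  proof (rule ccontr)
    assume "star v \<inter> D \<noteq> {}"
    then obtain d where d: "d \<in> D" "d = v \<or> adj d v" using adj_sym by (auto simp: star_def nbr_def)
    then have "(d, v) \<in> joined ?L" using joined_refl joined_edge[of d v ?L] nL by (auto simp: D_def)
    then have "(w, v) \<in> joined ?L" using d joined_trans by (auto simp: D_def)
    then show False using sep joined_sym by blast
  qed
  interpret wall_family \<Gamma> A D
  proof unfold_locales
    fix d assume d: "d \<in> D"
    show "nbr d \<subseteq> A \<union> D"
    proof
      fix e assume "e \<in> nbr d"
      then have e: "adj d e" "e \<in> V" using adj_V by (auto simp: nbr_def)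
      then show "e \<in> A \<union> D"
        using d joined_edge[of d e ?L] joined_trans by (auto simp: D_def A_def)
    qed
  qed (use v vD nbr_V in \<open>auto simp: A_def D_def\<close>)
  let ?V = "cl [(v, True)]" and ?W = "cl [(w, True)]"
  \<comment> \<open>Translation by \<open>v\<close> alone fixes the class of \<open>v\<close> at the
    identity; translation by \<open>w\<close> alone leaves the point \<open>w\<close> common to the
    two cosets that have to be disjoint at the end.\<close>
  let ?g = "?V \<cdot> ?W"
  have VW: "?V \<in> C" "?W \<in> C" using v w by auto
  then have g: "?g \<in> C" by simp
  have gi: "inver ?g \<in> C" using g by simp
  define M where "M = {cls l x | l x. l \<in> ?L \<and> x \<in> par ?L}"
  have LV: "?L \<subseteq> V" using nbr_V by blast
  have HM: "cls a x \<in> M" if axd: "a \<in> A" "x \<in> par A" "d \<in> D" "adj a d" for a x d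
  proof -
    have "a \<noteq> v" using axd starv by (auto simp: star_def nbr_def)
    then have a: "a \<in> ?L" using axd by (simp add: A_def)
    have aV: "a \<in> V" using a LV by blast
    \<comment> \<open>The power of \<open>v\<close> lies in the star group of \<open>a\<close> and
      is dropped. So \<open>M\<close> needs only base points in \<open>par ?L\<close>, which commute
      with \<open>?g\<close>.\<close>
    obtain m k where m: "m \<in> par ?L" "x = m \<cdot> gpow v k"
      using par_insert_decomp[OF v, of ?L x] axd(2) by (auto simp: A_def)
    have mC: "m \<in> C" by (rule par_in[OF m(1)])
    have "gpow v k \<in> par (star a)" by (rule gpow_par[OF v]) (use a adj_sym in \<open>auto simp: star_def nbr_def\<close>)
    then have "cls a m = cls a x" using cls_eq_iff[OF aV mC aV] m lcI mC v by auto
    then show ?thesis using a m by (auto simp: M_def)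
  qed
  have MPV: "M \<subseteq> PV" using LV par_in by (auto simp: M_def)
  have gvw: "?g \<in> par {v, w}" by (intro par_mult par_letter) (use v w in auto)
  have fixed: "act ?g r = r" if r: "r \<in> M" for r
  proof -
    obtain l x where l: "l \<in> ?L" "x \<in> par ?L" "r = cls l x" using r by (auto simp: M_def)
    have lV: "l \<in> V" using l LV by blast
    have xC: "x \<in> C" by (rule par_in[OF l(2)])
    have "?g \<cdot> x = x \<cdot> ?g" by (rule par_commute[OF gvw l(2)]) (auto simp: nbr_def)
    moreover have "{v, w} \<subseteq> star l" using l adj_sym by (auto simp: star_def nbr_def)
    then have "x \<cdot> ?g \<in> lc x (star l)" using gvw par_mono[of "{v, w}" "star l"] by (intro lcI) blast
    ultimately have "cls l x = cls l (?g \<cdot> x)" using cls_eq_iff[OF lV xC lV, of "?g \<cdot> x"] g xC by simp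
    then show ?thesis using act_cls[OF g lV xC] l by simp
  qed
  have fixed': "act (inver ?g) r = r" if "r \<in> M" for r
    using fixed[OF that] act_inv(2)[OF g, of r] MPV that by auto
  have gnear: "?g \<cdot> x \<notin> near" if x: "x \<in> near" for x
  proof -
    have xC: "x \<in> C" using x by (simp add: near_def)
    let ?s = "(w, False)"
    have ls: "linv ?s = (w, True)" by (simp add: linv_def)
    have s: "fst ?s \<in> V" using w by simp
    have e: "?g \<cdot> cl [?s] = ?V" using letter_cancel(1)[of "(w, True)" ?V] w VW by (simp add: linv_def)
    have "\<not> far one_elt ?s x" using x wD by (auto simp: near_def)
    \<comment> \<open>The wall of the inverse of \<open>w\<close> at the identity, translated by
      \<open>?g\<close>, is the wall between \<open>?V\<close> and \<open>?g\<close>.\<close>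
    then have "\<not> far ?g ?s (?g \<cdot> x)" using far_mult_left[OF g G.one_closed s xC] g by simp
    then have "far ?V (w, True) (?g \<cdot> x)" using far_flip[OF g s, of "?g \<cdot> x"] g xC unfolding e ls by simp
    moreover have "?V \<in> par A" by (rule par_letter) (use v in \<open>auto simp: A_def\<close>)
    ultimately show ?thesis using wD by (auto simp: near_def)
  qed
  define Q where "Q = {q \<in> PV. q \<notin> M \<and> near_class q}"
  define Q' where "Q' = act ?g ` Q"
  have dis: "act ?g q \<notin> Q" if q: "q \<in> Q" for q
  proof
    assume gq: "act ?g q \<in> Q"
    obtain u x where u: "u \<in> V" "x \<in> C" "q = cls u x" using q clsE by (metis (no_types, lifting) Q_def mem_Collect_eq)
    have "x \<in> near" using q near_class_cls[OF u(1,2)] u lc_self by (auto simp: Q_def)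
    moreover have "?g \<cdot> x \<in> near"
      using gq near_class_cls[OF u(1), of "?g \<cdot> x"] act_cls[OF g u(1,2)] u g lc_self[of "?g \<cdot> x"] by (auto simp: Q_def)
    ultimately show False using gnear by blast
  qed
  have Q'_iff: "q \<in> Q' \<longleftrightarrow> act (inver ?g) q \<in> Q" if "q \<in> PV" for q
  proof
    assume "q \<in> Q'"
    then obtain r where "r \<in> Q" "q = act ?g r" by (auto simp: Q'_def)
    then show "act (inver ?g) q \<in> Q" using act_inv(2)[OF g, of r] by (auto simp: Q_def)
  next
    assume "act (inver ?g) q \<in> Q"
    then show "q \<in> Q'" using act_inv(1)[OF g that] unfolding Q'_def by (metis image_eqI)
  qed
  define f where "f q = (if q \<in> Q then act ?g q else if q \<in> Q' then act (inver ?g) q else q)" for q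
  have QPV: "Q \<subseteq> PV" "Q' \<subseteq> PV" using g by (auto simp: Q_def Q'_def)
  have fPV: "f q \<in> PV" if "q \<in> PV" for q using that g gi by (simp add: f_def)
  have Q'Q: "q \<notin> Q" if "q \<in> Q'" for q using that dis by (auto simp: Q'_def)
  have ff: "f (f q) = q" if q: "q \<in> PV" for q
  proof -
    consider "q \<in> Q" | "q \<in> Q'" | "q \<notin> Q" "q \<notin> Q'" by blast
    then show ?thesis
    proof cases
      case 1
      then have "act ?g q \<in> Q'" by (simp add: Q'_def)
      then show ?thesis using 1 Q'Q act_inv(2)[OF g q] by (simp add: f_def)
    next
      case 2
      then have "act (inver ?g) q \<in> Q" using Q'_iff[OF q] by simp
      then show ?thesis using 2 Q'Q act_inv(1)[OF g q] by (simp add: f_def)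
    qed (simp add: f_def)
  qed
  have M_out: "r \<notin> Q \<and> r \<notin> Q'" if "r \<in> M" for r
    using that fixed'[OF that] Q'_iff[of r] MPV by (auto simp: Q_def)
  have M_iff: "act (inver ?g) r \<in> M \<longrightarrow> r \<in> M" if "r \<in> PV" for r
    using fixed[of "act (inver ?g) r"] act_inv(1)[OF g that] by auto
  have near: "r \<in> Q \<or> r \<in> M" if "q \<in> Q" "r \<in> PV" "padj q r" for q r
    using near_class_closed[where M = M and q = q and r = r] HM that by (auto simp: Q_def)
  have fadj1: "padj (f q) (f r)" if qr: "q \<in> PV" "r \<in> PV" "padj q r" "q \<in> Q \<union> Q'" for q r
  proof (cases "q \<in> Q")
    case True
    then have "r \<in> Q \<or> r \<in> M" using near qr by blast
    then have "f r = act ?g r" using fixed M_out by (auto simp: f_def)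
    then show ?thesis using act_padj[OF g qr(1,2,3)] True by (simp add: f_def)
  next
    case False
    then have q': "q \<in> Q'" using qr by blast
    have "act (inver ?g) r \<in> Q \<or> act (inver ?g) r \<in> M"
      using near[of "act (inver ?g) q" "act (inver ?g) r"] q' Q'_iff[OF qr(1)] act_padj[OF gi qr(1,2,3)] gi qr by simp
    then have "r \<in> Q' \<or> r \<in> M" using Q'_iff[OF qr(2)] M_iff[OF qr(2)] by blast
    then have "f r = act (inver ?g) r" using fixed' M_out Q'Q by (auto simp: f_def)
    then show ?thesis using act_padj[OF gi qr(1,2,3)] False q' by (simp add: f_def)
  qed
  have fadj: "padj (f q) (f r)" if qr: "q \<in> PV" "r \<in> PV" "padj q r" for q r
  proof -
    consider "q \<in> Q \<union> Q'" | "r \<in> Q \<union> Q'" | "q \<notin> Q \<union> Q'" "r \<notin> Q \<union> Q'" by blast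
    then show ?thesis
    proof cases
      case 2
      have "padj (f r) (f q)" using fadj1[OF qr(2,1) padj_sym[OF qr] 2] .
      then show ?thesis using padj_sym[OF fPV[OF qr(2)] fPV[OF qr(1)]] by blast
    qed (use fadj1 qr in \<open>auto simp: f_def\<close>)
  qed
  interpret automorphism \<Gamma> f
    by (rule automorphismI[of _ f]) (use fPV ff fadj in auto)
  have "cls v one_elt \<notin> M"
  proof
    assume "cls v one_elt \<in> M"
    then obtain l x where l: "l \<in> ?L" "x \<in> par ?L" "cls v one_elt = cls l x" unfolding M_def by blast
    then have "v = l" using cls_eq_iff[OF v G.one_closed _ par_in[OF l(2)], of l] LV by blast
    then show False using l(1) nL by blast
  qed
  then have vQ: "cls v one_elt \<in> Q" using near_class_base[OF v starv] v by (simp add: Q_def)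
  have wQ: "cls w one_elt \<notin> Q" using not_near_class[OF wD] by (simp add: Q_def)
  have "cls w one_elt \<notin> Q'"
  proof
    assume "cls w one_elt \<in> Q'"
    then have "cls w (inver ?g) \<in> Q" using Q'_iff[of "cls w one_elt"] act_cls[OF gi w G.one_closed] w gi by simp
    then have n: "inver ?g \<in> near" using near_class_cls[OF w gi] lc_self[OF gi] by (auto simp: Q_def)
    \<comment> \<open>The inverse of \<open>?g\<close> begins with the inverse of \<open>w\<close>,
      hence lies across a bounding hyperplane based at the identity.\<close>
    have "inver ?g = cl [(w, False)] \<cdot> cl [(v, False)]"
      using VW cl_linv[of "(v, True)"] cl_linv[of "(w, True)"] v w by (simp add: G.inv_mult_group linv_def)
    moreover have "far one_elt (w, False) (cl [(w, False)])" using far_self(2)[OF G.one_closed, of "(w, False)"] w by simp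
    moreover have "far one_elt (w, False) (cl [(w, False)] \<cdot> cl [(v, False)]) = far one_elt (w, False) (cl [(w, False)])"
      using far_step[OF G.one_closed, of "(w, False)" "cl [(w, False)]" "(v, False)"] v w vw by (auto simp: linv_def)
    ultimately show False using n wD by (auto simp: near_def)
  qed
  then have fw: "f (cls w one_elt) = cls w one_elt" using wQ by (simp add: f_def)
  have fv: "f (cls v one_elt) = cls v ?g" using vQ act_cls[OF g v G.one_closed] g by (simp add: f_def)
  have "lc ?g (star v) \<inter> lc one_elt (star w) = {}"
  proof (rule ccontr)
    assume "\<not> ?thesis"
    then obtain z where z: "z \<in> lc ?g (star v)" "z \<in> lc one_elt (star w)" by blast
    let ?s = "(w, True)"
    have s: "fst ?s \<in> V" using w by simp
    have ws: "w \<notin> star v" "v \<notin> star w" using vw adj_sym by (auto simp: star_def nbr_def)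
    \<comment> \<open>The wall of the edge from \<open>?V\<close> to \<open>?g\<close> separates the
      cosets. The first contains \<open>?g\<close> and has no edge labelled \<open>w\<close>; the
      second contains \<open>one_elt\<close>, which is on the side of \<open>?V\<close>, and its
      class is outside the star of the class of the wall.\<close>
    have "far ?V ?s z = far ?V ?s ?g"
      by (rule far_const[OF VW(1) s g z(1)]) (use g ws in auto)
    then have 1: "far ?V ?s z" using far_self(2)[OF VW(1) s] by simp
    have "cls w one_elt \<notin> verts (St P (cls w ?V))"
    proof
      assume "cls w one_elt \<in> verts (St P (cls w ?V))"
      then have "one_elt \<in> lc ?V (star w)" using cls_in_St[OF w VW(1) w G.one_closed] by simp
      then have "?V \<in> lc one_elt (star w)" by (rule lc_sym[OF VW(1)])
      then have "?V \<in> par (star w)" using lc_iff[OF G.one_closed VW(1)] VW by simp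
      then show False using letter_par[of "(v, True)"] v ws by auto
    qed
    then have "far ?V ?s z = far ?V ?s one_elt"
      using far_const_class[OF VW(1) s w G.one_closed _ z(2)] by simp
    also have "\<dots> = far ?V ?s ?V"
      using far_step[OF VW(1) s G.one_closed, of "(v, True)"] v VW vw by (auto simp: linv_def)
    finally show False using 1 far_self(1)[OF VW(1) s] by simp
  qed
  then have "\<not> visible \<Gamma> \<Gamma> f"
    using not_visible_if[OF v w g G.one_closed fv fw] by blast
  then show ?thesis using iso by blast
qed

text \<open>If no star separates but the common link does, \<open>v\<close> and \<open>w\<close> are
  themselves separated. Otherwise some \<open>z\<close> is not joined to \<open>v\<close>; it lies
  outside \<open>star v\<close>, where it is joined to \<open>w\<close>, and hence to
  \<open>v\<close> outside the common link.\<close>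

lemma not_weak_type_I_not_visible:
  assumes "\<not> weak_type_I \<Gamma>"
  shows "\<exists>\<alpha>. simplicial_iso P P \<alpha> \<and> \<not> visible \<Gamma> \<Gamma> \<alpha>"
proof (cases "\<exists>v\<in>V. \<not> conn (star v)")
  case True
  then show ?thesis using separating_star_not_visible by blast
next
  case False
  then obtain v w where vw: "v \<in> V" "w \<in> V" "v \<noteq> w" "\<not> adj v w" "\<not> conn (nbr v \<inter> nbr w)"
    using assms weak_type_I_iff by blast
  let ?L = "nbr v \<inter> nbr w"
  have "(v, w) \<notin> joined ?L"
  proof
    assume j: "(v, w) \<in> joined ?L"
    obtain c d where cd: "c \<in> V - ?L" "d \<in> V - ?L" "(c, d) \<notin> joined ?L" using vw(5) by (auto simp: conn_def)
    then have "(v, c) \<notin> joined ?L \<or> (v, d) \<notin> joined ?L" using joined_trans joined_sym by blast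
    then obtain z where z: "z \<in> V" "z \<notin> ?L" "(v, z) \<notin> joined ?L" using cd by blast
    have "v \<notin> ?L" by (auto simp: nbr_def)
    then have "z \<notin> star v" using z joined_refl joined_edge[of v z ?L] by (auto simp: star_def nbr_def)
    moreover have "w \<notin> star v" using vw by (auto simp: star_def nbr_def)
    ultimately have "(w, z) \<in> joined (star v)" using False vw z by (auto simp: conn_def)
    then have "(w, z) \<in> joined ?L" using joined_mono[of ?L "star v"] by (auto simp: star_def)
    then show False using j z joined_trans by blast
  qed
  then show ?thesis using separated_pair_not_visible[OF vw(1-4)] by blast
qed

end

theorem theorem3p32:
  fixes \<Gamma> :: "'v set set"
  assumes "finite_simplicial_graph \<Gamma>"
  shows "(weak_type_I \<Gamma> \<longleftrightarrow>
            \<not> (\<exists>x\<in>X_vertices \<Gamma>. \<exists>v\<in>verts (extension_complex \<Gamma>).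
                 \<not> connected_complex (remove (flag_at \<Gamma> x) (St (extension_complex \<Gamma>) v))))
       \<and> (weak_type_I \<Gamma> \<longleftrightarrow>
            (\<forall>\<alpha>. simplicial_iso (extension_complex \<Gamma>) (extension_complex \<Gamma>) \<alpha>
                 \<longrightarrow> visible \<Gamma> \<Gamma> \<alpha>))"
proof -
  interpret raag_graph \<Gamma> by unfold_locales (rule assms)
  have "visible \<Gamma> \<Gamma> \<alpha>" if "weak_type_I \<Gamma>" "simplicial_iso P P \<alpha>" for \<alpha>
  proof -
    interpret automorphism \<Gamma> \<alpha> by unfold_locales (rule that(2))
    show ?thesis by (rule visible_if) (use that(1) weak_type_I_iff_trace in blast)
  qed
  then show ?thesis
    using not_weak_type_I_not_visible unfolding condition_2_iff weak_type_I_iff_trace[symmetric] by blast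
qed

end
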